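(* Let $y$ be any P-I transcendent. Then $a\in\mathbb C$ is a pole of $y$ if and only if there exists $b\in\mathbb C$ such that $\mathcal M(y)=\mathcal T(a,b)$.
   Context: A P-I transcendent is a meromorphic function $y$ on $\mathbb C$ solving the Painlevé first equation $y''=6y^2-z$ (every local solution extends to such a function). Branches: for $k\in\mathbb Z$ and $\lambda\ne0$, choose the argument $\theta=\arg\lambda\in\mathbb R$ with $|\theta-\frac{2\pi k}5|<\frac{3\pi}5$ (asymptotics associated with index $k$ always refer to this sector, viewed on the universal cover of $\mathbb C\setminus\{0\}$), and put $\lambda^{p}=|\lambda|^{p}e^{ip\theta}$ for $p\in\{\pm\frac14,\frac34\}$, $\lambda_k^{1/2}=(-1)^k|\lambda|^{1/2}e^{i\theta/2}$, $\lambda_k^{5/2}=(\lambda_k^{1/2})^5$, so that $\mathrm{Re}\,\lambda_k^{5/2}\to+\infty$ as $|\lambda|\to\infty$ with $\theta=\frac{2\pi k}5$. The map $\mathcal M$. For $z$ not a pole of $y$ consider $$\partial_\lambda\overrightarrow{\Phi}=\begin{pmatrix} y'(z) & 2\lambda^2+2\lambda y(z)-z+2y^2(z)\\ 2(\lambda-y(z)) & -y'(z)\end{pmatrix}\overrightarrow{\Phi}.$$ Let $\overrightarrow{\Phi}_k(\lambda,z)$ be its unique solution such that for every $\varepsilon>0$, as $\lambda\to\infty$ with $|\arg\lambda-\frac{2\pi k}5|<\frac{3\pi}5-\varepsilon$, $$e^{\frac45\lambda_k^{5/2}-z\lambda_k^{1/2}}\begin{pmatrix}\lambda^{-1/4}&0\\0&\lambda^{1/4}\end{pmatrix}\overrightarrow{\Phi}_k(\lambda,z)\to\begin{pmatrix}(-1)^{k+1}\\1\end{pmatrix}.$$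 The Stokes multipliers are defined by $\overrightarrow{\Phi}_{k-1}=\overrightarrow{\Phi}_{k+1}+\sigma_k\overrightarrow{\Phi}_k$. They are independent of $z$, depend only on $k$ modulo $5$, and satisfy $1+\sigma_k\sigma_{k+1}=-i\,\sigma_{k+3}$, $k\in\mathbb Z_5$. One sets $\mathcal M(y)=(\sigma_k)_{k\in\mathbb Z_5}$. The map $\mathcal T$. For $(a,b)\in\mathbb C^2$ consider $\Psi''(\lambda)=(4\lambda^3-2a\lambda-28b)\Psi(\lambda)$ and let $\Psi_k$, $k\in\mathbb Z$, be its unique (entire) solution with, for every $\varepsilon>0$, $\lambda^{3/4}e^{\frac45\lambda_k^{5/2}-a\lambda_k^{1/2}}\Psi_k(\lambda)\to(-1)^{k+1}$ as $\lambda\to\infty$, $|\arg\lambda-\frac{2\pi k}5|<\frac{3\pi}5-\varepsilon$. Its Stokes multipliers are defined by $\Psi_{k-1}=\Psi_{k+1}+\sigma_k\Psi_k$, depend only on $k$ modulo $5$, and $\mathcal T(a,b)=(\sigma_k)_{k\in\mathbb Z_5}$. *)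

theory Defs
  imports "HOL-Complex_Analysis.Complex_Analysis" "HOL-Library.Numeral_Type"
begin

text \<open>
  A transcendent is analytic and satisfies the equation away from its poles; its (irrelevant) values
  at the poles are left unconstrained.
\<close>

definition PI_transcendent :: "(complex \<Rightarrow> complex) \<Rightarrow> bool" where
  "PI_transcendent y \<longleftrightarrow> y meromorphic_on UNIV \<and>
     (\<forall>z. \<not> is_pole y z \<longrightarrow> y analytic_on {z} \<and> (deriv ^^ 2) y z = 6 * y z ^ 2 - z)"

text \<open>
  The branches of index \<open>k\<close> are used only inside the sector of half-opening
  \<open>3 * pi / 5\<close> around the direction \<open>2 * pi * k / 5\<close>. Since \<open>6 * pi / 5 < 2 * pi\<close>, a point of that
  sector determines its argument, so this sector of the universal cover can be identified with
  a set of complex numbers. Indices that agree modulo 5 give the same set but different arguments.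
\<close>

definition sector :: "int \<Rightarrow> real \<Rightarrow> complex set" where
  "sector k \<epsilon> =
     {l. l \<noteq> 0 \<and> (\<exists>\<theta>. is_Arg l \<theta> \<and> \<bar>\<theta> - 2 * pi * of_int k / 5\<bar> < 3 * pi / 5 - \<epsilon>)}"

definition branch_arg :: "int \<Rightarrow> complex \<Rightarrow> real" where
  "branch_arg k l = (THE \<theta>. is_Arg l \<theta> \<and> \<bar>\<theta> - 2 * pi * of_int k / 5\<bar> < 3 * pi / 5)"

lemma branch_arg_eq:
  assumes "l \<noteq> 0" "is_Arg l \<theta>" "\<bar>\<theta> - 2 * pi * of_int k / 5\<bar> < 3 * pi / 5"
  shows "branch_arg k l = \<theta>"
  unfolding branch_arg_def
proof (rule the_equality)
  fix \<phi> assume \<phi>: "is_Arg l \<phi> \<and> \<bar>\<phi> - 2 * pi * of_int k / 5\<bar> < 3 * pi / 5"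
  then have "\<bar>\<phi> - \<theta>\<bar> < 2 * pi"
    using assms(3) pi_gt_zero by linarith
  with \<phi> assms show "\<phi> = \<theta>"
    by (blast intro: is_Arg_eqI)
qed (use assms in auto)

definition branch_power :: "int \<Rightarrow> real \<Rightarrow> complex \<Rightarrow> complex" where
  "branch_power k p l = of_real (norm l powr p) * cis (p * branch_arg k l)"

definition branch_sqrt :: "int \<Rightarrow> complex \<Rightarrow> complex" where
  "branch_sqrt k l = (-1) powi k * of_real (sqrt (norm l)) * cis (branch_arg k l / 2)"

definition sector_at_infinity :: "int \<Rightarrow> real \<Rightarrow> complex filter" where
  "sector_at_infinity k \<epsilon> = inf at_infinity (principal (sector k \<epsilon>))"


definition PI_lax_matrix :: "(complex \<Rightarrow> complex) \<Rightarrow> complex \<Rightarrow> complex \<Rightarrow> complex ^ 2 ^ 2" where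
  "PI_lax_matrix y z l =
     vector [vector [deriv y z, 2 * l ^ 2 + 2 * l * y z - z + 2 * y z ^ 2],
             vector [2 * (l - y z), - deriv y z]]"

definition is_PI_subdominant ::
    "(complex \<Rightarrow> complex) \<Rightarrow> complex \<Rightarrow> int \<Rightarrow> (complex \<Rightarrow> complex ^ 2) \<Rightarrow> bool" where
  "is_PI_subdominant y z k \<Phi> \<longleftrightarrow>
     (\<forall>l i. ((\<lambda>x. \<Phi> x $ i) has_field_derivative (PI_lax_matrix y z l *v \<Phi> l) $ i) (at l)) \<and>
     (\<forall>\<epsilon>>0. ((\<lambda>l. exp (4 / 5 * branch_sqrt k l ^ 5 - z * branch_sqrt k l) *s
                    ((vector [vector [branch_power k (- 1 / 4) l, 0],
                              vector [0, branch_power k (1 / 4) l]] :: complex ^ 2 ^ 2) *v \<Phi> l))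
              \<longlongrightarrow> vector [(-1) powi (k + 1), 1]) (sector_at_infinity k \<epsilon>))"

definition PI_subdominant ::
    "(complex \<Rightarrow> complex) \<Rightarrow> complex \<Rightarrow> int \<Rightarrow> complex \<Rightarrow> complex ^ 2" where
  "PI_subdominant y z k = (THE \<Phi>. is_PI_subdominant y z k \<Phi>)"

definition PI_stokes :: "(complex \<Rightarrow> complex) \<Rightarrow> complex \<Rightarrow> int \<Rightarrow> complex" where
  "PI_stokes y z k =
     (THE \<sigma>. \<forall>l. PI_subdominant y z (k - 1) l =
                  PI_subdominant y z (k + 1) l + \<sigma> *s PI_subdominant y z k l)"

text \<open>
  The numeral type \<open>5\<close> is the ring of integers modulo 5, and \<^term>\<open>of_int :: int \<Rightarrow> 5\<close> is reduction.
  The multiplier attached to a residue class is the common value over all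
  representatives \<open>k\<close> and, for the transcendent, all points \<open>z\<close> that are not poles.
\<close>

lemma of_int_5_eq_iff: "(of_int k :: 5) = of_int m \<longleftrightarrow> k mod 5 = m mod 5"
proof -
  have "Rep_bit1 (of_int j :: 5) = j mod 5" for j :: int
    using bit1.Rep_Abs_mod[where 'a = "2"] by (simp add: bit1.of_int_eq Abs_bit1'_def Abs_bit1_inverse)
  then show ?thesis
    by (metis Rep_bit1_inject)
qed

definition PI_monodromy :: "(complex \<Rightarrow> complex) \<Rightarrow> 5 \<Rightarrow> complex" where
  "PI_monodromy y j =
     (THE \<sigma>. \<forall>k z. of_int k = j \<longrightarrow> \<not> is_pole y z \<longrightarrow> PI_stokes y z k = \<sigma>)"


definition is_cubic_subdominant :: "complex \<Rightarrow> complex \<Rightarrow> int \<Rightarrow> (complex \<Rightarrow> complex) \<Rightarrow> bool" where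
  "is_cubic_subdominant a b k \<Psi> \<longleftrightarrow>
     \<Psi> holomorphic_on UNIV \<and>
     (\<forall>l. (deriv ^^ 2) \<Psi> l = (4 * l ^ 3 - 2 * a * l - 28 * b) * \<Psi> l) \<and>
     (\<forall>\<epsilon>>0. ((\<lambda>l. branch_power k (3 / 4) l *
                    exp (4 / 5 * branch_sqrt k l ^ 5 - a * branch_sqrt k l) * \<Psi> l)
              \<longlongrightarrow> (-1) powi (k + 1)) (sector_at_infinity k \<epsilon>))"

definition cubic_subdominant :: "complex \<Rightarrow> complex \<Rightarrow> int \<Rightarrow> complex \<Rightarrow> complex" where
  "cubic_subdominant a b k = (THE \<Psi>. is_cubic_subdominant a b k \<Psi>)"

definition cubic_stokes :: "complex \<Rightarrow> complex \<Rightarrow> int \<Rightarrow> complex" where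
  "cubic_stokes a b k =
     (THE \<sigma>. \<forall>l. cubic_subdominant a b (k - 1) l =
                  cubic_subdominant a b (k + 1) l + \<sigma> * cubic_subdominant a b k l)"

definition cubic_monodromy :: "complex \<Rightarrow> complex \<Rightarrow> 5 \<Rightarrow> complex" where
  "cubic_monodromy a b j = (THE \<sigma>. \<forall>k. of_int k = j \<longrightarrow> cubic_stokes a b k = \<sigma>)"

end

theory Submission
  imports Defs
begin

text \<open>
  The Lax system and, in the unknowns \<open>(\<Psi>' / 2, \<Psi>)\<close>, the cubic oscillator are traceless systems with the same
  exponential behaviour \<open>exp (\<plusminus> (4/5 l_k^(5/2) - a l_k^(1/2)))\<close> at infinity. Picard iteration around the WKB
  approximation along rotated rays gives for every \<open>k\<close> the solution that decays in the sector of index \<open>k\<close>, and the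
  Stokes multipliers are determined by decay alone: any linear map of solutions that is bounded by
  \<open>exp (C (1 + |l|^2))\<close> preserves them up to a constant, since the decay is of order \<open>exp (- c |l|^(5/2))\<close>.

  The flow of the isomonodromic deformation is such a map. Near a pole \<open>a\<close> the Laurent expansion of \<open>y\<close> gives an
  explicit gauge transformation after which the deformation is holomorphic up to \<open>z = a\<close>, where the system becomes
  the cubic oscillator with \<open>b\<close> the free Laurent coefficient of \<open>y\<close>. Hence the multipliers of \<open>y\<close> are those of
  \<open>(a, b)\<close>. Conversely, if \<open>a\<close> is not a pole, the Lax system at \<open>z = a\<close> and an oscillator with the same multipliers
  have solutions whose cross Wronskians are entire and tend to \<open>0\<close>, so that Liouville's theorem gives a contradiction.
\<close>

section \<open>Linear differential equations in a disc\<close>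

text \<open>The second component has the algebraic exponent -1/4 at infinity for the Lax system and
  -3/4 for the oscillator. Passing from index \<open>k\<close> to \<open>k + 5\<close>, one turn
  around infinity, therefore multiplies the decaying solutions by \<open>- \<i>\<close> and by
  \<open>\<i>\<close> respectively. Because of these opposite signs, the multipliers of the two
  systems, normalised alike, agree only up to a factor -1; the factor
  \<open>(-1) powi (k + 1)\<close> prescribed for \<Psi>_k absorbs it. The same difference of 1/2
  makes the cross Wronskians vanish at infinity when \<open>a\<close> is not a pole. The deformation
  matrix grows like |l|^2, so its flow is at most of size exp (C |l|^2). That 2 is less than 5/2 is
  why decay on a single ray per index survives the flow, and asymptotics uniform in \<open>z\<close>
  never enter. The coefficients of the Lax system blow up at a pole of \<open>y\<close>. They can be
  regularised because the Laurent recurrence has a resonance: one coefficient stays free, and it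
  becomes the constant term of the potential.\<close>

lemma primitive_bound_segment:
  fixes f g :: "complex \<Rightarrow> complex"
  assumes g: "\<And>w. w \<in> closed_segment p q \<Longrightarrow> (g has_field_derivative f w) (at w)"
    and f: "\<And>w. w \<in> closed_segment p q \<Longrightarrow> norm (f w) \<le> A * norm (w - p) ^ n"
  shows "norm (g q - g p) \<le> A * norm (q - p) ^ Suc n / real (Suc n)"
proof -
  define c where "c = (\<lambda>s::real. p + of_real s * (q - p))"
  have c_in: "c s \<in> closed_segment p q" if "0 \<le> s" "s \<le> 1" for s
    using that by (auto simp: c_def closed_segment_def algebra_simps scaleR_conv_of_real intro!: exI[of _ s])
  have vd: "((\<lambda>s. g (c s)) has_vector_derivative (q - p) * f (c s)) (at s)" if "0 \<le> s" "s \<le> 1" for s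
  proof -
    have "(c has_vector_derivative (q - p)) (at s)"
      unfolding c_def by (auto intro!: derivative_eq_intros simp: has_vector_derivative_def scaleR_conv_of_real)
    from field_vector_diff_chain_at[OF this g[OF c_in[OF that]]] show ?thesis
      by (simp add: o_def)
  qed
  have "norm (g (c 1) - g (c 0)) \<le> (A * norm (q - p) ^ Suc n / real (Suc n)) * 1 ^ Suc n
          - (A * norm (q - p) ^ Suc n / real (Suc n)) * 0 ^ Suc n"
  proof (rule differentiable_bound_general[where f = "\<lambda>s. g (c s)" and f' = "\<lambda>s. (q - p) * f (c s)"
        and \<phi> = "\<lambda>s. (A * norm (q - p) ^ Suc n / real (Suc n)) * s ^ Suc n"
        and \<phi>' = "\<lambda>s. A * norm (q - p) ^ Suc n * s ^ n"])
    show "continuous_on {0..1} (\<lambda>s. g (c s))"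
      by (intro continuous_at_imp_continuous_on ballI) (auto intro!: has_vector_derivative_continuous[OF vd])
  next
    fix x :: real assume "0 < x" "x < 1"
    show "((\<lambda>s. A * norm (q - p) ^ Suc n / real (Suc n) * s ^ Suc n)
             has_vector_derivative A * norm (q - p) ^ Suc n * x ^ n) (at x)"
      unfolding has_real_derivative_iff_has_vector_derivative[symmetric]
      by (rule derivative_eq_intros refl | simp add: divide_simps)+
    have "norm (f (c x)) \<le> A * norm (c x - p) ^ n"
      using \<open>0 < x\<close> \<open>x < 1\<close> by (intro f c_in) auto
    also have "norm (c x - p) = x * norm (q - p)"
      using \<open>0 < x\<close> by (simp add: c_def norm_mult)
    finally have "norm (q - p) * norm (f (c x)) \<le> norm (q - p) * (A * (x * norm (q - p)) ^ n)"
      by (intro mult_left_mono) auto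
    then show "norm ((q - p) * f (c x)) \<le> A * norm (q - p) ^ Suc n * x ^ n"
      by (simp add: norm_mult power_mult_distrib mult_ac)
  qed (use vd in \<open>auto intro!: continuous_intros\<close>)
  then show ?thesis by (simp add: c_def)
qed

text \<open>Picard iteration arranged as a series: \<open>U n\<close> and \<open>V n\<close> are the
  successive increments, so the solution is their sum and the equation follows by termwise
  differentiation. Convexity provides both the primitives and the segments from \<open>p\<close>
  along which the increments are bounded by powers of the distance over factorials.\<close>

lemma linear_ode_exists:
  fixes m11 m12 m21 m22 :: "complex \<Rightarrow> complex"
  assumes S: "open S" "convex S" "p \<in> S"
    and hol: "m11 holomorphic_on S" "m12 holomorphic_on S" "m21 holomorphic_on S" "m22 holomorphic_on S"
  obtains u v where
    "\<And>z. z \<in> S \<Longrightarrow> (u has_field_derivative m11 z * u z + m12 z * v z) (at z)"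
    "\<And>z. z \<in> S \<Longrightarrow> (v has_field_derivative m21 z * u z + m22 z * v z) (at z)"
    "u p = a" "v p = b"
proof -
  have prim: "\<exists>G. (\<forall>z\<in>S. (G has_field_derivative f z) (at z)) \<and> G p = 0" if f: "f holomorphic_on S" for f
  proof -
    obtain g where g: "\<And>z. z \<in> S \<Longrightarrow> (g has_field_derivative f z) (at z within S)"
      using holomorphic_convex_primitive'[OF S(2) S(1) f] by metis
    show ?thesis
      using g at_within_open[OF _ S(1)]
      by (intro exI[of _ "\<lambda>z. g z - g p"]) (auto intro!: derivative_eq_intros)
  qed
  \<comment> \<open>\<open>I f\<close> is the primitive that vanishes at \<open>p\<close>; fixing
    one by choice makes the iteration a recursion on functions.\<close>
  define I where "I = (\<lambda>f. SOME G. (\<forall>z\<in>S. (G has_field_derivative f z) (at z)) \<and> G p = 0)"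
  have I: "(\<And>z. z \<in> S \<Longrightarrow> (I f has_field_derivative f z) (at z))" "I f p = 0" if "f holomorphic_on S" for f
    using someI_ex[OF prim[OF that]] unfolding I_def by auto
  define it where "it = rec_nat (\<lambda>z::complex. a, \<lambda>z::complex. b)
     (\<lambda>n uv. (I (\<lambda>z. m11 z * fst uv z + m12 z * snd uv z), I (\<lambda>z. m21 z * fst uv z + m22 z * snd uv z)))"
  define U where "U n = fst (it n)" for n
  define V where "V n = snd (it n)" for n
  have U0: "U 0 = (\<lambda>z. a)" and V0: "V 0 = (\<lambda>z. b)"
    and US: "U (Suc n) = I (\<lambda>z. m11 z * U n z + m12 z * V n z)"
    and VS: "V (Suc n) = I (\<lambda>z. m21 z * U n z + m22 z * V n z)" for n
    by (auto simp: U_def V_def it_def)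
  have hUV: "U n holomorphic_on S \<and> V n holomorphic_on S" for n
  proof (induction n)
    case 0 then show ?case by (simp add: U0 V0)
  next
    case (Suc n)
    then have "(\<lambda>z. m11 z * U n z + m12 z * V n z) holomorphic_on S" "(\<lambda>z. m21 z * U n z + m22 z * V n z) holomorphic_on S"
      by (auto intro!: holomorphic_intros hol)
    from I(1)[OF this(1)] I(1)[OF this(2)] show ?case
      unfolding US VS holomorphic_on_open[OF S(1)] by metis
  qed
  have dU: "(U (Suc n) has_field_derivative m11 z * U n z + m12 z * V n z) (at z)"
    and dV: "(V (Suc n) has_field_derivative m21 z * U n z + m22 z * V n z) (at z)" if "z \<in> S" for n z
    unfolding US VS using hUV[of n] that by (auto intro!: I holomorphic_intros hol)
  have USp: "U (Suc n) p = 0" and VSp: "V (Suc n) p = 0" for n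
    unfolding US VS using hUV[of n] by (auto intro!: I holomorphic_intros hol)
  have loc: "\<exists>d h. 0 < d \<and> summable h \<and> (\<forall>n. \<forall>y\<in>ball x d. norm (U n y) + norm (V n y) \<le> h n)"
    if x: "x \<in> S" for x
  proof -
    obtain d where d: "d > 0" "cball x d \<subseteq> S"
      using S x open_contains_cball by metis
    \<comment> \<open>The hull is compact and contains all segments from \<open>p\<close> to points
      near \<open>x\<close>, so one bound on the coefficients serves every iterate there.\<close>
    define C where "C = convex hull (insert p (cball x d))"
    have CS: "C \<subseteq> S" unfolding C_def using d S by (intro hull_minimal) auto
    have cC: "compact C" "convex C" "p \<in> C" "cball x d \<subseteq> C"
      unfolding C_def using hull_subset[of "insert p (cball x d)" convex]
      by (auto intro!: compact_convex_hull compact_insert)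
    have bd: "\<exists>B. \<forall>z\<in>C. norm (m z) \<le> B" if "m holomorphic_on S" for m :: "complex \<Rightarrow> complex"
    proof -
      have "compact (m ` C)" using that CS cC
        by (meson compact_continuous_image continuous_on_subset holomorphic_on_imp_continuous_on)
      then show ?thesis by (meson bounded_iff compact_imp_bounded imageI)
    qed
    obtain K1 K2 K3 K4 where "\<forall>z\<in>C. norm (m11 z) \<le> K1" "\<forall>z\<in>C. norm (m12 z) \<le> K2"
       "\<forall>z\<in>C. norm (m21 z) \<le> K3" "\<forall>z\<in>C. norm (m22 z) \<le> K4"
      using bd hol by metis
    then obtain K where K: "K \<ge> 0" "\<And>z. z \<in> C \<Longrightarrow> norm (m11 z) \<le> K" "\<And>z. z \<in> C \<Longrightarrow> norm (m12 z) \<le> K"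
       "\<And>z. z \<in> C \<Longrightarrow> norm (m21 z) \<le> K" "\<And>z. z \<in> C \<Longrightarrow> norm (m22 z) \<le> K"
      by (smt (verit, best) norm_ge_zero)
    define c where "c = norm a + norm b"
    define D where "D = norm (x - p) + d"
    have bnd: "norm (U n y) + norm (V n y) \<le> c * (2 * K) ^ n / fact n * norm (y - p) ^ n" if "y \<in> C" for n y
      using that
    proof (induction n arbitrary: y)
      case 0 then show ?case by (simp add: U0 V0 c_def)
    next
      case (Suc n)
      have seg: "closed_segment p y \<subseteq> C" using Suc.prems cC by (simp add: closed_segment_subset)
      define A where "A = K * (c * (2 * K) ^ n / fact n)"
      have est: "norm (s * U n w + t * V n w) \<le> A * norm (w - p) ^ n"
        if "w \<in> closed_segment p y" "norm s \<le> K" "norm t \<le> K" for w s t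
      proof -
        have "norm (s * U n w + t * V n w) \<le> norm s * norm (U n w) + norm t * norm (V n w)"
          by (metis norm_mult norm_triangle_ineq)
        also have "\<dots> \<le> K * norm (U n w) + K * norm (V n w)"
          using that by (intro add_mono mult_right_mono) auto
        also have "\<dots> = K * (norm (U n w) + norm (V n w))" by (simp add: algebra_simps)
        also have "\<dots> \<le> K * (c * (2 * K) ^ n / fact n * norm (w - p) ^ n)"
          using that seg K by (intro mult_left_mono Suc.IH) auto
        finally show ?thesis by (simp add: A_def mult_ac)
      qed
      have "norm (U (Suc n) y - U (Suc n) p) \<le> A * norm (y - p) ^ Suc n / real (Suc n)"
        using seg CS K by (intro primitive_bound_segment[OF dU] est) auto
      moreover have "norm (V (Suc n) y - V (Suc n) p) \<le> A * norm (y - p) ^ Suc n / real (Suc n)"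
        using seg CS K by (intro primitive_bound_segment[OF dV] est) auto
      ultimately have "norm (U (Suc n) y) + norm (V (Suc n) y) \<le> 2 * (A * norm (y - p) ^ Suc n / real (Suc n))"
        by (simp add: USp VSp)
      also have "\<dots> = c * (2 * K) ^ Suc n / fact (Suc n) * norm (y - p) ^ Suc n"
        by (simp add: A_def field_simps)
      finally show ?case .
    qed
    show ?thesis
    proof (intro exI conjI allI ballI)
      show "0 < d" by fact
      show "summable (\<lambda>n. c * (inverse (fact n) * (2 * K * D) ^ n))"
        by (intro summable_mult summable_exp)
      fix n y assume y: "y \<in> ball x d"
      then have "y \<in> C" using cC by auto
      have "norm (y - p) \<le> norm (y - x) + norm (x - p)" using norm_triangle_ineq[of "y - x" "x - p"] by simp
      then have "norm (y - p) \<le> D" using y by (simp add: D_def dist_norm norm_minus_commute)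
      then have "norm (y - p) ^ n \<le> D ^ n" by (intro power_mono) auto
      have "norm (U n y) + norm (V n y) \<le> c * (2 * K) ^ n / fact n * norm (y - p) ^ n" using bnd[OF \<open>y \<in> C\<close>] .
      also have "\<dots> \<le> c * (2 * K) ^ n / fact n * D ^ n"
        using \<open>norm (y - p) ^ n \<le> D ^ n\<close> K(1) by (intro mult_left_mono) (auto simp: c_def)
      finally show "norm (U n y) + norm (V n y) \<le> c * (inverse (fact n) * (2 * K * D) ^ n)"
        by (simp add: field_simps power_mult_distrib)
    qed
  qed
  \<comment> \<open>The series starts at index 1: each term then has as derivative the right-hand
    side formed from the preceding increment. The initial values are added afterwards.\<close>
  have ser: "\<exists>g g'. \<forall>x\<in>S. ((\<lambda>n. X (Suc n) x) sums g x) \<and> ((\<lambda>n. s x * U n x + t x * V n x) sums g' x)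
       \<and> (g has_field_derivative g' x) (at x)"
    if X: "\<And>n x. x \<in> S \<Longrightarrow> (X (Suc n) has_field_derivative s x * U n x + t x * V n x) (at x)"
      and le: "\<And>n x. norm (X n x) \<le> norm (U n x) + norm (V n x)" for X s t
  proof (rule series_and_derivative_comparison_local[OF S(1) X])
    fix x assume "x \<in> S"
    from loc[OF this] obtain d h where dh: "0 < d" "summable h" "\<And>n y. y \<in> ball x d \<Longrightarrow> norm (U n y) + norm (V n y) \<le> h n"
      by blast
    show "\<exists>d h. 0 < d \<and> summable h \<and> (\<forall>\<^sub>F n in sequentially. \<forall>y\<in>ball x d \<inter> S. cmod (X (Suc n) y) \<le> h n)"
      using dh(1) order_trans[OF le dh(3)] dh(2)
      by (intro exI[of _ d] exI[of _ "\<lambda>n. h (Suc n)"]) (auto simp: summable_Suc_iff)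
  qed
  obtain gu gu' where gu_all: "\<forall>x\<in>S. ((\<lambda>n. U (Suc n) x) sums gu x) \<and>
      ((\<lambda>n. m11 x * U n x + m12 x * V n x) sums gu' x) \<and> (gu has_field_derivative gu' x) (at x)"
    using ser[OF dU] by auto
  obtain gv gv' where gv_all: "\<forall>x\<in>S. ((\<lambda>n. V (Suc n) x) sums gv x) \<and>
      ((\<lambda>n. m21 x * U n x + m22 x * V n x) sums gv' x) \<and> (gv has_field_derivative gv' x) (at x)"
    using ser[OF dV] by auto
  note gu = gu_all[rule_format, THEN conjunct1] gu_all[rule_format, THEN conjunct2, THEN conjunct1]
    gu_all[rule_format, THEN conjunct2, THEN conjunct2]
  note gv = gv_all[rule_format, THEN conjunct1] gv_all[rule_format, THEN conjunct2, THEN conjunct1]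
    gv_all[rule_format, THEN conjunct2, THEN conjunct2]
  have sU: "(\<lambda>n. U n x) sums (gu x + a)" and sV: "(\<lambda>n. V n x) sums (gv x + b)" if "x \<in> S" for x
    using sums_Suc[OF gu(1)[OF that]] sums_Suc[OF gv(1)[OF that]] by (simp_all add: U0 V0)
  have eu: "gu' x = m11 x * (gu x + a) + m12 x * (gv x + b)"
    and ev: "gv' x = m21 x * (gu x + a) + m22 x * (gv x + b)" if "x \<in> S" for x
    using gu(2)[OF that] gv(2)[OF that] sums_add[OF sums_mult[OF sU[OF that]] sums_mult[OF sV[OF that]]]
    by (metis sums_unique2)+
  have "(\<lambda>n. U (Suc n) p) sums 0" "(\<lambda>n. V (Suc n) p) sums 0" by (simp_all add: USp VSp)
  with gu(1)[OF S(3)] gv(1)[OF S(3)] have "gu p = 0" "gv p = 0" by (metis sums_unique2)+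
  then show ?thesis
    using gu(3) gv(3) eu ev
    by (intro that[of "\<lambda>x. gu x + a" "\<lambda>x. gv x + b"]) (auto intro!: derivative_eq_intros)
qed

text \<open>The squared norm is used because it is differentiable also at zeros of the solution. The
  case \<open>G = 0\<close> bounds the growth of the deformation flow; \<open>G\<close> of order
  |h|^2 controls Taylor remainders in \<open>l\<close>.\<close>

lemma linear_ode_gronwall:
  fixes f1 f2 m11 m12 m21 m22 h1 h2 :: "complex \<Rightarrow> complex"
  assumes d1: "\<And>z. z \<in> closed_segment p q \<Longrightarrow> (f1 has_field_derivative m11 z * f1 z + m12 z * f2 z + h1 z) (at z)"
    and d2: "\<And>z. z \<in> closed_segment p q \<Longrightarrow> (f2 has_field_derivative m21 z * f1 z + m22 z * f2 z + h2 z) (at z)"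
    and K: "\<And>z. z \<in> closed_segment p q \<Longrightarrow> norm (m11 z) \<le> K" "\<And>z. z \<in> closed_segment p q \<Longrightarrow> norm (m12 z) \<le> K"
       "\<And>z. z \<in> closed_segment p q \<Longrightarrow> norm (m21 z) \<le> K" "\<And>z. z \<in> closed_segment p q \<Longrightarrow> norm (m22 z) \<le> K"
    and G: "\<And>z. z \<in> closed_segment p q \<Longrightarrow> norm (h1 z) \<le> G" "\<And>z. z \<in> closed_segment p q \<Longrightarrow> norm (h2 z) \<le> G"
  shows "norm (f1 q)^2 + norm (f2 q)^2
           \<le> exp (norm (q - p) * (4 * K + 1)) * (norm (f1 p)^2 + norm (f2 p)^2 + 2 * norm (q - p) * G^2)"
proof -
  define L where "L = norm (q - p)"
  define k where "k = L * (4 * K + 1)"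
  have L: "L \<ge> 0" by (simp add: L_def)
  have K0: "K \<ge> 0" using K(1)[of p] norm_ge_zero order_trans by (metis ends_in_segment(1))
  define c where "c = (\<lambda>s::real. p + of_real s * (q - p))"
  have c_in: "c s \<in> closed_segment p q" if "0 \<le> s" "s \<le> 1" for s
    using that by (auto simp: c_def closed_segment_def algebra_simps scaleR_conv_of_real intro!: exI[of _ s])
  have cd: "(c has_vector_derivative (q - p)) (at s)" for s
    unfolding c_def by (auto intro!: derivative_eq_intros simp: has_vector_derivative_def scaleR_conv_of_real)
  define e1 where "e1 z = m11 z * f1 z + m12 z * f2 z + h1 z" for z
  define e2 where "e2 z = m21 z * f1 z + m22 z * f2 z + h2 z" for z
  define N where "N = (\<lambda>s. f1 (c s) \<bullet> f1 (c s) + f2 (c s) \<bullet> f2 (c s))"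
  define N' where "N' = (\<lambda>s. 2 * (f1 (c s) \<bullet> ((q - p) * e1 (c s))) + 2 * (f2 (c s) \<bullet> ((q - p) * e2 (c s))))"
  have v1: "((\<lambda>s. f1 (c s)) has_vector_derivative (q - p) * e1 (c s)) (at s)" if "0 \<le> s" "s \<le> 1" for s
    using field_vector_diff_chain_at[OF cd d1[OF c_in[OF that]]] by (simp add: o_def e1_def)
  have v2: "((\<lambda>s. f2 (c s)) has_vector_derivative (q - p) * e2 (c s)) (at s)" if "0 \<le> s" "s \<le> 1" for s
    using field_vector_diff_chain_at[OF cd d2[OF c_in[OF that]]] by (simp add: o_def e2_def)
  have N: "(N has_real_derivative N' s) (at s)" if "0 \<le> s" "s \<le> 1" for s
    unfolding N_def N'_def has_real_derivative_iff_has_vector_derivative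
    using bounded_bilinear.has_vector_derivative[OF bounded_bilinear_inner v1[OF that] v1[OF that]]
     bounded_bilinear.has_vector_derivative[OF bounded_bilinear_inner v2[OF that] v2[OF that]]
    by (auto intro!: derivative_eq_intros simp: inner_commute)
  have N_eq: "N s = norm (f1 (c s))^2 + norm (f2 (c s))^2" for s
    by (simp add: N_def dot_square_norm)
  have N'_le: "N' s \<le> k * N s + 2 * L * G^2" if s: "0 \<le> s" "s \<le> 1" for s
  proof -
    define z where "z = c s"
    have z: "z \<in> closed_segment p q" using c_in[OF s] by (simp add: z_def)
    define x y where "x = norm (f1 z)" and "y = norm (f2 z)"
    have G0: "G \<ge> 0" using G(1)[OF z] norm_ge_zero order_trans by blast
    have ne: "norm (s * f1 z + t * f2 z + h) \<le> K * x + K * y + G" if "norm s \<le> K" "norm t \<le> K" "norm h \<le> G" for s t h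
    proof -
      have "norm (s * f1 z + t * f2 z + h) \<le> norm s * x + norm t * y + norm h"
        unfolding x_def y_def by (metis (no_types, opaque_lifting) add_mono_thms_linordered_semiring(3) norm_mult norm_triangle_ineq order_trans)
      also have "\<dots> \<le> K * x + K * y + G"
        using that by (intro add_mono mult_right_mono) (auto simp: x_def y_def)
      finally show ?thesis .
    qed
    have xy: "x \<ge> 0" "y \<ge> 0" by (auto simp: x_def y_def)
    have "f1 z \<bullet> ((q - p) * e1 z) \<le> norm (f1 z) * norm ((q - p) * e1 z)" by (rule norm_cauchy_schwarz)
    also have "\<dots> \<le> x * (L * (K * x + K * y + G))"
      unfolding x_def[symmetric] norm_mult L_def[symmetric] e1_def
      using xy L K z G by (intro mult_left_mono ne) auto
    finally have 1: "f1 z \<bullet> ((q - p) * e1 z) \<le> x * (L * (K * x + K * y + G))" .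
    have "f2 z \<bullet> ((q - p) * e2 z) \<le> norm (f2 z) * norm ((q - p) * e2 z)" by (rule norm_cauchy_schwarz)
    also have "\<dots> \<le> y * (L * (K * x + K * y + G))"
      unfolding y_def[symmetric] norm_mult L_def[symmetric] e2_def
      using xy L K z G by (intro mult_left_mono ne) auto
    finally have 2: "f2 z \<bullet> ((q - p) * e2 z) \<le> y * (L * (K * x + K * y + G))" .
    have "N' s \<le> L * (2 * (x + y) * (K * x + K * y + G))"
      using 1 2 unfolding N'_def z_def[symmetric] by (simp add: algebra_simps)
    also have "\<dots> \<le> L * ((4 * K + 1) * (x^2 + y^2) + 2 * G^2)"
    proof (rule mult_left_mono[OF _ L])
      \<comment> \<open>These squares give 2 K (x + y)^2 \<le> 4 K (x^2 + y^2) and 2 (x + y) G \<le>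
        x^2 + y^2 + 2 G^2.\<close>
      have "0 \<le> K * (x - y)^2 * 2" "0 \<le> (x - G)^2 + (y - G)^2" using K0 by auto
      then show "2 * (x + y) * (K * x + K * y + G) \<le> (4 * K + 1) * (x^2 + y^2) + 2 * G^2"
        by (simp add: power2_eq_square algebra_simps)
    qed
    also have "\<dots> = k * N s + 2 * L * G^2"
      by (simp add: N_eq k_def x_def y_def z_def algebra_simps)
    finally show ?thesis .
  qed
  have k0: "k \<ge> 0" using K0 L by (simp add: k_def)
  \<comment> \<open>The subtracted linear term absorbs the inhomogeneity, since the exponential
    factor is at most 1 on the segment.\<close>
  have "exp (- k * 1) * N 1 - 2 * L * G^2 * 1 \<le> exp (- k * 0) * N 0 - 2 * L * G^2 * 0"
  proof (rule DERIV_nonpos_imp_nonincreasing[of 0 1 "\<lambda>s. exp (- k * s) * N s - 2 * L * G^2 * s"])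
    fix s :: real assume s: "0 \<le> s" "s \<le> 1"
    have "((\<lambda>s. exp (- k * s) * N s - 2 * L * G^2 * s) has_real_derivative
          exp (- k * s) * N' s - k * exp (- k * s) * N s - 2 * L * G^2) (at s)"
      by (rule derivative_eq_intros N[OF s] refl | simp)+
    moreover have "exp (- k * s) * N' s \<le> exp (- k * s) * (k * N s) + 1 * (2 * L * G^2)"
    proof -
      have "exp (- k * s) * N' s \<le> exp (- k * s) * (k * N s + 2 * L * G^2)"
        by (intro mult_left_mono N'_le s) auto
      also have "\<dots> = exp (- k * s) * (k * N s) + exp (- k * s) * (2 * L * G^2)" by (simp add: algebra_simps)
      also have "\<dots> \<le> exp (- k * s) * (k * N s) + 1 * (2 * L * G^2)"
        using k0 s L by (intro add_left_mono mult_right_mono) (auto simp: mult_nonneg_nonneg)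
      finally show ?thesis .
    qed
    ultimately show "\<exists>y. ((\<lambda>s. exp (- k * s) * N s - 2 * L * G^2 * s) has_real_derivative y) (at s) \<and> y \<le> 0"
      by (intro exI[of _ "exp (- k * s) * N' s - k * exp (- k * s) * N s - 2 * L * G^2"]) (auto simp: algebra_simps)
  qed auto
  then have "exp (-k) * N 1 \<le> N 0 + 2 * L * G^2" by simp
  then have "exp k * (exp (-k) * N 1) \<le> exp k * (N 0 + 2 * L * G^2)" by (intro mult_left_mono) auto
  then have "N 1 \<le> exp k * (N 0 + 2 * L * G^2)" by (simp add: mult.assoc[symmetric] exp_add[symmetric])
  then show ?thesis by (simp add: N_eq c_def k_def L_def)
qed

section \<open>Contraction in cones at infinity\<close>

text \<open>For \<open>K > 0\<close> this is the complement of a wedge with apex \<open>M\<close>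
  around the negative real axis. Translation by positive reals preserves it, so integration to
  infinity along horizontal rays stays inside, and a large \<open>K\<close> makes the omitted wedge
  thin.\<close>

definition cone :: "real \<Rightarrow> real \<Rightarrow> complex set" where
  "cone K M = {v. M < Re v + K * \<bar>Im v\<bar>}"

lemma open_cone: "open (cone K M)"
  unfolding cone_def by (intro open_Collect_less continuous_intros)

lemma cone_add: "v \<in> cone K M \<Longrightarrow> 0 \<le> t \<Longrightarrow> v + of_real t \<in> cone K M"
  by (simp add: cone_def)

lemma cone_norm_gt:
  assumes "v \<in> cone K M" "0 \<le> K"
  shows "M / (1 + K) < norm v"
proof -
  have "M < Re v + K * \<bar>Im v\<bar>" using assms by (simp add: cone_def)
  also have "\<dots> \<le> norm v + K * norm v"
    using assms complex_Re_le_cmod abs_Im_le_cmod by (intro add_mono mult_left_mono) auto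
  finally show ?thesis using assms by (simp add: field_simps)
qed

text \<open>A horizontal ray in the cone never comes back close to the origin: for
  \<open>Re v < 0\<close> the imaginary part, which the shift preserves, already controls
  \<open>norm v\<close>.\<close>

lemma cone_shift_norm:
  assumes "v \<in> cone K M" "0 \<le> K" "0 \<le> M" "0 \<le> t"
  shows "norm v + t \<le> (3 + 2 * K) * norm (v + of_real t)"
proof (cases "Re v \<ge> 0")
  case True
  have "norm v \<le> norm (v + of_real t)"
    using True assms by (simp add: cmod_def power_mono)
  moreover have "t \<le> norm (v + of_real t)"
    using True assms complex_Re_le_cmod[of "v + of_real t"] by simp
  moreover have "2 * norm (v + of_real t) \<le> (3 + 2 * K) * norm (v + of_real t)"
    using assms by (intro mult_right_mono) auto
  ultimately show ?thesis by linarith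
next
  case False
  have 1: "- Re v \<le> K * \<bar>Im v\<bar>" using assms by (simp add: cone_def)
  have "norm v \<le> \<bar>Re v\<bar> + \<bar>Im v\<bar>" by (rule cmod_le)
  also have "\<dots> \<le> (1 + K) * \<bar>Im v\<bar>" using 1 False by (simp add: algebra_simps)
  also have "\<dots> \<le> (1 + K) * norm (v + of_real t)"
    using assms abs_Im_le_cmod[of "v + of_real t"] by (intro mult_left_mono) auto
  finally have 2: "norm v \<le> (1 + K) * norm (v + of_real t)" .
  have "t = norm ((v + of_real t) - v)" using assms by simp
  also have "\<dots> \<le> norm (v + of_real t) + norm v" by (rule norm_triangle_ineq4)
  finally show ?thesis using 2 by (simp add: algebra_simps)
qed

lemma starlike_cone: 
  assumes "0 \<le> M"
  shows "starlike (cone K M)"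
  unfolding starlike_def
proof (intro bexI ballI subsetI)
  show "of_real (M + 1) \<in> cone K M" by (simp add: cone_def)
  fix x y assume x: "x \<in> cone K M" and "y \<in> closed_segment (complex_of_real (M + 1)) x"
  then obtain u where u: "0 \<le> u" "u \<le> 1" "y = (1 - u) *\<^sub>R of_real (M + 1) + u *\<^sub>R x"
    by (auto simp: closed_segment_def)
  have "(1 - u) * M + u * M < (1 - u) * (M + 1) + u * (Re x + K * \<bar>Im x\<bar>)"
  proof (cases "u = 1")
    case True then show ?thesis using x by (simp add: cone_def)
  next
    case False
    then have "(1 - u) * M < (1 - u) * (M + 1)" using u by (intro mult_strict_left_mono) auto
    moreover have "u * M \<le> u * (Re x + K * \<bar>Im x\<bar>)" using u x by (intro mult_left_mono) (auto simp: cone_def)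
    ultimately show ?thesis by linarith
  qed
  moreover have "Re y = (1 - u) * (M + 1) + u * Re x" "\<bar>Im y\<bar> = u * \<bar>Im x\<bar>"
    using u by (simp_all add: abs_mult)
  ultimately show "y \<in> cone K M"
    by (simp add: cone_def algebra_simps)
qed

lemma cone_primitive:
  assumes "f holomorphic_on cone K M" "0 \<le> M"
  shows "\<exists>F. \<forall>v\<in>cone K M. (F has_field_derivative f v) (at v)"
  by (rule holomorphic_starlike_primitive[where k = "{}"])
    (use assms open_cone starlike_cone in \<open>auto intro!: holomorphic_on_imp_continuous_on
      simp: holomorphic_on_imp_differentiable_at\<close>)

lemma has_vector_derivative_shift:
  fixes F :: "complex \<Rightarrow> complex"
  assumes "(F has_field_derivative d) (at (v + of_real t))"
  shows "((\<lambda>t. F (v + of_real t)) has_vector_derivative d) (at t)"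
proof -
  have "((\<lambda>t. v + complex_of_real t) has_vector_derivative 1) (at t)"
    by (auto intro!: derivative_eq_intros simp: has_vector_derivative_def scaleR_conv_of_real)
  from field_vector_diff_chain_at[OF this assms] show ?thesis by (simp add: o_def)
qed

text \<open>\<open>F\<close> plays the role of minus the integral of \<open>f\<close> over the
  horizontal ray from \<open>v\<close> to infinity. It is built as an arbitrary primitive minus its
  limit along \<open>v + n\<close>; that limit is locally constant because \<open>f\<close> tends to
  0 uniformly on the shifted discs, so the derivative is unchanged. \<open>\<phi> v 0\<close> is the
  integral of the majorant \<open>\<psi> v\<close>.\<close>

lemma tail_primitive:
  fixes f :: "complex \<Rightarrow> complex" and \<phi> \<psi> :: "complex \<Rightarrow> real \<Rightarrow> real"
  assumes f: "f holomorphic_on cone K M" "0 \<le> M"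
    and \<phi>: "\<And>v t. v \<in> cone K M \<Longrightarrow> 0 \<le> t \<Longrightarrow> (\<phi> v has_real_derivative - \<psi> v t) (at t)"
    and f_le: "\<And>v t. v \<in> cone K M \<Longrightarrow> 0 \<le> t \<Longrightarrow> norm (f (v + of_real t)) \<le> \<psi> v t"
    and lim: "\<And>v. v \<in> cone K M \<Longrightarrow> (\<phi> v \<longlongrightarrow> 0) at_top"
    and unif: "\<And>v. v \<in> cone K M \<Longrightarrow> \<exists>e>0. \<exists>b. b \<longlonglongrightarrow> 0 \<and>
        (\<forall>w\<in>ball v e \<inter> cone K M. \<forall>n::nat. norm (f (w + of_nat n)) \<le> b n)"
  obtains F where "\<And>v. v \<in> cone K M \<Longrightarrow> (F has_field_derivative f v) (at v)"
    "\<And>v. v \<in> cone K M \<Longrightarrow> norm (F v) \<le> \<phi> v 0"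
proof -
  obtain F where F: "\<And>v. v \<in> cone K M \<Longrightarrow> (F has_field_derivative f v) (at v)"
    using cone_primitive[OF f] by metis
  have cmp: "norm (F (v + of_real t) - F (v + of_real s)) \<le> \<phi> v s - \<phi> v t"
    if v: "v \<in> cone K M" and st: "0 \<le> s" "s \<le> t" for v s t
  proof (cases "s = t")
    case False
    have "norm (F (v + of_real t) - F (v + of_real s)) \<le> (- \<phi> v t) - (- \<phi> v s)"
    proof (rule differentiable_bound_general[where f = "\<lambda>t. F (v + of_real t)" and f' = "\<lambda>t. f (v + of_real t)"
        and \<phi> = "\<lambda>t. - \<phi> v t" and \<phi>' = "\<psi> v"])
      show "s < t" using False st by simp
      show "continuous_on {s..t} (\<lambda>t. F (v + complex_of_real t))"
        using st has_vector_derivative_shift[OF F[OF cone_add[OF v]]]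
        by (intro continuous_at_imp_continuous_on ballI) (meson atLeastAtMost_iff has_vector_derivative_continuous order_trans)
      have "continuous (at x) (\<phi> v)" if "x \<in> {s..t}" for x
        using that st by (intro DERIV_isCont[OF \<phi>[OF v]]) auto
      then show "continuous_on {s..t} (\<lambda>t. - \<phi> v t)"
        by (intro continuous_at_imp_continuous_on ballI continuous_minus)
      fix x assume x: "s < x" "x < t"
      show "((\<lambda>t. F (v + of_real t)) has_vector_derivative f (v + of_real x)) (at x)"
        using x st by (intro has_vector_derivative_shift F cone_add v) auto
      have "((\<lambda>t. - \<phi> v t) has_real_derivative - (- \<psi> v x)) (at x)"
        using x st by (intro DERIV_minus \<phi> v) auto
      then show "((\<lambda>t. - \<phi> v t) has_vector_derivative \<psi> v x) (at x)"
        by (simp add: has_real_derivative_iff_has_vector_derivative)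
      show "norm (f (v + of_real x)) \<le> \<psi> v x" using x st by (intro f_le v) auto
    qed
    then show ?thesis by simp
  qed simp
  have conv: "convergent (\<lambda>n. F (v + of_nat n))" if v: "v \<in> cone K M" for v
  proof -
    have lim': "(\<lambda>n. \<phi> v (real n)) \<longlonglongrightarrow> 0"
      using filterlim_compose[OF lim[OF v] filterlim_real_sequentially] .
    then have "Cauchy (\<lambda>n. \<phi> v (real n))" by (rule LIMSEQ_imp_Cauchy)
    have "Cauchy (\<lambda>n. F (v + of_nat n))"
    proof (rule CauchyI)
      fix e :: real assume "e > 0"
      then obtain N where N: "\<And>m n. m \<ge> N \<Longrightarrow> n \<ge> N \<Longrightarrow> norm (\<phi> v (real m) - \<phi> v (real n)) < e"
        using CauchyD[OF \<open>Cauchy (\<lambda>n. \<phi> v (real n))\<close>] by blast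
      have "norm (F (v + of_nat m) - F (v + of_nat n)) < e" if "m \<ge> N" "n \<ge> N" for m n
      proof (cases "n \<le> m")
        case True
        then show ?thesis using cmp[OF v, of "real n" "real m"] N[OF that] by simp
      next
        case False
        then show ?thesis using cmp[OF v, of "real m" "real n"] N[OF that] by (simp add: norm_minus_commute)
      qed
      then show "\<exists>M. \<forall>m\<ge>M. \<forall>n\<ge>M. norm (F (v + of_nat m) - F (v + of_nat n)) < e" by blast
    qed
    then show ?thesis by (rule Cauchy_convergent)
  qed
  define L where "L v = lim (\<lambda>n. F (v + of_nat n))" for v
  have L: "(\<lambda>n. F (v + of_nat n)) \<longlonglongrightarrow> L v" if "v \<in> cone K M" for v
    using conv[OF that] by (simp add: L_def convergent_LIMSEQ_iff)
  have le: "norm (F v - L v) \<le> \<phi> v 0" if v: "v \<in> cone K M" for v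
  proof -
    have 1: "(\<lambda>n. norm (F (v + of_nat n) - F v)) \<longlonglongrightarrow> norm (L v - F v)"
      by (intro tendsto_intros L v)
    have 2: "(\<lambda>n. \<phi> v 0 - \<phi> v (real n)) \<longlonglongrightarrow> \<phi> v 0 - 0"
      by (intro tendsto_intros filterlim_compose[OF lim[OF v] filterlim_real_sequentially])
    have 3: "norm (F (v + of_nat n) - F v) \<le> \<phi> v 0 - \<phi> v (real n)" for n
      using cmp[OF v, of 0 "real n"] by simp
    have "norm (L v - F v) \<le> \<phi> v 0 - 0"
      using 3 by (intro LIMSEQ_le[OF 1 2]) auto
    then show ?thesis by (simp add: norm_minus_commute)
  qed
  have der: "((\<lambda>v. F v - L v) has_field_derivative f v) (at v)" if v: "v \<in> cone K M" for v
  proof -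
    obtain e b where eb: "e > 0" "b \<longlonglongrightarrow> 0" "\<And>w n. w \<in> ball v e \<inter> cone K M \<Longrightarrow> norm (f (w + of_nat n)) \<le> b n"
      using unif[OF v] by blast
    obtain e' where e': "e' > 0" "ball v e' \<subseteq> cone K M" using open_cone v open_contains_ball by metis
    define r where "r = min e e'"
    have r: "r > 0" "ball v r \<subseteq> ball v e \<inter> cone K M" using eb(1) e' by (auto simp: r_def)
    have "L w = L v" if w: "w \<in> ball v r" for w
    proof -
      have "norm (F (w + of_nat n) - F (v + of_nat n)) \<le> b n * norm (w - v)" for n
      proof (rule field_differentiable_bound[where f = "\<lambda>z. F (z + of_nat n)" and S = "ball v r" and f' = "\<lambda>z. f (z + of_nat n)"])
        fix z assume z: "z \<in> ball v r"
        then have "z + of_nat n \<in> cone K M" using r cone_add[of z K M "real n"] by auto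
        from F[OF this] have "(F \<circ> (\<lambda>z. z + of_nat n) has_field_derivative f (z + of_nat n) * 1) (at z)"
          by (intro DERIV_chain) (auto intro!: derivative_eq_intros)
        then show "((\<lambda>z. F (z + of_nat n)) has_field_derivative f (z + of_nat n)) (at z within ball v r)"
          by (auto simp: o_def intro: has_field_derivative_at_within)
        show "norm (f (z + of_nat n)) \<le> b n" by (rule eb(3)[OF subsetD[OF r(2) z]])
      qed (use w r(1) in simp_all)
      then have "\<forall>\<^sub>F n in sequentially. norm (F (w + of_nat n) - F (v + of_nat n)) \<le> b n * norm (w - v)"
        by (rule always_eventually[rule_format])
      moreover have "(\<lambda>n. b n * norm (w - v)) \<longlonglongrightarrow> 0" by (rule tendsto_mult_left_zero[OF eb(2)])
      ultimately have "(\<lambda>n. F (w + of_nat n) - F (v + of_nat n)) \<longlonglongrightarrow> 0"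
        by (rule Lim_null_comparison)
      moreover have "w \<in> cone K M" using w r(2) by blast
      then have "(\<lambda>n. F (w + of_nat n) - F (v + of_nat n)) \<longlonglongrightarrow> L w - L v"
        by (rule tendsto_diff[OF L L[OF v]])
      ultimately have "0 = L w - L v" by (rule LIMSEQ_unique)
      then show ?thesis by simp
    qed
    then have same: "F w - L v = F w - L w" if "w \<in> ball v r" for w
      using that by simp
    have "((\<lambda>w. F w - L v) has_field_derivative f v) (at v)"
      using DERIV_diff[OF F[OF v] DERIV_const[of "L v"]] by simp
    then show ?thesis
      by (rule has_field_derivative_transform_within_open[where S = "ball v r" and g = "\<lambda>w. F w - L w"])
        (use r(1) same in auto)
  qed
  show ?thesis by (rule that[OF der le])
qed

lemma powr_shift_bound:
  assumes "v \<in> cone K M" "0 \<le> K" "0 < M" "0 \<le> t"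
  shows "norm (v + of_real t) powr (-6/5) \<le> (3 + 2 * K) powr (6/5) * (norm v + t) powr (-6/5)"
proof -
  have v: "norm v > 0" using cone_norm_gt[OF assms(1,2)] assms by (smt (verit) divide_pos_pos)
  have "norm (v + of_real t) \<ge> (norm v + t) / (3 + 2 * K)"
    using cone_shift_norm[OF assms(1,2) _ assms(4)] assms by (simp add: field_simps)
  then have "norm (v + of_real t) powr (-6/5) \<le> ((norm v + t) / (3 + 2 * K)) powr (-6/5)"
    using assms v by (intro powr_mono2') (auto intro!: divide_pos_pos add_pos_nonneg)
  also have "\<dots> = (3 + 2 * K) powr (6/5) * (norm v + t) powr (-6/5)"
    using assms v by (simp add: powr_divide powr_minus field_simps)
  finally show ?thesis .
qed

text \<open>The equation for \<open>P\<close> has the integrating factor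
  \<open>e = exp (- 2 * S)\<close>: \<open>P v\<close> is minus the integral of
  \<open>e w / e v * (R w * D w)\<close> over the horizontal ray, and
  \<open>Re s \<ge> \<mu>\<close> makes this kernel decay exponentially. The power -6/5 that bounds
  \<open>P\<close> is integrable at infinity, so the second integration gains
  \<open>norm v powr (-1/5)\<close>; the 5 in \<open>C2\<close> comes from integrating this
  power.\<close>

lemma cone_iteration_step:
  fixes s R S D :: "complex \<Rightarrow> complex"
  assumes K: "0 \<le> K" "0 < M" and \<mu>: "0 < \<mu>" and C: "0 \<le> C"
    and S: "\<And>v. v \<in> cone K M \<Longrightarrow> (S has_field_derivative s v) (at v)"
    and s: "\<And>v. v \<in> cone K M \<Longrightarrow> \<mu> \<le> Re (s v)"
    and R: "R holomorphic_on cone K M" "\<And>v. v \<in> cone K M \<Longrightarrow> norm (R v) \<le> C * norm v powr (-6/5)"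
    and D: "D holomorphic_on cone K M" "\<And>v. v \<in> cone K M \<Longrightarrow> norm (D v) \<le> B"
    and C1: "C1 = C * (3 + 2 * K) powr (6/5) / (2 * \<mu>)" and C2: "C2 = 5 * C1 * (3 + 2 * K) powr (6/5)"
  shows "\<exists>P N. \<forall>v\<in>cone K M. (P has_field_derivative 2 * s v * P v + R v * D v) (at v) \<and>
      (N has_field_derivative P v) (at v) \<and> norm (P v) \<le> C1 * B * norm v powr (-6/5) \<and>
      norm (N v) \<le> C2 * B * norm v powr (-1/5)"
proof -
  let ?U = "cone K M"
  define c where "c = (3 + 2 * K) powr (6/5)"
  have c: "c > 0" using K by (simp add: c_def)
  have vpos: "norm v > 0" if "v \<in> ?U" for v
    using cone_norm_gt[OF that K(1)] K by (smt (verit) divide_pos_pos)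
  have "of_real (M + 1) \<in> ?U" by (simp add: cone_def)
  from D(2)[OF this] have B: "B \<ge> 0" using norm_ge_zero order_trans by blast
  define e where "e v = exp (- 2 * S v)" for v
  have e_der: "(e has_field_derivative (- 2 * s v) * e v) (at v)" if "v \<in> ?U" for v
    unfolding e_def by (rule derivative_eq_intros S that refl | simp)+
  have e_hol: "e holomorphic_on ?U" using e_der holomorphic_on_open[OF open_cone] by blast
  have ReS: "Re (S v) + \<mu> * t \<le> Re (S (v + of_real t))" if v: "v \<in> ?U" and t: "0 \<le> t" for v t
  proof -
    have "Re (S (v + of_real 0)) - \<mu> * 0 \<le> Re (S (v + of_real t)) - \<mu> * t"
    proof (rule DERIV_nonneg_imp_nondecreasing[OF t])
      fix x :: real assume x: "0 \<le> x" "x \<le> t"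
      have "((\<lambda>t. S (v + of_real t)) has_vector_derivative s (v + of_real x)) (at x)"
        by (rule has_vector_derivative_shift[OF S[OF cone_add[OF v x(1)]]])
      from bounded_linear.has_vector_derivative[OF bounded_linear_Re this]
      have "((\<lambda>t. Re (S (v + of_real t))) has_real_derivative Re (s (v + of_real x))) (at x)"
        by (simp add: has_real_derivative_iff_has_vector_derivative)
      then have "((\<lambda>t. Re (S (v + of_real t)) - \<mu> * t) has_real_derivative Re (s (v + of_real x)) - \<mu>) (at x)"
        using DERIV_diff[OF _ DERIV_cmult_Id] by blast
      then show "\<exists>y. ((\<lambda>t. Re (S (v + of_real t)) - \<mu> * t) has_real_derivative y) (at x) \<and> 0 \<le> y"
        using s[OF cone_add[OF v x(1)]] by (intro exI conjI) auto
    qed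
    then show ?thesis by simp
  qed
  have e_le: "norm (e (v + of_real t)) \<le> norm (e v) * exp (- 2 * \<mu> * t)" if v: "v \<in> ?U" and t: "0 \<le> t" for v t
    using ReS[OF that] by (simp add: e_def norm_exp exp_add[symmetric])
  have RD: "norm (R (v + of_real t) * D (v + of_real t)) \<le> C * c * norm v powr (-6/5) * B" if v: "v \<in> ?U" and t: "0 \<le> t" for v t
  proof -
    have "norm (R (v + of_real t)) \<le> C * norm (v + of_real t) powr (-6/5)" using R(2) cone_add that by blast
    also have "\<dots> \<le> C * (c * (norm v + t) powr (-6/5))"
      unfolding c_def using powr_shift_bound[OF v K t] C by (intro mult_left_mono) auto
    also have "\<dots> \<le> C * (c * norm v powr (-6/5))"
      using C c vpos[OF v] t by (intro mult_left_mono powr_mono2') auto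
    finally show ?thesis
      unfolding norm_mult using D(2)[OF cone_add[OF that]] C c by (intro mult_mono) (auto simp: mult_ac)
  qed
  define f where "f v = e v * (R v * D v)" for v
  obtain F where F: "\<And>v. v \<in> ?U \<Longrightarrow> (F has_field_derivative f v) (at v)"
    "\<And>v. v \<in> ?U \<Longrightarrow> norm (F v) \<le> norm (e v) * (C * c * norm v powr (-6/5) * B) / (2 * \<mu>) * exp (- 2 * \<mu> * 0)"
  proof (rule tail_primitive[of f K M "\<lambda>v t. norm (e v) * (C * c * norm v powr (-6/5) * B) / (2 * \<mu>) * exp (- 2 * \<mu> * t)"
        "\<lambda>v t. norm (e v) * (C * c * norm v powr (-6/5) * B) * exp (- 2 * \<mu> * t)"])
    show "f holomorphic_on ?U" unfolding f_def by (intro holomorphic_intros e_hol R D)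
    show "0 \<le> M" using K by simp
    fix v assume v: "v \<in> ?U"
    show "((\<lambda>t. norm (e v) * (C * c * norm v powr (-6/5) * B) / (2 * \<mu>) * exp (- 2 * \<mu> * t)) \<longlongrightarrow> 0) at_top"
    proof -
      have "((\<lambda>t. exp (- 2 * \<mu> * t)) \<longlongrightarrow> 0) at_top"
        using \<mu> by real_asymp
      from tendsto_mult_right_zero[OF this] show ?thesis .
    qed
    obtain d where d: "d > 0" "cball v d \<subseteq> ?U" using open_cone v open_contains_cball by metis
    have "compact (e ` cball v d)"
      using e_hol d by (meson compact_cball compact_continuous_image continuous_on_subset holomorphic_on_imp_continuous_on)
    then obtain E where E: "\<And>w. w \<in> cball v d \<Longrightarrow> norm (e w) \<le> E"
      by (meson bounded_iff compact_imp_bounded imageI)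
    define m where "m = M / (1 + K)"
    have m: "m > 0" using K by (simp add: m_def)
    show "\<exists>d>0. \<exists>b. b \<longlonglongrightarrow> 0 \<and> (\<forall>w\<in>ball v d \<inter> ?U. \<forall>n::nat. norm (f (w + of_nat n)) \<le> b n)"
    proof (intro exI conjI ballI allI)
      show "d > 0" by fact
      show "(\<lambda>n. E * (C * c * m powr (-6/5) * B) * exp (- 2 * \<mu> * real n)) \<longlonglongrightarrow> 0"
      proof -
        have "(\<lambda>n. exp (- 2 * \<mu> * real n)) \<longlonglongrightarrow> 0" using \<mu> by real_asymp
        from tendsto_mult_right_zero[OF this] show ?thesis .
      qed
      fix w and n :: nat assume w: "w \<in> ball v d \<inter> ?U"
      then have wU: "w \<in> ?U" by simp
      have "norm (f (w + of_nat n)) = norm (e (w + of_real (real n))) * norm (R (w + of_real (real n)) * D (w + of_real (real n)))"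
        by (simp add: f_def norm_mult)
      also have "\<dots> \<le> (norm (e w) * exp (- 2 * \<mu> * real n)) * (C * c * norm w powr (-6/5) * B)"
        by (intro mult_mono e_le RD wU) auto
      also have "\<dots> \<le> (E * exp (- 2 * \<mu> * real n)) * (C * c * m powr (-6/5) * B)"
      proof (intro mult_mono)
        show "norm (e w) \<le> E" using w by (intro E) auto
        then show "0 \<le> E" by (rule order_trans[OF norm_ge_zero])
        then show "0 \<le> E * exp (- 2 * \<mu> * real n)" by simp
        show "norm w powr (-6/5) \<le> m powr (-6/5)"
          using cone_norm_gt[OF wU K(1)] m by (intro powr_mono2') (auto simp: m_def)
      qed (use C c B in auto)
      finally show "norm (f (w + of_nat n)) \<le> E * (C * c * m powr (-6/5) * B) * exp (- 2 * \<mu> * real n)"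
        by (simp add: mult_ac)
    qed
    fix t :: real assume t: "0 \<le> t"
    show "((\<lambda>t. norm (e v) * (C * c * norm v powr (-6/5) * B) / (2 * \<mu>) * exp (- 2 * \<mu> * t)) has_real_derivative
       - (norm (e v) * (C * c * norm v powr (-6/5) * B) * exp (- 2 * \<mu> * t))) (at t)"
      using \<mu> by (auto intro!: derivative_eq_intros)
    show "norm (f (v + of_real t)) \<le> norm (e v) * (C * c * norm v powr (-6/5) * B) * exp (- 2 * \<mu> * t)"
      using mult_mono[OF e_le[OF v t] RD[OF v t]] unfolding f_def norm_mult by (simp add: mult_ac)
  qed blast
  define P where "P v = F v / e v" for v
  have e0: "e v \<noteq> 0" for v by (simp add: e_def)
  have P_der: "(P has_field_derivative 2 * s v * P v + R v * D v) (at v)" if "v \<in> ?U" for v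
    unfolding P_def using that e0[of v]
    by (auto intro!: derivative_eq_intros F(1) e_der simp: f_def field_simps)
  have P_le: "norm (P v) \<le> C1 * B * norm v powr (-6/5)" if "v \<in> ?U" for v
  proof -
    have "norm (P v) = norm (F v) / norm (e v)" by (simp add: P_def norm_divide)
    also have "\<dots> \<le> (norm (e v) * (C * c * norm v powr (-6/5) * B) / (2 * \<mu>)) / norm (e v)"
      using F(2)[OF that] by (intro divide_right_mono) auto
    also have "\<dots> = C1 * B * norm v powr (-6/5)"
      using e0[of v] by (simp add: C1 c_def)
    finally show ?thesis .
  qed
  have P_hol: "P holomorphic_on ?U" using P_der holomorphic_on_open[OF open_cone] by blast
  have C10: "C1 \<ge> 0" using C \<mu> by (simp add: C1)
  obtain N where N: "\<And>v. v \<in> ?U \<Longrightarrow> (N has_field_derivative P v) (at v)"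
    "\<And>v. v \<in> ?U \<Longrightarrow> norm (N v) \<le> 5 * (C1 * B * c) * (norm v + 0) powr (-1/5)"
  proof (rule tail_primitive[of P K M "\<lambda>v t. 5 * (C1 * B * c) * (norm v + t) powr (-1/5)"
        "\<lambda>v t. C1 * B * c * (norm v + t) powr (-6/5)"])
    show "P holomorphic_on ?U" "0 \<le> M" using P_hol K by auto
    fix v assume v: "v \<in> ?U"
    have "((\<lambda>t. (norm v + t) powr (-1/5)) \<longlongrightarrow> 0) at_top"
      by (intro tendsto_neg_powr filterlim_tendsto_add_at_top[OF tendsto_const] filterlim_ident) auto
    from tendsto_mult_right_zero[OF this]
    show "((\<lambda>t. 5 * (C1 * B * c) * (norm v + t) powr (-1/5)) \<longlongrightarrow> 0) at_top" .
    show "\<exists>d>0. \<exists>b. b \<longlonglongrightarrow> 0 \<and> (\<forall>w\<in>ball v d \<inter> ?U. \<forall>n::nat. norm (P (w + of_nat n)) \<le> b n)"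
    proof (intro exI conjI ballI allI)
      show "(0::real) < 1" by simp
      show "(\<lambda>n. C1 * B * c * ((M / (1 + K)) + real n) powr (-6/5)) \<longlonglongrightarrow> 0"
      proof -
        have "(\<lambda>n. ((M / (1 + K)) + real n) powr (-6/5)) \<longlonglongrightarrow> 0"
          by (intro tendsto_neg_powr filterlim_tendsto_add_at_top[OF tendsto_const] filterlim_real_sequentially) auto
        from tendsto_mult_right_zero[OF this] show ?thesis .
      qed
      fix w and n :: nat assume "w \<in> ball v 1 \<inter> ?U"
      then have w: "w \<in> ?U" by simp
      have "norm (P (w + of_real (real n))) \<le> C1 * B * norm (w + of_real (real n)) powr (-6/5)"
        by (rule P_le[OF cone_add[OF w]]) simp
      also have "\<dots> \<le> C1 * B * (c * (norm w + real n) powr (-6/5))"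
        unfolding c_def using powr_shift_bound[OF w K, of "real n"] C10 B by (intro mult_left_mono) auto
      also have "\<dots> \<le> C1 * B * (c * (M / (1 + K) + real n) powr (-6/5))"
        using cone_norm_gt[OF w K(1)] C10 B c K 
        by (intro mult_left_mono powr_mono2') (auto intro!: add_pos_nonneg)
      finally show "norm (P (w + of_nat n)) \<le> C1 * B * c * ((M / (1 + K)) + real n) powr (-6/5)"
        by (simp add: mult_ac)
    qed
    fix t :: real assume t: "0 \<le> t"
    have pos: "norm v + t > 0" using vpos[OF v] t by linarith
    have "((\<lambda>t. (norm v + t) powr (-1/5)) has_real_derivative (-1/5) * (norm v + t) powr (-1/5 - 1) * 1) (at t)"
      by (rule derivative_eq_intros refl pos | use pos in \<open>simp add: powr_diff\<close>)+
    from DERIV_cmult[OF this, of "5 * (C1 * B * c)"]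
    show "((\<lambda>t. 5 * (C1 * B * c) * (norm v + t) powr (-1/5)) has_real_derivative
       - (C1 * B * c * (norm v + t) powr (-6/5))) (at t)" by (simp add: mult.assoc)
    have "norm (P (v + of_real t)) \<le> C1 * B * norm (v + of_real t) powr (-6/5)"
      using v t cone_add by (intro P_le) auto
    also have "\<dots> \<le> C1 * B * (c * (norm v + t) powr (-6/5))"
      unfolding c_def using powr_shift_bound[OF v K t] C10 B by (intro mult_left_mono) auto
    finally show "norm (P (v + of_real t)) \<le> C1 * B * c * (norm v + t) powr (-6/5)" by (simp add: mult_ac)
  qed blast
  show ?thesis
    using P_der P_le N unfolding C2 c_def by (intro exI[of _ P] exI[of _ N]) (auto simp: mult_ac)
qed

text \<open>Solves \<open>H'' = 2 s H' + R H\<close> with \<open>H = 1\<close> at infinity, as a sum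
  of increments \<open>D n\<close> starting from 1. By \<open>half\<close> each increment is at most
  half the preceding bound, so the series and its derivatives converge uniformly on the
  cone.\<close>

lemma cone_solution_contraction:
  fixes s R S :: "complex \<Rightarrow> complex"
  assumes K: "0 \<le> K" "0 < M" and \<mu>: "0 < \<mu>" and C: "0 \<le> C"
    and S: "\<And>v. v \<in> cone K M \<Longrightarrow> (S has_field_derivative s v) (at v)"
    and s: "\<And>v. v \<in> cone K M \<Longrightarrow> \<mu> \<le> Re (s v)"
    and R: "R holomorphic_on cone K M" "\<And>v. v \<in> cone K M \<Longrightarrow> norm (R v) \<le> C * norm v powr (-6/5)"
    and C1: "C1 = C * (3 + 2 * K) powr (6/5) / (2 * \<mu>)" and C2: "C2 = 5 * C1 * (3 + 2 * K) powr (6/5)"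
    and half: "\<And>v. v \<in> cone K M \<Longrightarrow> C2 * norm v powr (-1/5) \<le> 1/2"
  shows "\<exists>H P. \<forall>v\<in>cone K M. (H has_field_derivative P v) (at v) \<and>
      (P has_field_derivative 2 * s v * P v + R v * H v) (at v) \<and>
      norm (H v - 1) \<le> 2 * C2 * norm v powr (-1/5) \<and> norm (P v) \<le> 2 * C1 * norm v powr (-6/5)"
proof -
  let ?U = "cone K M"
  have C10: "C1 \<ge> 0" "C2 \<ge> 0" using C \<mu> by (auto simp: C1 C2)
  define good where "good D P N B \<longleftrightarrow> (\<forall>v\<in>?U. (P has_field_derivative 2 * s v * P v + R v * D v) (at v) \<and>
      (N has_field_derivative P v) (at v) \<and> norm (P v) \<le> C1 * B * norm v powr (-6/5) \<and>
      norm (N v) \<le> C2 * B * norm v powr (-1/5))" for D P N :: "complex \<Rightarrow> complex" and B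
  have ex: "\<exists>P N. good D P N B" if "D holomorphic_on ?U" "\<And>v. v \<in> ?U \<Longrightarrow> norm (D v) \<le> B" for D B
    unfolding good_def by (rule cone_iteration_step[OF K \<mu> C S s R that C1 C2])
  define nxt where "nxt D n = (SOME PN. good D (fst PN) (snd PN) ((1/2) ^ n))" for D :: "complex \<Rightarrow> complex" and n
  define D where "D = rec_nat (\<lambda>v::complex. 1::complex) (\<lambda>n D. snd (nxt D n))"
  define P where "P n = fst (nxt (D n) n)" for n
  have D0: "D 0 = (\<lambda>v. 1)" and DS: "D (Suc n) = snd (nxt (D n) n)" for n by (auto simp: D_def)
  have D_inv: "D n holomorphic_on ?U \<and> (\<forall>v\<in>?U. norm (D n v) \<le> (1/2) ^ n) \<and> good (D n) (P n) (D (Suc n)) ((1/2) ^ n)" for n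
  proof (induction n)
    case 0
    have "\<exists>PN. good (D 0) (fst PN) (snd PN) ((1/2)^0)" using ex[of "D 0" "(1/2)^0"] by (auto simp: D0)
    from someI_ex[OF this] have "good (D 0) (P 0) (D (Suc 0)) ((1/2)^0)" unfolding P_def DS nxt_def .
    then show ?case by (auto simp: D0)
  next
    case (Suc n)
    then have g: "good (D n) (P n) (D (Suc n)) ((1/2) ^ n)" by blast
    have hol: "D (Suc n) holomorphic_on ?U"
      using g unfolding good_def holomorphic_on_open[OF open_cone] by blast
    have bd: "norm (D (Suc n) v) \<le> (1/2) ^ Suc n" if v: "v \<in> ?U" for v
    proof -
      have "norm (D (Suc n) v) \<le> (C2 * norm v powr (-1/5)) * (1/2) ^ n" using g v by (auto simp: good_def mult_ac)
      also have "\<dots> \<le> (1/2) * (1/2) ^ n" using half[OF v] by (intro mult_right_mono) auto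
      finally show ?thesis by simp
    qed
    have "\<exists>PN. good (D (Suc n)) (fst PN) (snd PN) ((1/2)^Suc n)" using ex[OF hol bd] by auto
    from someI_ex[OF this] have "good (D (Suc n)) (P (Suc n)) (D (Suc (Suc n))) ((1/2)^Suc n)"
      unfolding P_def DS nxt_def .
    with hol bd show ?case by blast
  qed
  have dP: "(P n has_field_derivative 2 * s v * P n v + R v * D n v) (at v)" 
    and dD: "(D (Suc n) has_field_derivative P n v) (at v)"
    and bP: "norm (P n v) \<le> C1 * (1/2)^n * norm v powr (-6/5)"
    and bD: "norm (D (Suc n) v) \<le> C2 * (1/2)^n * norm v powr (-1/5)"
    and bD': "norm (D n v) \<le> (1/2)^n"
    if "v \<in> ?U" for n v
    using D_inv[of n] that unfolding good_def by auto
  define m where "m = M / (1 + K)"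
  have m: "m > 0" using K by (simp add: m_def)
  obtain H H' where "\<forall>v\<in>?U. ((\<lambda>n. D (Suc n) v) sums H v) \<and> ((\<lambda>n. P n v) sums H' v) \<and> (H has_field_derivative H' v) (at v)"
  proof (rule series_and_derivative_comparison[of ?U "\<lambda>n. (1/2) ^ Suc n" "\<lambda>n. D (Suc n)" P])
    show "summable (\<lambda>n. (1/2::real) ^ Suc n)" by (subst summable_Suc_iff) (simp add: summable_geometric)
    show "\<forall>\<^sub>F n in sequentially. \<forall>v\<in>?U. norm (D (Suc n) v) \<le> (1/2) ^ Suc n"
      using bD' by (intro always_eventually allI ballI) blast
  qed (use open_cone dD in auto)
  then have H: "\<And>v. v \<in> ?U \<Longrightarrow> (\<lambda>n. D (Suc n) v) sums H v" "\<And>v. v \<in> ?U \<Longrightarrow> (\<lambda>n. P n v) sums H' v"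
     "\<And>v. v \<in> ?U \<Longrightarrow> (H has_field_derivative H' v) (at v)" by blast+
  obtain Q Q' where "\<forall>v\<in>?U. ((\<lambda>n. P n v) sums Q v) \<and> ((\<lambda>n. 2 * s v * P n v + R v * D n v) sums Q' v) \<and> (Q has_field_derivative Q' v) (at v)"
  proof (rule series_and_derivative_comparison[of ?U "\<lambda>n. C1 * m powr (-6/5) * (1/2) ^ n" P "\<lambda>n v. 2 * s v * P n v + R v * D n v"])
    show "summable (\<lambda>n. C1 * m powr (-6/5) * (1/2::real) ^ n)" by (intro summable_mult summable_geometric) simp
    have "norm (P n v) \<le> C1 * m powr (-6/5) * (1/2) ^ n" if v: "v \<in> ?U" for n v
    proof -
      have "norm (P n v) \<le> C1 * (1/2)^n * norm v powr (-6/5)" by (rule bP[OF v])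
      also have "\<dots> \<le> C1 * (1/2)^n * m powr (-6/5)"
        using cone_norm_gt[OF v K(1)] m C10 by (intro mult_left_mono powr_mono2') (auto simp: m_def)
      finally show ?thesis by (simp add: mult_ac)
    qed
    then show "\<forall>\<^sub>F n in sequentially. \<forall>v\<in>?U. norm (P n v) \<le> C1 * m powr (-6/5) * (1/2) ^ n" by simp
  qed (use open_cone dP in auto)
  then have Q: "\<And>v. v \<in> ?U \<Longrightarrow> (\<lambda>n. P n v) sums Q v" "\<And>v. v \<in> ?U \<Longrightarrow> (\<lambda>n. 2 * s v * P n v + R v * D n v) sums Q' v"
     "\<And>v. v \<in> ?U \<Longrightarrow> (Q has_field_derivative Q' v) (at v)" by blast+
  have H'Q: "H' v = Q v" if "v \<in> ?U" for v using H(2)[OF that] Q(1)[OF that] by (rule sums_unique2)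
  have H1: "(\<lambda>n. D n v) sums (H v + 1)" if "v \<in> ?U" for v using sums_Suc[OF H(1)[OF that]] by (simp add: D0)
  have Q'e: "Q' v = 2 * s v * Q v + R v * (H v + 1)" if "v \<in> ?U" for v
    using sums_add[OF sums_mult[OF Q(1)[OF that], of "2 * s v"] sums_mult[OF H1[OF that], of "R v"]] Q(2)[OF that]
    by (metis (no_types, lifting) sums_unique2)
  have geo: "(\<lambda>n. A * (1/2)^n) sums (2 * A)" for A :: real
    using sums_mult[OF geometric_sums[of "1/2::real"], of A] by (simp add: mult.commute)
  have bH: "norm (H v) \<le> 2 * C2 * norm v powr (-1/5)" if v: "v \<in> ?U" for v
  proof -
    have "norm (H v) \<le> 2 * (C2 * norm v powr (-1/5))"
      using norm_sums_le[OF H(1)[OF v] geo, of "C2 * norm v powr (-1/5)"] bD[OF v] by (simp add: mult_ac)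
    then show ?thesis by simp
  qed
  have bQ: "norm (Q v) \<le> 2 * C1 * norm v powr (-6/5)" if v: "v \<in> ?U" for v
  proof -
    have "norm (Q v) \<le> 2 * (C1 * norm v powr (-6/5))"
      using norm_sums_le[OF Q(1)[OF v] geo, of "C1 * norm v powr (-6/5)"] bP[OF v] by (simp add: mult_ac)
    then show ?thesis by simp
  qed
  show ?thesis
  proof (rule exI[of _ "\<lambda>v. H v + 1"], rule exI[of _ Q], intro ballI conjI)
    fix v assume v: "v \<in> ?U"
    show "((\<lambda>v. H v + 1) has_field_derivative Q v) (at v)"
      using H(3)[OF v] H'Q[OF v] by (auto intro!: derivative_eq_intros)
    show "(Q has_field_derivative 2 * s v * Q v + R v * (H v + 1)) (at v)"
      using Q(3)[OF v] Q'e[OF v] by simp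
  qed (use bH bQ in auto)
qed

section \<open>The WKB coordinate\<close>

definition cpow :: "real \<Rightarrow> complex \<Rightarrow> complex" where
  "cpow r v = exp (of_real r * Ln v)"

lemma cpow_nonzero [simp]: "cpow r v \<noteq> 0"
  by (simp add: cpow_def)

lemma cpow_polar: "v \<noteq> 0 \<Longrightarrow> cpow r v = of_real (norm v powr r) * cis (r * Arg v)"
  by (simp add: cpow_def exp_eq_polar Arg_eq_Im_Ln powr_def)

lemma norm_cpow: "v \<noteq> 0 \<Longrightarrow> norm (cpow r v) = norm v powr r"
  by (simp add: cpow_polar norm_mult)

lemma cpow_add: "cpow (r + s) v = cpow r v * cpow s v"
  by (simp add: cpow_def ring_distribs exp_add)

lemma cpow_power: "cpow r v ^ n = cpow (real n * r) v"
  by (simp add: cpow_def exp_of_nat_mult[symmetric] mult.assoc)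

lemma cpow_1: "v \<noteq> 0 \<Longrightarrow> cpow 1 v = v"
  by (simp add: cpow_def)

lemma has_field_derivative_cpow:
  "v \<notin> \<real>\<^sub>\<le>\<^sub>0 \<Longrightarrow> (cpow r has_field_derivative of_real r * cpow r v / v) (at v)"
  unfolding cpow_def by (auto intro!: derivative_eq_intros simp: field_simps)

text \<open>
  The coordinate \<open>v\<close> is \<open>4/5 l_k^(5/2)\<close> turned by \<open>- \<psi>\<close>; the half plane of decay of index \<open>k\<close> becomes
  \<open>\<bar>Arg v + \<psi>\<bar> < pi / 2\<close>, and \<open>coord_sqrt\<close> is \<open>l_k^(1/2)\<close>.
\<close>

definition ray_angle :: "int \<Rightarrow> real \<Rightarrow> real" where
  "ray_angle k \<psi> = 2 * pi * of_int k / 5 + 2 * \<psi> / 5"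

definition coord_sqrt :: "int \<Rightarrow> real \<Rightarrow> complex \<Rightarrow> complex" where
  "coord_sqrt k \<psi> v = (-1) powi k * of_real ((5/4) powr (1/5)) * cis (ray_angle k \<psi> / 2) * cpow (1/5) v"

definition coord_inv :: "int \<Rightarrow> real \<Rightarrow> complex \<Rightarrow> complex" where
  "coord_inv k \<psi> l = of_real (4/5) * cpow (5/2) (l * cis (- ray_angle k \<psi>))"

text \<open>In the coordinate this is \<open>\<bar>Arg v\<bar> < pi - 5/2 * \<delta>\<close>: almost
  the whole slit plane, not only the half plane of decay.\<close>

definition narrow_sector :: "int \<Rightarrow> real \<Rightarrow> real \<Rightarrow> complex set" where
  "narrow_sector k \<psi> \<delta> = {l. l \<noteq> 0 \<and> (\<exists>\<theta>. is_Arg l \<theta> \<and> \<bar>\<theta> - ray_angle k \<psi>\<bar> < 2 * pi / 5 - \<delta>)}"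

lemma powi_minus_one_power: "((-1::complex) powi k) ^ 2 = 1"
  by (cases "even k") (auto simp: power_int_minus_left)

text \<open>This cancels the \<open>pi * k\<close> that multiplying \<open>ray_angle\<close> by 5/2
  produces, so that \<open>coord_sqrt\<close> has the same fifth power for every
  \<open>k\<close>.\<close>

lemma powi_minus_one_power5: "((-1::complex) powi k) ^ 5 = cis (- (pi * of_int k))"
proof -
  have "((-1::complex) powi k) ^ 5 = (-1) powi k"
    by (cases "even k") (auto simp: power_int_minus_left)
  also have "cis (- (pi * of_int k)) = (-1) powi k"
  proof -
    have "cis (- (pi * of_int k)) = cis (-pi) powi k" by (simp add: cis_power_int mult.commute)
    also have "cis (- pi) = -1" by (simp add: complex_eq_iff)
    finally show ?thesis by simp
  qed
  finally show ?thesis by simp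
qed

lemma coord_sqrt_nonzero [simp]: "coord_sqrt k \<psi> v \<noteq> 0"
  by (simp add: coord_sqrt_def)

lemma norm_coord_sqrt: "v \<noteq> 0 \<Longrightarrow> norm (coord_sqrt k \<psi> v) = (5/4 * norm v) powr (1/5)"
  by (subst powr_mult) (simp_all add: coord_sqrt_def norm_mult norm_power_int norm_cpow)

lemma coord_sqrt_power5:
  assumes "v \<noteq> 0"
  shows "coord_sqrt k \<psi> v ^ 5 = 5/4 * cis \<psi> * v"
proof -
  have "coord_sqrt k \<psi> v ^ 5 = ((-1) powi k) ^ 5 * of_real ((5/4) powr (1/5)) ^ 5 * cis (ray_angle k \<psi> / 2) ^ 5 * cpow (1/5) v ^ 5"
    by (simp add: coord_sqrt_def power_mult_distrib)
  also have "cpow (1/5) v ^ 5 = v" using assms by (simp add: cpow_power cpow_1)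
  also have "complex_of_real ((5/4) powr (1/5)) ^ 5 = 5/4"
  proof -
    have "((5/4::real) powr (1/5)) ^ 5 = 5/4" by (simp add: powr_power)
    then show ?thesis by (metis of_real_divide of_real_numeral of_real_power)
  qed
  also have "cis (ray_angle k \<psi> / 2) ^ 5 = cis (pi * of_int k + \<psi>)"
  proof -
    have "5 * (ray_angle k \<psi> / 2) = pi * of_int k + \<psi>" by (simp add: ray_angle_def field_simps)
    then show ?thesis by (metis Complex.DeMoivre of_nat_numeral)
  qed
  also have "((-1) powi k) ^ 5 * (5/4) * cis (pi * of_int k + \<psi>) * v
      = 5/4 * (cis (- (pi * of_int k)) * cis (pi * of_int k + \<psi>)) * v"
    by (simp only: powi_minus_one_power5) (simp add: mult_ac)
  also have "cis (- (pi * of_int k)) * cis (pi * of_int k + \<psi>) = cis \<psi>"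
    by (simp add: cis_mult)
  finally show ?thesis .
qed

lemma has_field_derivative_coord_sqrt:
  "v \<notin> \<real>\<^sub>\<le>\<^sub>0 \<Longrightarrow> (coord_sqrt k \<psi> has_field_derivative coord_sqrt k \<psi> v / (5 * v)) (at v)"
  unfolding coord_sqrt_def[abs_def]
  by (rule DERIV_cmult[THEN DERIV_cong, OF has_field_derivative_cpow]) (auto simp: field_simps)

lemma coord_sqrt_square_polar:
  assumes "v \<noteq> 0"
  shows "coord_sqrt k \<psi> v ^ 2 = of_real ((5/4 * norm v) powr (2/5)) * cis (ray_angle k \<psi> + 2/5 * Arg v)"
proof -
  have 1: "cpow (1/5) v ^ 2 = of_real (norm v powr (2/5)) * cis (2/5 * Arg v)"
  proof -
    have "cpow (1/5) v ^ 2 = cpow (2/5) v" by (simp add: cpow_power)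
    then show ?thesis using cpow_polar[OF assms, of "2/5"] by simp
  qed
  have 2: "complex_of_real ((5/4) powr (1/5)) ^ 2 = of_real ((5/4) powr (2/5))"
    by (subst of_real_power[symmetric], subst powr_power) auto
  have 3: "cis (ray_angle k \<psi> / 2) ^ 2 = cis (ray_angle k \<psi>)" by (simp add: Complex.DeMoivre)
  have 4: "(5/4 * norm v) powr (2/5) = (5/4) powr (2/5) * norm v powr (2/5)" by (rule powr_mult)
  show ?thesis
    unfolding coord_sqrt_def power_mult_distrib powi_minus_one_power 1 2 3 4 cis_mult[symmetric] of_real_mult
    by (simp only: mult_1 mult_ac)
qed

text \<open>With \<open>\<bar>Arg v\<bar> < pi\<close> and
  \<open>\<bar>\<psi>\<bar> < pi / 2\<close> the argument of \<open>l\<close> stays within 2/5 (pi +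
  pi / 2) = 3 pi / 5 of the central direction. So the branches of index \<open>k\<close> are the
  ones that the coordinate sees, for every admissible rotation.\<close>

lemma
  assumes v: "v \<notin> \<real>\<^sub>\<le>\<^sub>0" and \<psi>: "\<bar>\<psi>\<bar> < pi / 2"
  shows branch_arg_coord: "branch_arg k (coord_sqrt k \<psi> v ^ 2) = ray_angle k \<psi> + 2/5 * Arg v"
    and branch_sqrt_coord: "branch_sqrt k (coord_sqrt k \<psi> v ^ 2) = coord_sqrt k \<psi> v"
    and branch_power_coord: "branch_power k p (coord_sqrt k \<psi> v ^ 2) =
           of_real ((5/4) powr (2 * p / 5)) * cis (p * ray_angle k \<psi>) * cpow (2 * p / 5) v"
proof -
  have v0: "v \<noteq> 0" using v by auto
  have "Arg v \<noteq> pi" using v by (auto simp: Arg_eq_pi complex_nonpos_Reals_iff)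
  then have Arg: "\<bar>Arg v\<bar> < pi" using mpi_less_Arg[of v] Arg_le_pi[of v] by linarith
  let ?l = "coord_sqrt k \<psi> v ^ 2"
  have nl: "norm ?l = (5/4 * norm v) powr (2/5)"
    by (simp add: coord_sqrt_square_polar[OF v0] norm_mult)
  show ba: "branch_arg k ?l = ray_angle k \<psi> + 2/5 * Arg v"
  proof (rule branch_arg_eq)
    show "is_Arg ?l (ray_angle k \<psi> + 2/5 * Arg v)"
      unfolding is_Arg_def nl by (simp add: coord_sqrt_square_polar[OF v0] cis_conv_exp mult_ac)
    have "\<bar>2 * \<psi> / 5 + 2/5 * Arg v\<bar> < 3 * pi / 5"
      using Arg \<psi> by linarith
    then show "\<bar>ray_angle k \<psi> + 2/5 * Arg v - 2 * pi * of_int k / 5\<bar> < 3 * pi / 5"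
      by (simp add: ray_angle_def)
  qed simp
  have 1: "sqrt (norm ?l) = (5/4 * norm v) powr (1/5)"
    unfolding nl by (subst powr_half_sqrt[symmetric]) (auto simp: powr_powr)
  have 2: "(5/4 * norm v) powr (1/5) = (5/4) powr (1/5) * norm v powr (1/5)" by (rule powr_mult)
  have 3: "cis ((ray_angle k \<psi> + 2/5 * Arg v) / 2) = cis (ray_angle k \<psi> / 2) * cis (1/5 * Arg v)"
    by (simp add: cis_mult add_divide_distrib)
  show "branch_sqrt k ?l = coord_sqrt k \<psi> v"
    unfolding branch_sqrt_def ba 1 2 3 of_real_mult
    unfolding coord_sqrt_def cpow_polar[OF v0] by (simp only: mult_ac)
  have 4: "norm ?l powr p = (5/4) powr (2 * p / 5) * norm v powr (2 * p / 5)"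
    unfolding nl powr_powr by (subst powr_mult) auto
  have 5: "cis (p * (ray_angle k \<psi> + 2/5 * Arg v)) = cis (p * ray_angle k \<psi>) * cis (2 * p / 5 * Arg v)"
  proof -
    have "p * (ray_angle k \<psi> + 2/5 * Arg v) = p * ray_angle k \<psi> + 2 * p / 5 * Arg v"
      by (simp add: ring_distribs)
    then show ?thesis by (simp only: cis_mult)
  qed
  show "branch_power k p ?l =
           of_real ((5/4) powr (2 * p / 5)) * cis (p * ray_angle k \<psi>) * cpow (2 * p / 5) v"
    unfolding branch_power_def ba 4 5 cpow_polar[OF v0] of_real_mult by (simp only: mult_ac)
qed

lemma Arg_in_narrow_sector:
  assumes "l \<in> narrow_sector k \<psi> \<delta>" "0 \<le> \<delta>"
  shows "\<bar>Arg (l * cis (- ray_angle k \<psi>))\<bar> < 2 * pi / 5 - \<delta>" "l * cis (- ray_angle k \<psi>) \<noteq> 0"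
proof -
  obtain \<theta> where \<theta>: "l \<noteq> 0" "is_Arg l \<theta>" "\<bar>\<theta> - ray_angle k \<psi>\<bar> < 2 * pi / 5 - \<delta>"
    using assms by (auto simp: narrow_sector_def)
  have "l * cis (- ray_angle k \<psi>) = of_real (norm l) * (cis \<theta> * cis (- ray_angle k \<psi>))"
    using \<theta>(2) by (metis cis_conv_exp is_Arg_def mult.assoc)
  also have "cis \<theta> * cis (- ray_angle k \<psi>) = cis (\<theta> - ray_angle k \<psi>)"
    by (subst cis_mult) simp
  finally have eq: "l * cis (- ray_angle k \<psi>) = of_real (norm l) * cis (\<theta> - ray_angle k \<psi>)" .
  have "Arg (l * cis (- ray_angle k \<psi>)) = \<theta> - ray_angle k \<psi>"
    unfolding eq using \<theta> assms pi_gt_zero by (intro Arg_unique[of "norm l"]) (auto simp: cis_conv_exp)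
  with \<theta> show "\<bar>Arg (l * cis (- ray_angle k \<psi>))\<bar> < 2 * pi / 5 - \<delta>" by simp
  show "l * cis (- ray_angle k \<psi>) \<noteq> 0" using \<theta> by simp
qed

lemma
  assumes "l \<in> narrow_sector k \<psi> \<delta>" "0 < \<delta>"
  shows Arg_coord_inv: "\<bar>Arg (coord_inv k \<psi> l)\<bar> < pi - 5/2 * \<delta>"
    and norm_coord_inv: "norm (coord_inv k \<psi> l) = 4/5 * norm l powr (5/2)"
    and coord_sqrt_inv: "coord_sqrt k \<psi> (coord_inv k \<psi> l) ^ 2 = l"
proof -
  let ?x = "l * cis (- ray_angle k \<psi>)"
  have x: "\<bar>Arg ?x\<bar> < 2 * pi / 5 - \<delta>" "?x \<noteq> 0" using Arg_in_narrow_sector assms by auto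
  then have l0: "l \<noteq> 0" by auto
  have eq: "coord_inv k \<psi> l = of_real (4/5 * norm l powr (5/2)) * cis (5/2 * Arg ?x)"
    using x(2) by (simp add: coord_inv_def cpow_polar norm_mult)
  show n: "norm (coord_inv k \<psi> l) = 4/5 * norm l powr (5/2)"
    unfolding eq by (simp add: norm_mult)
  have A: "Arg (coord_inv k \<psi> l) = 5/2 * Arg ?x"
    unfolding eq using x l0 assms(2)
    by (intro Arg_unique[of "4/5 * norm l powr (5/2)"]) (auto simp: cis_conv_exp abs_less_iff)
  then show "\<bar>Arg (coord_inv k \<psi> l)\<bar> < pi - 5/2 * \<delta>" using x(1) by (simp add: abs_mult)
  have "coord_inv k \<psi> l \<noteq> 0" using n l0 by auto
  then have "coord_sqrt k \<psi> (coord_inv k \<psi> l) ^ 2 = of_real ((norm l powr (5/2)) powr (2/5)) * cis (ray_angle k \<psi> + Arg ?x)"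
    by (simp add: coord_sqrt_square_polar n A)
  also have "(norm l powr (5/2)) powr (2/5) = norm l" by (simp add: powr_powr)
  also have "of_real (norm l) * cis (ray_angle k \<psi> + Arg ?x) = cis (ray_angle k \<psi>) * (of_real (norm ?x) * cis (Arg ?x))"
    by (simp add: norm_mult cis_mult[symmetric])
  also have "of_real (norm ?x) * cis (Arg ?x) = ?x"
    using rcis_cmod_Arg[of ?x] by (simp add: rcis_def)
  also have "cis (ray_angle k \<psi>) * ?x = l" by (simp add: cis_mult mult.left_commute)
  finally show "coord_sqrt k \<psi> (coord_inv k \<psi> l) ^ 2 = l" .
qed

section \<open>Solutions with prescribed WKB asymptotics\<close>

text \<open>
  The Lax system at a point that is not a pole (\<open>j = 1\<close>) and the cubic oscillator in the unknowns
  \<open>(\<Psi>' / 2, \<Psi>)\<close> (\<open>j = 0\<close>) are both of this form.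
\<close>

locale lax_system =
  fixes a c d y0 :: complex and j :: nat and m :: "complex \<Rightarrow> complex"
  assumes j: "j = 0 \<or> j = 1"
    and m_hol: "m holomorphic_on UNIV"
    and det_eq: "d^2 + 2 * (l - y0) ^ j * m l = 4 * l^3 - 2 * a * l + c"
begin

definition f :: "complex \<Rightarrow> complex" where "f l = 2 * (l - y0) ^ j"

text \<open>The exponent is forced by \<open>2 * \<nu> + j = 3/2\<close>: this removes the term
  linear in \<open>q\<close> from \<open>remainder\<close> and the term in \<open>1 / v\<close> from
  the coefficient of the first derivative.\<close>

definition \<nu> :: real where "\<nu> = 3/4 - real j / 2"

definition solution :: "(complex \<Rightarrow> complex) \<Rightarrow> (complex \<Rightarrow> complex) \<Rightarrow> bool" where
  "solution u w \<longleftrightarrow> (\<forall>l. (u has_field_derivative d * u l + m l * w l) (at l) \<and>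
     (w has_field_derivative f l * u l - d * w l) (at l))"

definition log_deriv_f :: "complex \<Rightarrow> complex" where "log_deriv_f q = of_nat j / (q^2 - y0)"

text \<open>The logarithmic \<open>l\<close>-derivative of
  \<open>l powr (- \<nu>) * exp (a * q - 4/5 * q^5)\<close> at \<open>l = q^2\<close>;
  \<open>wkb_deriv\<close> is the \<open>l\<close>-derivative of this expression.\<close>

definition wkb :: "complex \<Rightarrow> complex" where
  "wkb q = - of_real \<nu> / q^2 - 2 * q^3 + a / (2 * q)"

definition wkb_deriv :: "complex \<Rightarrow> complex" where
  "wkb_deriv q = of_real \<nu> / q^4 - 3 * q - a / (4 * q^3)"

text \<open>Eliminating \<open>u\<close> leaves a second-order equation for \<open>w\<close>. With
  \<open>w = G * H\<close> and \<open>wkb\<close> the logarithmic derivative of \<open>G\<close>, it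
  reads \<open>H'' = (log_deriv_f - 2 * wkb) * H' + remainder * H\<close>, primes in
  \<open>l\<close>.\<close>

definition remainder :: "complex \<Rightarrow> complex" where
  "remainder q = 4 * q^6 - 2 * a * q^2 + c + log_deriv_f q * (wkb q + d) - wkb q ^ 2 - wkb_deriv q"

text \<open>The exponential and algebraic factors kept in \<open>wkb\<close> are just enough to
  cancel all growing powers of \<open>q\<close>. In \<open>t = 1 / q\<close> the defect is a
  rational function regular at 0, namely \<open>h\<close>.\<close>

lemma remainder_tendsto: "(remainder \<longlongrightarrow> c) at_infinity"
proof -
  define h where "h = (\<lambda>t::complex. c - a^2 * t^2 / 4 + of_nat j * d * t^2 / (1 - y0 * t^2) - of_nat j * of_real \<nu> * t^4 / (1 - y0 * t^2)
     - of_real \<nu> * (of_real \<nu> + 1) * t^4 + a * t^3 - of_nat j * y0 * (2 * t - a * t^5 / 2) / (1 - y0 * t^2))"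
  have "isCont h 0" unfolding h_def by (intro continuous_intros) auto
  then have "(h \<longlongrightarrow> c) (at 0)" by (simp add: isCont_def h_def)
  then have "((\<lambda>q. h (inverse q)) \<longlongrightarrow> c) at_infinity"
    by (rule filterlim_compose[OF _ filterlim_inverse_at_iff[THEN iffD2, OF filterlim_ident]])
  moreover have "\<forall>\<^sub>F q in at_infinity. h (inverse q) = remainder q"
  proof -
    have "\<forall>\<^sub>F q in at_infinity. norm (q::complex) \<ge> norm y0 + 1"
      by (rule eventually_at_infinity[THEN iffD2]) blast
    then show ?thesis
    proof eventually_elim
      case (elim q)
      have q: "q \<noteq> 0" "norm q \<ge> 1" using elim by (auto simp: norm_le_zero_iff) (smt (verit) norm_ge_zero)+
      have "norm q * 1 \<le> norm q * norm q" using q by (intro mult_left_mono) auto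
      then have "norm (q^2) > norm y0" using elim by (simp add: norm_mult power2_eq_square)
      then have y: "q^2 - y0 \<noteq> 0" by auto
      have e1: "1 - y0 * (inverse q)^2 = (q^2 - y0) / q^2" using q by (simp add: field_simps)
      define D where "D = q^2 - y0"
      have y0: "y0 = q^2 - D" by (simp add: D_def)
      have D: "D \<noteq> 0" using y by (simp add: D_def)
      consider "j = 0" | "j = 1" using j by blast
      then show ?case
      proof cases
        case 1
        show ?thesis unfolding h_def remainder_def wkb_def wkb_deriv_def log_deriv_f_def \<nu>_def using q 1
          by (simp add: divide_simps)
             (simp add: algebra_simps power2_eq_square power3_eq_cube power4_eq_xxxx eval_nat_numeral)
      next
        case 2
        \<comment> \<open>With the inverses as variables the identity is polynomial, modulo
          \<open>q * T = 1\<close> and \<open>X * (q^2 - y0) = 1\<close>.\<close>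
        define T X where "T = inverse q" and "X = inverse D"
        have T: "q * T = 1" "inverse q = T" "\<And>x. x / q = x * T" using q by (auto simp: T_def field_simps)
        have X: "X * (q^2 - y0) = 1" "\<And>x. x / D = x * X" using D by (auto simp: X_def D_def field_simps)
        have i: "1 / (1 - y0 * T^2) = q^2 * X"
          using e1 D q by (simp add: T_def X_def D_def field_simps)
        have r: "remainder q = 4 * q^6 - 2 * a * q^2 + c + X * (a * T / 2 - T^2 / 4 - 2 * q^3 + d)
            - (a * T / 2 - T^2 / 4 - 2 * q^3)^2 - (T^4 / 4 - 3 * q - a * T^3 / 4)"
        proof -
          have \<nu>: "of_real \<nu> = (1 / 4 :: complex)" unfolding \<nu>_def using 2 by simp
          have w: "wkb q = a * T / 2 - T^2 / 4 - 2 * q^3"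
            unfolding wkb_def \<nu> T_def using q by (simp add: field_simps)
          have w': "wkb_deriv q = T^4 / 4 - 3 * q - a * T^3 / 4"
            unfolding wkb_deriv_def \<nu> T_def using q by (simp add: field_simps)
          have l: "log_deriv_f q = X"
            unfolding log_deriv_f_def X_def D_def using 2 by (simp add: inverse_eq_divide)
          show ?thesis unfolding remainder_def w w' l ..
        qed
        have "h T = c - a^2 * T^2 / 4 + d * T^2 * (1 / (1 - y0 * T^2)) - 1/4 * T^4 * (1 / (1 - y0 * T^2))
           - 1/4 * (1/4 + 1) * T^4 + a * T^3 - y0 * (2 * T - a * T^5 / 2) * (1 / (1 - y0 * T^2))"
          unfolding h_def \<nu>_def using 2 by simp
        also have "\<dots> = remainder q"
        proof -
          have q3: "q^3 * T = q^2" "q^3 * T^2 = q" "T^2 * q^2 = 1" "T^4 * q^2 = T^2" "T^3 * q^2 = T" "T * q^2 = q" "T^5 * q^2 = T^3"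
            using T(1) by algebra+
          have y0X: "y0 * X = q^2 * X - 1" using X(1) by algebra
          have "(a * T / 2 - T^2 / 4 - 2 * q^3)^2
              = a^2 * T^2 / 4 + T^4 / 16 + 4 * q^6 - a * T^3 / 4 - 2 * a * (q^3 * T) + q^3 * T^2"
            by (simp add: power2_eq_square field_simps) (simp add: algebra_simps eval_nat_numeral)
          then have sq: "(a * T / 2 - T^2 / 4 - 2 * q^3)^2
              = a^2 * T^2 / 4 + T^4 / 16 + 4 * q^6 - a * T^3 / 4 - 2 * a * q^2 + q"
            by (simp only: q3)
          have "y0 * (2 * T - a * T^5 / 2) * (q^2 * X) = (2 * (T * q^2) - a * (T^5 * q^2) / 2) * (y0 * X)"
            by (simp add: algebra_simps)
          also have "\<dots> = 2 * q * q^2 * X - 2 * q - a * (T^3 * q^2) / 2 * X + a * T^3 / 2"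
            unfolding y0X q3(6,7) by (simp add: field_simps)
          finally have l1: "y0 * (2 * T - a * T^5 / 2) * (q^2 * X) = 2 * q^3 * X - 2 * q - a * T / 2 * X + a * T^3 / 2"
            unfolding q3 by (simp add: power2_eq_square power3_eq_cube)
          have l2: "d * T^2 * (q^2 * X) = d * X" using q3(3) by algebra
          have "1/4 * T^4 * (q^2 * X) = 1/4 * (T^4 * q^2) * X" by (simp add: mult_ac)
          then have l3: "1/4 * T^4 * (q^2 * X) = T^2 / 4 * X" unfolding q3 by simp
          show ?thesis unfolding i r l1 l2 l3 sq by (simp add: field_simps)
        qed
        finally show ?thesis by (simp add: T)
      qed
    qed
  qed
  ultimately show ?thesis by (rule Lim_transform_eventually)
qed

lemma f_has_field_derivative:
  assumes "q^2 \<noteq> y0"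
  shows "(f has_field_derivative log_deriv_f q * f (q^2)) (at (q^2))"
  using j assms unfolding f_def[abs_def] log_deriv_f_def
  by (auto intro!: derivative_eq_intros simp: nonzero_eq_divide_eq algebra_simps)

lemma f_nonzero: "l \<noteq> y0 \<Longrightarrow> f l \<noteq> 0"
  by (simp add: f_def)

lemma wkb_has_field_derivative:
  assumes "q \<noteq> 0"
  shows "(wkb has_field_derivative 2 * q * wkb_deriv q) (at q)"
  unfolding wkb_def[abs_def]
  by ((rule derivative_eq_intros refl | (use assms in \<open>simp; fail\<close>))+)
    (use assms in \<open>simp add: wkb_deriv_def divide_simps\<close>, simp add: algebra_simps eval_nat_numeral)

text \<open>Change of variable \<open>l = (q v)^2\<close>, with
  \<open>dl / dv = L = 2 q^2 / (5 v)\<close>. Since \<open>P\<close> is the derivative of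
  \<open>H\<close> in \<open>v\<close>, its coefficient \<open>2 s\<close> is
  \<open>L * (log_deriv_f - 2 * wkb)\<close> plus the logarithmic derivative of \<open>L\<close>.
  \<open>W1\<close> is \<open>(w' + d w) / f\<close>, read off from the second equation.\<close>

lemma wkb_solution:
  fixes q G H P :: "complex \<Rightarrow> complex"
  assumes v: "v \<noteq> 0" and q0: "q v \<noteq> 0" and qy: "(q v)^2 \<noteq> y0"
    and q: "(q has_field_derivative q v / (5 * v)) (at v)"
    and G: "(G has_field_derivative 2 * (q v)^2 / (5 * v) * wkb (q v) * G v) (at v)"
    and H: "(H has_field_derivative P v) (at v)"
    and P: "(P has_field_derivative 2 * s * P v + R * H v) (at v)"
    and s: "s = (4 * (q v)^5 - a * q v) / (5 * v) + of_nat j * y0 / (5 * v * ((q v)^2 - y0))"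
    and R: "R = (2 * (q v)^2 / (5 * v))^2 * remainder (q v)"
  defines "W2 \<equiv> \<lambda>v. G v * H v"
    and "W1 \<equiv> \<lambda>v. G v * ((wkb (q v) + d) * H v + 5 * v / (2 * (q v)^2) * P v) / f ((q v)^2)"
  shows "(W2 has_field_derivative 2 * (q v)^2 / (5 * v) * (f ((q v)^2) * W1 v - d * W2 v)) (at v)"
    and "(W1 has_field_derivative 2 * (q v)^2 / (5 * v) * (d * W1 v + m ((q v)^2) * W2 v)) (at v)"
proof -
  define L where "L = 2 * (q v)^2 / (5 * v)"
  define g where "g = wkb (q v)"
  define p where "p = log_deriv_f (q v)"
  define F where "F = f ((q v)^2)"
  define T where "T = (\<lambda>v. (wkb (q v) + d) * H v + 5 * v / (2 * (q v)^2) * P v)"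
  have L0: "L \<noteq> 0" using v q0 by (simp add: L_def)
  have F0: "F \<noteq> 0" using qy by (simp add: F_def f_nonzero)
  have inv: "5 * v / (2 * (q v)^2) = 1 / L" by (simp add: L_def)
  have W1v: "W1 v = G v * T v / F" by (simp add: W1_def T_def F_def)
  have Tv: "T v = (g + d) * H v + P v / L" unfolding T_def inv g_def by simp
  have "(W2 has_field_derivative L * g * G v * H v + P v * G v) (at v)"
    unfolding W2_def using DERIV_mult[OF G H] by (simp add: L_def g_def)
  moreover have "L * g * G v * H v + P v * G v = L * (F * W1 v - d * W2 v)"
    using L0 F0 by (simp add: W1v Tv W2_def field_simps)
  ultimately show "(W2 has_field_derivative 2 * (q v)^2 / (5 * v) * (f ((q v)^2) * W1 v - d * W2 v)) (at v)"
    by (simp add: L_def F_def)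
  have dq2: "((\<lambda>v. (q v)^2) has_field_derivative L) (at v)"
    using DERIV_power[OF q, of 2] v by (simp add: L_def power2_eq_square field_simps)
  have dwkb: "((\<lambda>v. wkb (q v)) has_field_derivative wkb_deriv (q v) * L) (at v)"
    using DERIV_chain2[OF wkb_has_field_derivative[OF q0] q] v by (simp add: L_def power2_eq_square field_simps)
  have df: "((\<lambda>v. f ((q v)^2)) has_field_derivative p * F * L) (at v)"
    using DERIV_chain2[OF f_has_field_derivative[OF qy] dq2] by (simp add: p_def F_def)
  have dinv: "((\<lambda>v. 5 * v / (2 * (q v)^2)) has_field_derivative 3 / (2 * (q v)^2)) (at v)"
  proof -
    have "((\<lambda>v. 5 * v / (2 * (q v)^2)) has_field_derivative
       (5 * (2 * (q v)^2) - 5 * v * (2 * L)) / ((2 * (q v)^2) * (2 * (q v)^2))) (at v)"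
      using q0 by (intro DERIV_divide DERIV_cmult_Id DERIV_cmult dq2) auto
    moreover have "(5 * (2 * (q v)^2) - 5 * v * (2 * L)) / ((2 * (q v)^2) * (2 * (q v)^2)) = 3 / (2 * (q v)^2)"
      using q0 v by (simp add: L_def divide_simps)
    ultimately show ?thesis by simp
  qed
  \<comment> \<open>Here the choice of \<nu> enters: the terms in \<open>1 / v\<close> cancel by
    \<open>2 * \<nu> + j = 3/2\<close>.\<close>
  have key: "2 * s / L + 3 / (2 * (q v)^2) = p - 2 * g"
  proof -
    define D where "D = (q v)^2 - y0"
    have D: "D \<noteq> 0" "y0 = (q v)^2 - D" using qy by (auto simp: D_def)
    show ?thesis
      unfolding s L_def p_def g_def log_deriv_f_def wkb_def \<nu>_def D_def[symmetric]
      using v q0 D j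
      by (auto simp: divide_simps D(2)) (simp_all add: algebra_simps eval_nat_numeral)
  qed
  have "(T has_field_derivative ((wkb_deriv (q v) * L + 0) * H v + P v * (g + d))
      + ((3 / (2 * (q v)^2)) * P v + (2 * s * P v + R * H v) * (1 / L))) (at v)"
    unfolding T_def g_def inv[symmetric]
    by (rule DERIV_add[OF DERIV_mult[OF DERIV_add[OF dwkb DERIV_const[of d]] H] DERIV_mult[OF dinv P]])
  then have "(T has_field_derivative (wkb_deriv (q v) * L) * H v + (g + d) * P v + (3 / (2 * (q v)^2)) * P v + (2 * s * P v + R * H v) / L) (at v)"
    by (simp add: mult_ac add_ac)
  moreover have "(wkb_deriv (q v) * L) * H v + (g + d) * P v + (3 / (2 * (q v)^2)) * P v + (2 * s * P v + R * H v) / L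
     = (wkb_deriv (q v) * L) * H v + (g + d) * P v + (2 * s / L + 3 / (2 * (q v)^2)) * P v + R * H v / L"
    by (simp add: ring_distribs add_divide_distrib)
  moreover have "R * H v / L = L * remainder (q v) * H v"
  proof -
    have "R = L^2 * remainder (q v)" unfolding R L_def ..
    then show ?thesis using L0 by (simp add: power2_eq_square)
  qed
  moreover have "(wkb_deriv (q v) * L) * H v + (g + d) * P v + (p - 2 * g) * P v + L * remainder (q v) * H v
     = (wkb_deriv (q v) * L) * H v + (d + p - g) * P v + L * remainder (q v) * H v"
    by (simp add: algebra_simps)
  ultimately have dT: "(T has_field_derivative (wkb_deriv (q v) * L) * H v + (d + p - g) * P v + L * remainder (q v) * H v) (at v)"
    by (simp only: key)
  have "(W1 has_field_derivative ((L * g * G v * T v + ((wkb_deriv (q v) * L) * H v + (d + p - g) * P v + L * remainder (q v) * H v) * G v) * F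
      - (G v * T v) * (p * F * L)) / (F * F)) (at v)"
    using DERIV_divide[OF DERIV_mult[OF G dT] df] F0 unfolding W1_def T_def[symmetric] F_def[symmetric] L_def[symmetric] g_def[symmetric]
    by (simp add: F_def L_def g_def T_def)
  moreover have "((L * g * G v * T v + ((wkb_deriv (q v) * L) * H v + (d + p - g) * P v + L * remainder (q v) * H v) * G v) * F
      - (G v * T v) * (p * F * L)) / (F * F) = L * (d * W1 v + m ((q v)^2) * W2 v)"
  proof -
    have det: "F * m ((q v)^2) = 4 * (q v)^6 - 2 * a * (q v)^2 + c - d^2"
      using det_eq[of "(q v)^2"] by (simp add: F_def f_def algebra_simps flip: power_mult)
    have LP: "L * (P v / L) = P v" using L0 by simp
    have rem: "remainder (q v) + wkb_deriv (q v) = F * m ((q v)^2) + d^2 + p * (g + d) - g^2"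
      unfolding det remainder_def g_def p_def by simp
    have "L * g * T v + (wkb_deriv (q v) * L) * H v + (d + p - g) * P v + L * remainder (q v) * H v - p * L * T v - L * d * T v
       = L * H v * ((g - p - d) * (g + d) + (remainder (q v) + wkb_deriv (q v)))
         + (g - p - d) * (L * (P v / L)) + (d + p - g) * P v"
      unfolding Tv by (simp add: algebra_simps)
    also have "\<dots> = L * F * m ((q v)^2) * H v"
      unfolding LP rem by (simp add: algebra_simps power2_eq_square)
    finally have e: "L * g * T v + (wkb_deriv (q v) * L) * H v + (d + p - g) * P v + L * remainder (q v) * H v - p * L * T v
       = L * d * T v + L * F * m ((q v)^2) * H v" by (simp add: algebra_simps)
    have "((L * g * G v * T v + ((wkb_deriv (q v) * L) * H v + (d + p - g) * P v + L * remainder (q v) * H v) * G v) * F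
      - (G v * T v) * (p * F * L)) / (F * F)
      = G v * (L * g * T v + (wkb_deriv (q v) * L) * H v + (d + p - g) * P v + L * remainder (q v) * H v - p * L * T v) / F"
      using F0 by (simp add: divide_simps) (simp add: algebra_simps)
    also have "\<dots> = L * (d * W1 v + m ((q v)^2) * W2 v)"
      unfolding e W1v W2_def using F0 by (simp add: divide_simps) (simp add: algebra_simps)
    finally show ?thesis .
  qed
  ultimately show "(W1 has_field_derivative 2 * (q v)^2 / (5 * v) * (d * W1 v + m ((q v)^2) * W2 v)) (at v)"
    by (simp add: L_def)
qed

end

section \<open>The coordinate near infinity\<close>

lemma filterlim_coord_sqrt: "filterlim (coord_sqrt k \<psi>) at_infinity at_infinity"
proof -
  have "filterlim (\<lambda>v::complex. norm v) at_top at_infinity" by (rule filterlim_norm_at_top)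
  then have "filterlim (\<lambda>v::complex. 5/4 * norm v) at_top at_infinity"
    by (intro filterlim_tendsto_pos_mult_at_top[OF tendsto_const]) auto
  then have "filterlim (\<lambda>v::complex. (5/4 * norm v) powr (1/5)) at_top at_infinity"
    by (intro filterlim_compose[OF real_powr_at_top]) auto
  moreover have "\<forall>\<^sub>F v in at_infinity. (5/4 * norm v) powr (1/5) = norm (coord_sqrt k \<psi> v)"
  proof -
    have "\<forall>\<^sub>F v in at_infinity. norm (v::complex) \<ge> 1" by (rule eventually_at_infinity[THEN iffD2]) blast
    then show ?thesis
    proof eventually_elim
      case (elim v)
      then have "v \<noteq> 0" by auto
      then show ?case by (rule norm_coord_sqrt[symmetric])
    qed
  qed
  ultimately have "filterlim (\<lambda>v. norm (coord_sqrt k \<psi> v)) at_top at_infinity"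
    by (rule filterlim_mono_eventually[OF _ order_refl order_refl])
  then show ?thesis by (simp add: filterlim_at_infinity_conv_norm_at_top)
qed

lemma cone_not_nonpos: "v \<in> cone K M \<Longrightarrow> 0 \<le> M \<Longrightarrow> v \<notin> \<real>\<^sub>\<le>\<^sub>0"
  by (auto simp: cone_def complex_nonpos_Reals_iff)

text \<open>For \<open>\<bar>Arg v\<bar> \<le> pi / 2\<close> the sum of cos and |sin| is at least
  1. Beyond that |sin| \<ge> sin \<eta>, so the numerator 2 outweighs cos \<ge> -1 with 1 left
  over.\<close>

lemma in_cone_if_Arg:
  assumes v: "v \<noteq> 0" "M < norm v" and A: "\<bar>Arg v\<bar> \<le> pi - \<eta>" and \<eta>: "0 < \<eta>" "\<eta> \<le> pi / 2"
  shows "v \<in> cone (2 / sin \<eta>) M"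
proof -
  have vp: "v = of_real (norm v) * cis (Arg v)" using rcis_cmod_Arg[of v] by (simp add: rcis_def)
  have s: "0 < sin \<eta>" "sin \<eta> \<le> 1" using \<eta> by (auto intro!: sin_gt_zero)
  have "1 \<le> cos (Arg v) + 2 / sin \<eta> * \<bar>sin (Arg v)\<bar>"
  proof (cases "\<bar>Arg v\<bar> \<le> pi / 2")
    case True
    have c: "0 \<le> cos (Arg v)" using True by (intro cos_ge_zero) auto
    have "1 = cos (Arg v)^2 + sin (Arg v)^2" by simp
    also have "\<dots> \<le> cos (Arg v) + \<bar>sin (Arg v)\<bar>"
    proof (rule add_mono)
      show "cos (Arg v)^2 \<le> cos (Arg v)"
        using mult_left_mono[OF cos_le_one c] by (simp add: power2_eq_square)
      have "\<bar>sin (Arg v)\<bar>^2 \<le> \<bar>sin (Arg v)\<bar>"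
        using mult_left_mono[OF abs_sin_le_one abs_ge_zero] by (simp add: power2_eq_square del: abs_mult_self_eq)
      then show "sin (Arg v)^2 \<le> \<bar>sin (Arg v)\<bar>" by simp
    qed
    also have "\<bar>sin (Arg v)\<bar> \<le> 2 / sin \<eta> * \<bar>sin (Arg v)\<bar>"
    proof -
      have "1 \<le> 2 / sin \<eta>" using s by (subst pos_le_divide_eq) linarith+
      from mult_right_mono[OF this, of "\<bar>sin (Arg v)\<bar>"] show ?thesis by simp
    qed
    finally show ?thesis by simp
  next
    case False
    have "sin \<eta> \<le> sin (pi - \<bar>Arg v\<bar>)"
      using False A \<eta> by (intro sin_monotone_2pi_le) auto
    also have "\<dots> = \<bar>sin (Arg v)\<bar>"
      by (smt (verit) A \<eta>(1) sin_ge_zero sin_minus sin_pi_minus)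
    finally have "2 \<le> 2 / sin \<eta> * \<bar>sin (Arg v)\<bar>" using s by (simp add: field_simps)
    then show ?thesis using cos_ge_minus_one[of "Arg v"] by linarith
  qed
  then have "norm v * 1 \<le> norm v * (cos (Arg v) + 2 / sin \<eta> * \<bar>sin (Arg v)\<bar>)"
    by (intro mult_left_mono) auto
  moreover have "Re v = norm v * cos (Arg v)" "Im v = norm v * sin (Arg v)"
    by (subst vp, simp)+
  ultimately show ?thesis using v by (simp add: cone_def abs_mult algebra_simps)
qed

lemma filterlim_coord_inv:
  assumes "0 < \<delta>"
  shows "filterlim (coord_inv k \<psi>) at_infinity (inf at_infinity (principal (narrow_sector k \<psi> \<delta>)))"
proof -
  have "filterlim (\<lambda>l::complex. norm l powr (5/2)) at_top at_infinity"
    by (rule filterlim_compose[OF real_powr_at_top filterlim_norm_at_top]) simp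
  then have "filterlim (\<lambda>l::complex. 4/5 * norm l powr (5/2)) at_top at_infinity"
    by (intro filterlim_tendsto_pos_mult_at_top[OF tendsto_const]) auto
  then have "filterlim (\<lambda>l. 4/5 * norm l powr (5/2)) at_top (inf at_infinity (principal (narrow_sector k \<psi> \<delta>)))"
    by (rule filterlim_mono) auto
  moreover have "\<forall>\<^sub>F l in inf at_infinity (principal (narrow_sector k \<psi> \<delta>)).
      4/5 * norm l powr (5/2) = norm (coord_inv k \<psi> l)"
    using assms by (auto simp: eventually_inf_principal norm_coord_inv)
  ultimately have "filterlim (\<lambda>l. norm (coord_inv k \<psi> l)) at_top (inf at_infinity (principal (narrow_sector k \<psi> \<delta>)))"
    by (rule filterlim_mono_eventually[OF _ order_refl order_refl])
  then show ?thesis by (simp add: filterlim_at_infinity_conv_norm_at_top)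
qed

section \<open>Wronskians and continuation to entire solutions\<close>

context lax_system
begin

lemma f_holomorphic: "f holomorphic_on UNIV"
  unfolding f_def[abs_def] by (intro holomorphic_intros)

lemma solution_det_constant:
  assumes "solution u w" "solution u' w'"
  shows "u l * w' l - u' l * w l = u 0 * w' 0 - u' 0 * w 0"
proof -
  have "((\<lambda>l. u l * w' l - u' l * w l) has_field_derivative 0) (at l)" for l
  proof -
    have "((\<lambda>l. u l * w' l - u' l * w l) has_field_derivative
        ((d * u l + m l * w l) * w' l + (f l * u' l - d * w' l) * u l) -
        ((d * u' l + m l * w' l) * w l + (f l * u l - d * w l) * u' l)) (at l)"
      using assms unfolding solution_def by (intro DERIV_diff DERIV_mult) auto
    then show ?thesis by (simp add: algebra_simps)
  qed
  then have "(\<lambda>l. u l * w' l - u' l * w l) constant_on UNIV"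
    by (intro has_field_derivative_0_imp_constant_on) auto
  then show ?thesis unfolding constant_on_def by (metis UNIV_I)
qed

lemma solution_combination:
  assumes "solution u w" "solution u' w'"
  shows "solution (\<lambda>l. s * u l + t * u' l) (\<lambda>l. s * w l + t * w' l)"
  unfolding solution_def
proof (intro allI conjI)
  fix l
  have "((\<lambda>l. s * u l + t * u' l) has_field_derivative s * (d * u l + m l * w l) + t * (d * u' l + m l * w' l)) (at l)"
    using assms unfolding solution_def by (intro DERIV_add DERIV_cmult) auto
  then show "((\<lambda>l. s * u l + t * u' l) has_field_derivative
      d * (s * u l + t * u' l) + m l * (s * w l + t * w' l)) (at l)"
    by (simp add: algebra_simps)
  have "((\<lambda>l. s * w l + t * w' l) has_field_derivative s * (f l * u l - d * w l) + t * (f l * u' l - d * w' l)) (at l)"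
    using assms unfolding solution_def by (intro DERIV_add DERIV_cmult) auto
  then show "((\<lambda>l. s * w l + t * w' l) has_field_derivative
      f l * (s * u l + t * u' l) - d * (s * w l + t * w' l)) (at l)"
    by (simp add: algebra_simps)
qed

lemma fundamental_solutions:
  obtains u1 w1 u2 w2 where "solution u1 w1" "solution u2 w2" "\<And>l. u1 l * w2 l - u2 l * w1 l = 1"
proof -
  obtain u1 w1 where 1: "\<And>z. (u1 has_field_derivative d * u1 z + m z * w1 z) (at z)"
    "\<And>z. (w1 has_field_derivative f z * u1 z + (- d) * w1 z) (at z)" "u1 0 = 1" "w1 0 = 0"
    using linear_ode_exists[of UNIV 0 "\<lambda>_. d" m f "\<lambda>_. - d" 1 0] m_hol f_holomorphic by auto
  obtain u2 w2 where 2: "\<And>z. (u2 has_field_derivative d * u2 z + m z * w2 z) (at z)"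
    "\<And>z. (w2 has_field_derivative f z * u2 z + (- d) * w2 z) (at z)" "u2 0 = 0" "w2 0 = 1"
    using linear_ode_exists[of UNIV 0 "\<lambda>_. d" m f "\<lambda>_. - d" 0 1] m_hol f_holomorphic by auto
  have s: "solution u1 w1" "solution u2 w2" using 1 2 by (simp_all add: solution_def)
  show ?thesis using that[OF s] solution_det_constant[OF s] 1 2 by simp
qed

text \<open>The Wronskians of \<open>(W1, W2)\<close> with a fundamental pair are constant on the
  connected set \<open>S\<close>. By Cramer's rule \<open>(W1, W2)\<close> is then a fixed
  combination of entire solutions pulled back along \<open>q^2\<close>, which continues it from the
  cone to the whole \<open>l\<close>-plane.\<close>

lemma extend_solution:
  fixes W1 W2 q :: "complex \<Rightarrow> complex"
  assumes S: "open S" "connected S"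
    and q: "\<And>v. v \<in> S \<Longrightarrow> ((\<lambda>v. q v ^ 2) has_field_derivative L v) (at v)"
    and W1: "\<And>v. v \<in> S \<Longrightarrow> (W1 has_field_derivative L v * (d * W1 v + m (q v ^ 2) * W2 v)) (at v)"
    and W2: "\<And>v. v \<in> S \<Longrightarrow> (W2 has_field_derivative L v * (f (q v ^ 2) * W1 v - d * W2 v)) (at v)"
  obtains u w where "solution u w" "\<And>v. v \<in> S \<Longrightarrow> u (q v ^ 2) = W1 v" "\<And>v. v \<in> S \<Longrightarrow> w (q v ^ 2) = W2 v"
proof -
  obtain u1 w1 u2 w2 where F: "solution u1 w1" "solution u2 w2" "\<And>l. u1 l * w2 l - u2 l * w1 l = 1"
    using fundamental_solutions by blast
  have cst: "\<exists>C. \<forall>v\<in>S. W1 v * w' (q v ^ 2) - W2 v * u' (q v ^ 2) = C" if s: "solution u' w'" for u' w'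
  proof -
    have du: "((\<lambda>v. u' (q v ^ 2)) has_field_derivative (d * u' (q v ^ 2) + m (q v ^ 2) * w' (q v ^ 2)) * L v) (at v)"
      and dw: "((\<lambda>v. w' (q v ^ 2)) has_field_derivative (f (q v ^ 2) * u' (q v ^ 2) - d * w' (q v ^ 2)) * L v) (at v)"
      if "v \<in> S" for v
      using DERIV_chain2[OF s[unfolded solution_def, rule_format, THEN conjunct1] q[OF that]]
        DERIV_chain2[OF s[unfolded solution_def, rule_format, THEN conjunct2] q[OF that]] by simp_all
    have "((\<lambda>v. W1 v * w' (q v ^ 2) - W2 v * u' (q v ^ 2)) has_field_derivative 0) (at v)" if v: "v \<in> S" for v
    proof -
      note DERIV_diff[OF DERIV_mult[OF W1[OF v] dw[OF v]] DERIV_mult[OF W2[OF v] du[OF v]]]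
      then show ?thesis by (simp add: algebra_simps)
    qed
    then have "(\<lambda>v. W1 v * w' (q v ^ 2) - W2 v * u' (q v ^ 2)) constant_on S"
      using S by (intro has_field_derivative_0_imp_constant_on) auto
    then show ?thesis by (auto simp: constant_on_def)
  qed
  obtain c1 where c1: "\<And>v. v \<in> S \<Longrightarrow> W1 v * w2 (q v ^ 2) - W2 v * u2 (q v ^ 2) = c1" using cst[OF F(2)] by blast
  obtain c2 where c2: "\<And>v. v \<in> S \<Longrightarrow> W1 v * w1 (q v ^ 2) - W2 v * u1 (q v ^ 2) = c2" using cst[OF F(1)] by blast
  show ?thesis
  proof (rule that[OF solution_combination[OF F(1,2), of c1 "- c2"]])
    fix v assume v: "v \<in> S"
    define x1 y1 x2 y2 where "x1 = u1 (q v ^ 2)" and "y1 = w1 (q v ^ 2)" and "x2 = u2 (q v ^ 2)" and "y2 = w2 (q v ^ 2)"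
    have "x1 * y2 - x2 * y1 = 1" using F(3)[of "q v ^ 2"] by (simp add: x1_def x2_def y1_def y2_def)
    then have "c1 * x1 + - c2 * x2 = W1 v" "c1 * y1 + - c2 * y2 = W2 v"
      unfolding c1[OF v, symmetric] c2[OF v, symmetric] x1_def[symmetric] x2_def[symmetric] y1_def[symmetric] y2_def[symmetric]
      by algebra+
    then show "c1 * u1 (q v ^ 2) + - c2 * u2 (q v ^ 2) = W1 v" "c1 * w1 (q v ^ 2) + - c2 * w2 (q v ^ 2) = W2 v"
      by (simp_all add: x1_def x2_def y1_def y2_def)
  qed
qed

end

section \<open>Existence of the decaying solution on a rotated ray\<close>

context lax_system
begin

text \<open>This is the \<open>s\<close> of \<open>wkb_solution\<close>: half the rate in
  \<open>v\<close> at which the growing solution outruns the decaying one.\<close>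

definition gap :: "complex \<Rightarrow> complex \<Rightarrow> complex" where
  "gap q v = (4 * q^5 - a * q) / (5 * v) + of_nat j * y0 / (5 * v * (q^2 - y0))"

text \<open>The leading term \<open>4 q^5 / (5 v)\<close> equals \<open>cis \<psi>\<close>; for
  \<open>\<bar>\<psi>\<bar> < pi / 2\<close> its real part is positive, which is what the
  contraction in the cone asks for.\<close>

lemma gap_tendsto: "((\<lambda>v. gap (coord_sqrt k \<psi> v) v) \<longlongrightarrow> cis \<psi>) at_infinity"
proof -
  define h where "h = (\<lambda>t::complex. cis \<psi> - a / 4 * cis \<psi> * t^4 + of_nat j * y0 * cis \<psi> / 4 * (t^7 / (1 - y0 * t^2)))"
  have "isCont h 0" unfolding h_def by (intro continuous_intros) auto
  then have "(h \<longlongrightarrow> cis \<psi>) (at 0)" by (simp add: isCont_def h_def)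
  moreover have "filterlim (\<lambda>v. inverse (coord_sqrt k \<psi> v)) (at 0) at_infinity"
    by (subst filterlim_inverse_at_iff) (rule filterlim_coord_sqrt)
  ultimately have "((\<lambda>v. h (inverse (coord_sqrt k \<psi> v))) \<longlongrightarrow> cis \<psi>) at_infinity"
    by (rule filterlim_compose)
  moreover have "\<forall>\<^sub>F v in at_infinity. h (inverse (coord_sqrt k \<psi> v)) = gap (coord_sqrt k \<psi> v) v"
  proof -
    have "\<forall>\<^sub>F v in at_infinity. norm (v::complex) \<ge> 1" by (rule eventually_at_infinity[THEN iffD2]) blast
    then show ?thesis
    proof eventually_elim
      case (elim v)
      define q where "q = coord_sqrt k \<psi> v"
      have v: "v \<noteq> 0" using elim by auto
      have q: "q \<noteq> 0" by (simp add: q_def)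
      have "q^5 = 5/4 * cis \<psi> * v" unfolding q_def by (rule coord_sqrt_power5[OF v])
      then have iv: "1 / (5 * v) = cis \<psi> / (4 * q^5)" using v by (simp add: field_simps)
      have "gap q v = (4 * q^5 - a * q) * (1 / (5 * v)) + of_nat j * y0 * (1 / (5 * v)) * (1 / (q^2 - y0))"
        by (simp add: gap_def)
      also have "(4 * q^5 - a * q) * (1 / (5 * v)) = cis \<psi> - a / 4 * cis \<psi> * inverse q ^ 4"
        unfolding iv using q by (simp add: field_simps eval_nat_numeral)
      also have "of_nat j * y0 * (1 / (5 * v)) * (1 / (q^2 - y0))
          = of_nat j * y0 * cis \<psi> / 4 * (inverse q ^ 5 * (1 / (q^2 - y0)))"
      proof -
        have "1 / (5 * v) = cis \<psi> / 4 * inverse q ^ 5"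
          unfolding iv using q by (simp add: field_simps eval_nat_numeral)
        moreover have "of_nat j * y0 * e * z = of_nat j * y0 * cis \<psi> / 4 * (i * z)"
          if "e = cis \<psi> / 4 * i" for e i z :: complex
          using that by simp
        ultimately show ?thesis by blast
      qed
      also have "inverse q ^ 5 * (1 / (q^2 - y0)) = inverse q ^ 7 / (1 - y0 * inverse q ^ 2)"
      proof -
        have "1 - y0 * inverse q ^ 2 = inverse q ^ 2 * (q^2 - y0)" using q by (simp add: field_simps)
        moreover have "inverse q ^ 7 = inverse q ^ 2 * inverse q ^ 5" by (simp flip: power_add)
        moreover have "x * (1 / y) = (i * x) / (i * y)" if "i \<noteq> 0" for i x y :: complex using that by simp
        ultimately show ?thesis using q by (metis inverse_zero_imp_zero power_eq_0_iff)
      qed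
      finally show "h (inverse (coord_sqrt k \<psi> v)) = gap (coord_sqrt k \<psi> v) v"
        by (simp add: h_def q_def)
    qed
  qed
  ultimately show ?thesis by (rule Lim_transform_eventually)
qed

lemma wkb_tendsto: "((\<lambda>q. (wkb q + d) / q^3) \<longlongrightarrow> -2) at_infinity"
proof -
  define h where "h = (\<lambda>t::complex. - of_real \<nu> * t^5 - 2 + a / 2 * t^4 + d * t^3)"
  have "isCont h 0" unfolding h_def by (intro continuous_intros)
  then have "(h \<longlongrightarrow> -2) (at 0)" by (simp add: isCont_def h_def)
  then have "((\<lambda>q. h (inverse q)) \<longlongrightarrow> -2) at_infinity"
    by (rule filterlim_compose[OF _ filterlim_inverse_at_iff[THEN iffD2, OF filterlim_ident]])
  moreover have "\<forall>\<^sub>F q in at_infinity. h (inverse q) = (wkb q + d) / q^3"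
  proof -
    have "\<forall>\<^sub>F q in at_infinity. norm (q::complex) \<ge> 1" by (rule eventually_at_infinity[THEN iffD2]) blast
    then show ?thesis
    proof eventually_elim
      case (elim q)
      then have "q \<noteq> 0" by auto
      then show ?case by (simp add: h_def wkb_def field_simps eval_nat_numeral)
    qed
  qed
  ultimately show ?thesis by (rule Lim_transform_eventually)
qed

definition phase :: "int \<Rightarrow> complex \<Rightarrow> complex" where
  "phase k l = exp (4 / 5 * branch_sqrt k l ^ 5 - a * branch_sqrt k l)"

text \<open>The -2 is the leading coefficient of \<open>wkb\<close>: \<open>f u = w' + d w\<close>,
  and \<open>w'\<close> behaves like \<open>-2 q^3 w\<close>. Keeping \<open>f\<close> inside the
  limit lets one notion serve both systems.\<close>

definition asymptotic :: "complex filter \<Rightarrow> int \<Rightarrow> (complex \<Rightarrow> complex) \<Rightarrow> (complex \<Rightarrow> complex) \<Rightarrow> bool" where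
  "asymptotic F k u w \<longleftrightarrow>
     ((\<lambda>l. phase k l * branch_power k \<nu> l * w l) \<longlongrightarrow> 1) F \<and>
     ((\<lambda>l. phase k l * branch_power k \<nu> l * (f l / branch_sqrt k l ^ 3) * u l) \<longlongrightarrow> -2) F"

lemma asymptotic_solution_exists:
  assumes \<psi>: "\<bar>\<psi>\<bar> < pi / 2" and \<delta>: "0 < \<delta>"
  shows "\<exists>u w. solution u w \<and> asymptotic (inf at_infinity (principal (narrow_sector k \<psi> \<delta>))) k u w"
proof -
  define q where "q = coord_sqrt k \<psi>"
  \<comment> \<open>The narrow sector maps into
    \<open>\<bar>Arg v\<bar> < pi - 5/2 * \<delta>\<close>; the cone with
    \<open>K = 2 / sin \<eta>\<close> must contain the distant part of that image.\<close>
  define \<eta> where "\<eta> = min (5/2 * \<delta>) (pi / 2)"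
  have \<eta>: "0 < \<eta>" "\<eta> \<le> pi / 2" "\<eta> \<le> 5/2 * \<delta>" using \<delta> by (auto simp: \<eta>_def)
  define K where "K = 2 / sin \<eta>"
  have K: "0 \<le> K" using \<eta> by (auto simp: K_def intro!: sin_ge_zero)
  define \<mu> where "\<mu> = cos \<psi> / 2"
  have \<mu>: "0 < \<mu>" using \<psi> by (auto simp: \<mu>_def intro!: cos_gt_zero_pi)
  have q5: "q v ^ 5 = 5/4 * cis \<psi> * v" if "v \<noteq> 0" for v using coord_sqrt_power5[OF that] by (simp add: q_def)
  have q0: "q v \<noteq> 0" for v by (simp add: q_def)
  have q_lim: "filterlim q at_infinity at_infinity" unfolding q_def by (rule filterlim_coord_sqrt)
  have "\<forall>\<^sub>F v in at_infinity. \<mu> < Re (gap (q v) v)"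
  proof -
    have "((\<lambda>v. Re (gap (q v) v)) \<longlongrightarrow> Re (cis \<psi>)) at_infinity"
      unfolding q_def by (intro tendsto_Re gap_tendsto)
    then show ?thesis by (rule order_tendstoD) (use \<mu> in \<open>simp add: \<mu>_def\<close>)
  qed
  moreover have "\<forall>\<^sub>F v in at_infinity. norm (remainder (q v)) < norm c + 1"
    by (rule order_tendstoD(2)[OF tendsto_norm[OF filterlim_compose[OF remainder_tendsto q_lim]]]) simp
  moreover have "\<forall>\<^sub>F v in at_infinity. norm (q v) \<ge> norm y0 + 1"
    using q_lim by (auto simp: filterlim_at_infinity_conv_norm_at_top filterlim_at_top)
  ultimately have "\<forall>\<^sub>F v in at_infinity. \<mu> < Re (gap (q v) v) \<and> norm (remainder (q v)) < norm c + 1 \<and> norm (q v) \<ge> norm y0 + 1"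
    by (intro eventually_conj)
  then obtain N where N: "\<And>v. N \<le> norm v \<Longrightarrow> \<mu> < Re (gap (q v) v)"
     "\<And>v. N \<le> norm v \<Longrightarrow> norm (remainder (q v)) < norm c + 1" "\<And>v. N \<le> norm v \<Longrightarrow> norm (q v) \<ge> norm y0 + 1"
    unfolding eventually_at_infinity by blast
  have qy: "(q v)^2 \<noteq> y0" if "N \<le> norm v" for v
  proof -
    have 1: "1 \<le> norm (q v)" using N(3)[OF that] norm_ge_zero[of y0] by linarith
    have "norm y0 < norm (q v) * 1" using N(3)[OF that] by simp
    also have "\<dots> \<le> norm (q v) * norm (q v)" using 1 by (intro mult_left_mono) auto
    finally show ?thesis by (auto simp: power2_eq_square norm_mult)
  qed
  \<comment> \<open>4/25 is the square of the 2/5 in \<open>R\<close>, and the power of 5/4 comes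
    from \<open>norm (q v) ^ 4\<close>. Together with \<open>1 / v^2\<close> this leaves the
    exponent 4/5 - 2 = -6/5.\<close>
  define C where "C = 4/25 * (5/4) powr (4/5) * (norm c + 1)"
  have C: "0 \<le> C" by (simp add: C_def)
  define C1 where "C1 = C * (3 + 2 * K) powr (6/5) / (2 * \<mu>)"
  define C2 where "C2 = 5 * C1 * (3 + 2 * K) powr (6/5)"
  have C2: "0 \<le> C2" "0 \<le> C1" using C \<mu> by (auto simp: C1_def C2_def)
  have "((\<lambda>r. C2 * r powr (-1/5)) \<longlongrightarrow> C2 * 0) at_top"
    by (intro tendsto_mult_left tendsto_neg_powr filterlim_ident) auto
  then have "\<forall>\<^sub>F r in at_top. C2 * r powr (-1/5) < 1/2" by (rule order_tendstoD) simp
  then obtain N2 where N2: "\<And>r. N2 \<le> r \<Longrightarrow> C2 * r powr (-1/5) < 1/2" by (auto simp: eventually_at_top_linorder)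
  \<comment> \<open>\<open>M / (1 + K)\<close> is a lower bound for \<open>norm v\<close> in the
    cone, so this \<open>M\<close> pushes the cone to where all the eventual estimates hold.\<close>
  define M where "M = (1 + K) * max 1 (max N N2)"
  have M: "0 < M" "M / (1 + K) = max 1 (max N N2)" using K by (auto simp: M_def intro!: mult_pos_pos)
  define U where "U = cone K M"
  have vN: "N \<le> norm v" "N2 \<le> norm v" "1 \<le> norm v" "v \<noteq> 0" "v \<notin> \<real>\<^sub>\<le>\<^sub>0" if "v \<in> U" for v
  proof -
    have *: "max 1 (max N N2) < norm v" using cone_norm_gt[OF _ K, of v M] that M by (simp add: U_def)
    then show "N \<le> norm v" "N2 \<le> norm v" "1 \<le> norm v" by auto
    then show "v \<noteq> 0" by auto
    show "v \<notin> \<real>\<^sub>\<le>\<^sub>0" using cone_not_nonpos that M by (auto simp: U_def)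
  qed
  have dq: "(q has_field_derivative q v / (5 * v)) (at v)" if "v \<in> U" for v
    unfolding q_def by (rule has_field_derivative_coord_sqrt[OF vN(5)[OF that]])
  have oU: "open U" by (simp add: U_def open_cone)
  have q_hol: "q holomorphic_on U" using dq holomorphic_on_open[OF oU] by blast
  define R where "R = (\<lambda>v. (2 * (q v)^2 / (5 * v))^2 * remainder (q v))"
  have qyU: "(q v)^2 - y0 \<noteq> 0" if "v \<in> U" for v using qy vN that by auto
  have v0U: "v \<noteq> 0" if "v \<in> U" for v using vN that by auto
  have gap_hol: "(\<lambda>v. gap (q v) v) holomorphic_on U"
    unfolding gap_def by (intro holomorphic_intros q_hol) (use v0U qyU in auto)
  have R_hol: "R holomorphic_on U"
    unfolding R_def remainder_def wkb_def wkb_deriv_def log_deriv_f_def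
    by (intro holomorphic_intros q_hol) (use v0U qyU q0 in auto)
  have R_le: "norm (R v) \<le> C * norm v powr (-6/5)" if v: "v \<in> U" for v
  proof -
    have nq: "norm (q v) = (5/4) powr (1/5) * norm v powr (1/5)"
      unfolding q_def norm_coord_sqrt[OF vN(4)[OF v]] by (rule powr_mult)
    have e: "norm v powr (-6/5) = norm v powr (4/5) / norm v powr 2"
      using powr_diff[of "norm v" "4/5" 2] by simp
    have q4: "norm (q v) ^ 4 = (5/4) powr (4/5) * norm v powr (4/5)"
      unfolding nq power_mult_distrib using vN(4)[OF v] by (simp add: powr_power)
    have "norm (R v) = 4/25 * norm (q v)^4 / norm v ^ 2 * norm (remainder (q v))"
      by (simp add: R_def norm_mult norm_divide norm_power power_divide power_mult_distrib flip: power_mult)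
    also have "\<dots> \<le> 4/25 * norm (q v)^4 / norm v ^ 2 * (norm c + 1)"
      using N(2)[OF vN(1)[OF v]] by (intro mult_left_mono) auto
    also have "\<dots> = C * norm v powr (-6/5)"
      unfolding e C_def q4 using vN(4)[OF v] by (simp add: powr_numeral)
    finally show ?thesis .
  qed
  have "\<exists>S. \<forall>v\<in>U. (S has_field_derivative gap (q v) v) (at v)"
    using cone_primitive[of "\<lambda>v. gap (q v) v" K M] gap_hol M by (simp add: U_def)
  then obtain S where S: "\<And>v. v \<in> U \<Longrightarrow> (S has_field_derivative gap (q v) v) (at v)" by blast
  have "\<exists>H P. \<forall>v\<in>cone K M. (H has_field_derivative P v) (at v) \<and>
      (P has_field_derivative 2 * gap (q v) v * P v + R v * H v) (at v) \<and>
      norm (H v - 1) \<le> 2 * C2 * norm v powr (-1/5) \<and> norm (P v) \<le> 2 * C1 * norm v powr (-6/5)"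
  proof (rule cone_solution_contraction[OF K M(1) \<mu> C])
    fix v assume v: "v \<in> cone K M"
    then have vU: "v \<in> U" by (simp add: U_def)
    show "(S has_field_derivative gap (q v) v) (at v)" by (rule S[OF vU])
    show "\<mu> \<le> Re (gap (q v) v)" using N(1)[OF vN(1)[OF vU]] by simp
    show "norm (R v) \<le> C * norm v powr (-6/5)" by (rule R_le[OF vU])
    show "C2 * norm v powr (-1/5) \<le> 1/2" using N2[OF vN(2)[OF vU]] by simp
  qed (use R_hol C1_def C2_def in \<open>auto simp: U_def\<close>)
  then obtain H P where HP: "\<And>v. v \<in> U \<Longrightarrow> (H has_field_derivative P v) (at v)"
      "\<And>v. v \<in> U \<Longrightarrow> (P has_field_derivative 2 * gap (q v) v * P v + R v * H v) (at v)"
      "\<And>v. v \<in> U \<Longrightarrow> norm (H v - 1) \<le> 2 * C2 * norm v powr (-1/5)"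
      "\<And>v. v \<in> U \<Longrightarrow> norm (P v) \<le> 2 * C1 * norm v powr (-6/5)"
    unfolding U_def by blast
  \<comment> \<open>The constant ratio of \<open>branch_power k \<nu>\<close> to
    \<open>cpow (2 * \<nu> / 5)\<close>; dividing by it normalises the first limit to 1.\<close>
  define \<beta> where "\<beta> = complex_of_real ((5/4) powr (2 * \<nu> / 5)) * cis (\<nu> * ray_angle k \<psi>)"
  have \<beta>: "\<beta> \<noteq> 0" by (simp add: \<beta>_def)
  define G where "G = (\<lambda>v. exp (a * q v - 4/5 * q v ^ 5) * cpow (- (2 * \<nu> / 5)) v / \<beta>)"
  have dG: "(G has_field_derivative 2 * (q v)^2 / (5 * v) * wkb (q v) * G v) (at v)" if v: "v \<in> U" for v
  proof -
    have "((\<lambda>v. a * q v - 4/5 * q v ^ 5) has_field_derivative a * (q v / (5 * v)) - 4/5 * (of_nat 5 * (q v ^ 4 * (q v / (5 * v))))) (at v)"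
      using DERIV_power[OF dq[OF v], of 5] by (intro DERIV_diff DERIV_cmult dq v) (simp add: mult_ac)
    then have "((\<lambda>v. exp (a * q v - 4/5 * q v ^ 5)) has_field_derivative exp (a * q v - 4/5 * q v ^ 5) *
        (a * (q v / (5 * v)) - 4/5 * (of_nat 5 * (q v ^ 4 * (q v / (5 * v)))))) (at v)"
      by (rule DERIV_chain2[OF DERIV_exp])
    from DERIV_cdivide[OF DERIV_mult[OF this has_field_derivative_cpow[OF vN(5)[OF v], of "- (2 * \<nu> / 5)"]], of \<beta>]
    have "(G has_field_derivative
      (exp (a * q v - 4/5 * q v ^ 5) * (a * (q v / (5 * v)) - 4/5 * (of_nat 5 * (q v ^ 4 * (q v / (5 * v))))) *
          cpow (- (2 * \<nu> / 5)) v +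
         complex_of_real (- (2 * \<nu> / 5)) * cpow (- (2 * \<nu> / 5)) v / v * exp (a * q v - 4/5 * q v ^ 5)) / \<beta>) (at v)"
      unfolding G_def .
    moreover have "(exp (a * q v - 4/5 * q v ^ 5) * (a * (q v / (5 * v)) - 4/5 * (of_nat 5 * (q v ^ 4 * (q v / (5 * v))))) *
          cpow (- (2 * \<nu> / 5)) v +
         complex_of_real (- (2 * \<nu> / 5)) * cpow (- (2 * \<nu> / 5)) v / v * exp (a * q v - 4/5 * q v ^ 5)) / \<beta>
       = ((a * (q v / (5 * v)) - 4/5 * (of_nat 5 * (q v ^ 4 * (q v / (5 * v))))) + complex_of_real (- (2 * \<nu> / 5)) / v) * G v"
      by (simp add: G_def algebra_simps add_divide_distrib diff_divide_distrib)
    moreover have "(a * (q v / (5 * v)) - 4/5 * (of_nat 5 * (q v ^ 4 * (q v / (5 * v))))) + complex_of_real (- (2 * \<nu> / 5)) / v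
        = 2 * (q v)^2 / (5 * v) * wkb (q v)"
      using vN(4)[OF v] q0[of v] by (simp add: wkb_def field_simps eval_nat_numeral)
    ultimately show ?thesis by simp
  qed
  define W2 where "W2 = (\<lambda>v. G v * H v)"
  define W1 where "W1 = (\<lambda>v. G v * ((wkb (q v) + d) * H v + 5 * v / (2 * (q v)^2) * P v) / f ((q v)^2))"
  have "(W2 has_field_derivative 2 * (q v)^2 / (5 * v) * (f ((q v)^2) * W1 v - d * W2 v)) (at v)"
    and "(W1 has_field_derivative 2 * (q v)^2 / (5 * v) * (d * W1 v + m ((q v)^2) * W2 v)) (at v)" if v: "v \<in> U" for v
    unfolding W1_def W2_def
    by (rule wkb_solution[OF v0U[OF v] q0 qy[OF vN(1)[OF v]] dq[OF v] dG[OF v] HP(1,2)[OF v]]; simp add: gap_def R_def)+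
  moreover have "((\<lambda>v. q v ^ 2) has_field_derivative 2 * (q v)^2 / (5 * v)) (at v)" if v: "v \<in> U" for v
    using DERIV_power[OF dq[OF v], of 2] vN(4)[OF v] by (simp add: power2_eq_square field_simps)
  moreover have "connected U"
    unfolding U_def using M by (intro starlike_imp_connected starlike_cone) auto
  ultimately obtain u w where uw: "solution u w" "\<And>v. v \<in> U \<Longrightarrow> u (q v ^ 2) = W1 v" "\<And>v. v \<in> U \<Longrightarrow> w (q v ^ 2) = W2 v"
    using extend_solution[OF oU, of q "\<lambda>v. 2 * (q v)^2 / (5 * v)" W1 W2] by metis
  define A where "A = inf at_infinity (principal U)"
  have A_inf: "A \<le> at_infinity" by (simp add: A_def)
  have evU: "\<forall>\<^sub>F v in A. v \<in> U" by (simp add: A_def eventually_inf_principal)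
  have nrm: "filterlim (\<lambda>v::complex. norm v) at_top A" by (rule filterlim_mono[OF filterlim_norm_at_top order_refl A_inf])
  have H1: "(H \<longlongrightarrow> 1) A"
  proof -
    have "((\<lambda>v. 2 * C2 * norm v powr (-1/5)) \<longlongrightarrow> 0) A"
      by (intro tendsto_mult_right_zero tendsto_neg_powr nrm) auto
    then have "((\<lambda>v. H v - 1) \<longlongrightarrow> 0) A"
      by (rule Lim_null_comparison[rotated]) (use evU HP(3) in \<open>auto elim: eventually_mono\<close>)
    then show ?thesis by (simp add: LIM_zero_iff)
  qed
  have P0: "(P \<longlongrightarrow> 0) A"
  proof -
    have "((\<lambda>v. 2 * C1 * norm v powr (-6/5)) \<longlongrightarrow> 0) A"
      by (intro tendsto_mult_right_zero tendsto_neg_powr nrm) auto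
    then show ?thesis
      by (rule Lim_null_comparison[rotated]) (use evU HP(4) in \<open>auto elim: eventually_mono\<close>)
  qed
  \<comment> \<open>The factor of \<open>P\<close> is \<open>5 v / (2 q^5)\<close>, which is
    constant because \<open>q^5 = 5/4 * cis \<psi> * v\<close>.\<close>
  have T: "((\<lambda>v. (wkb (q v) + d) / (q v)^3 * H v + 2 / cis \<psi> * P v) \<longlongrightarrow> -2 * 1 + 2 / cis \<psi> * 0) A"
    using filterlim_mono[OF filterlim_compose[OF wkb_tendsto q_lim] order_refl A_inf]
    by (intro tendsto_intros H1 P0)
  define F where "F = inf at_infinity (principal (narrow_sector k \<psi> \<delta>))"
  have inv_inf: "filterlim (coord_inv k \<psi>) at_infinity F"
    unfolding F_def by (rule filterlim_coord_inv[OF \<delta>])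
  have evF: "\<forall>\<^sub>F l in F. l \<in> narrow_sector k \<psi> \<delta>" by (simp add: F_def eventually_inf_principal)
  have "\<forall>\<^sub>F l in F. norm (coord_inv k \<psi> l) \<ge> M + 1"
    using inv_inf by (auto simp: filterlim_at_infinity_conv_norm_at_top filterlim_at_top)
  then have ev: "\<forall>\<^sub>F l in F. coord_inv k \<psi> l \<in> U \<and> q (coord_inv k \<psi> l) ^ 2 = l"
    using evF
  proof eventually_elim
    case (elim l)
    have "coord_inv k \<psi> l \<in> cone (2 / sin \<eta>) M"
    proof (rule in_cone_if_Arg[OF _ _ _ \<eta>(1,2)])
      show "coord_inv k \<psi> l \<noteq> 0" "M < norm (coord_inv k \<psi> l)" using elim M by auto
      show "\<bar>Arg (coord_inv k \<psi> l)\<bar> \<le> pi - \<eta>" using Arg_coord_inv[OF elim(2) \<delta>] \<eta> by linarith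
    qed
    then show ?case using coord_sqrt_inv[OF elim(2) \<delta>] by (simp add: U_def K_def q_def)
  qed
  have invA: "filterlim (coord_inv k \<psi>) A F"
    unfolding A_def using inv_inf ev by (auto simp: filterlim_inf filterlim_principal elim: eventually_mono)
  have val: "phase k (q v ^ 2) * branch_power k \<nu> (q v ^ 2) * G v = 1" and bs: "branch_sqrt k (q v ^ 2) = q v"
    if v: "v \<in> U" for v
  proof -
    show bs: "branch_sqrt k (q v ^ 2) = q v"
      unfolding q_def by (rule branch_sqrt_coord[OF vN(5)[OF v] \<psi>])
    have bp: "branch_power k \<nu> (q v ^ 2) = \<beta> * cpow (2 * \<nu> / 5) v"
      unfolding q_def \<beta>_def by (rule branch_power_coord[OF vN(5)[OF v] \<psi>])
    have "cpow (2 * \<nu> / 5) v * cpow (- (2 * \<nu> / 5)) v = 1"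
      unfolding cpow_add[symmetric] by (simp add: cpow_def)
    moreover have "exp (4 / 5 * q v ^ 5 - a * q v) * exp (a * q v - 4/5 * q v ^ 5) = 1"
      unfolding exp_add[symmetric] by simp
    moreover have "phase k (q v ^ 2) * branch_power k \<nu> (q v ^ 2) * G v =
       (exp (4 / 5 * q v ^ 5 - a * q v) * exp (a * q v - 4/5 * q v ^ 5)) * (cpow (2 * \<nu> / 5) v * cpow (- (2 * \<nu> / 5)) v)"
      unfolding phase_def bs bp G_def using \<beta> by simp
    ultimately show "phase k (q v ^ 2) * branch_power k \<nu> (q v ^ 2) * G v = 1" by simp
  qed
  have "((\<lambda>l. H (coord_inv k \<psi> l)) \<longlongrightarrow> 1) F" by (rule filterlim_compose[OF H1 invA])
  moreover have "\<forall>\<^sub>F l in F. H (coord_inv k \<psi> l) = phase k l * branch_power k \<nu> l * w l"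
    using ev
  proof eventually_elim
    case (elim l)
    define v where "v = coord_inv k \<psi> l"
    have v: "v \<in> U" "l = q v ^ 2" using elim by (auto simp: v_def)
    have "phase k l * branch_power k \<nu> l * w l = (phase k (q v ^ 2) * branch_power k \<nu> (q v ^ 2) * G v) * H v"
      unfolding v(2) uw(3)[OF v(1)] W2_def by (simp only: mult.assoc)
    then show "H (coord_inv k \<psi> l) = phase k l * branch_power k \<nu> l * w l"
      unfolding val[OF v(1)] by (simp add: v_def)
  qed
  ultimately have lim1: "((\<lambda>l. phase k l * branch_power k \<nu> l * w l) \<longlongrightarrow> 1) F"
    by (rule Lim_transform_eventually)
  have "((\<lambda>l. (wkb (q (coord_inv k \<psi> l)) + d) / (q (coord_inv k \<psi> l))^3 * H (coord_inv k \<psi> l) + 2 / cis \<psi> * P (coord_inv k \<psi> l)) \<longlongrightarrow> -2) F"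
    using filterlim_compose[OF T invA] by simp
  moreover have "\<forall>\<^sub>F l in F. (wkb (q (coord_inv k \<psi> l)) + d) / (q (coord_inv k \<psi> l))^3 * H (coord_inv k \<psi> l) + 2 / cis \<psi> * P (coord_inv k \<psi> l)
      = phase k l * branch_power k \<nu> l * (f l / branch_sqrt k l ^ 3) * u l"
    using ev
  proof eventually_elim
    case (elim l)
    define v where "v = coord_inv k \<psi> l"
    have v: "v \<in> U" "l = q v ^ 2" using elim by (auto simp: v_def)
    have fn: "f (q v ^ 2) \<noteq> 0" using qy[OF vN(1)[OF v(1)]] by (rule f_nonzero)
    have "phase k l * branch_power k \<nu> l * (f l / branch_sqrt k l ^ 3) * u l
      = (phase k (q v ^ 2) * branch_power k \<nu> (q v ^ 2) * G v) * ((wkb (q v) + d) * H v + 5 * v / (2 * (q v)^2) * P v) / (q v)^3"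
      unfolding v(2) uw(2)[OF v(1)] W1_def bs[OF v(1)] using fn by simp
    also have "\<dots> = (wkb (q v) + d) / (q v)^3 * H v + 5 * v / (2 * (q v)^5) * P v"
      unfolding val[OF v(1)] using q0[of v] by (simp add: field_simps eval_nat_numeral)
    also have "5 * v / (2 * (q v)^5) = 2 / cis \<psi>"
      unfolding q5[OF vN(4)[OF v(1)]] using vN(4)[OF v(1)] by (simp add: field_simps)
    finally show ?case by (simp add: v_def)
  qed
  ultimately have lim2: "((\<lambda>l. phase k l * branch_power k \<nu> l * (f l / branch_sqrt k l ^ 3) * u l) \<longlongrightarrow> -2) F"
    by (rule Lim_transform_eventually)
  show ?thesis using uw(1) lim1 lim2 unfolding asymptotic_def F_def by blast
qed

end

section \<open>Frames and Stokes multipliers\<close>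

definition ray :: "real \<Rightarrow> real \<Rightarrow> complex" where
  "ray \<theta> r = of_real r * cis \<theta>"

definition central :: "int \<Rightarrow> real" where
  "central k = 2 * pi * of_int k / 5"

lemma norm_ray: "norm (ray \<theta> r) = \<bar>r\<bar>"
  by (simp add: ray_def norm_mult)

lemma filterlim_ray: "filterlim (ray \<theta>) at_infinity at_top"
  by (simp add: filterlim_at_infinity_conv_norm_at_top norm_ray filterlim_abs_real)

lemma is_Arg_ray: "0 < r \<Longrightarrow> is_Arg (ray \<theta> r) \<theta>"
  unfolding is_Arg_def norm_ray by (simp add: ray_def cis_conv_exp)

lemma
  assumes "0 < r" "\<bar>\<theta> - central k\<bar> < 3 * pi / 5"
  shows branch_sqrt_ray: "branch_sqrt k (ray \<theta> r) = (-1) powi k * of_real (sqrt r) * cis (\<theta> / 2)"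
    and branch_power_ray: "branch_power k p (ray \<theta> r) = of_real (r powr p) * cis (p * \<theta>)"
proof -
  have "branch_arg k (ray \<theta> r) = \<theta>"
    using assms is_Arg_ray by (intro branch_arg_eq) (auto simp: ray_def central_def)
  then show "branch_sqrt k (ray \<theta> r) = (-1) powi k * of_real (sqrt r) * cis (\<theta> / 2)"
    "branch_power k p (ray \<theta> r) = of_real (r powr p) * cis (p * \<theta>)"
    using assms by (simp_all add: branch_sqrt_def branch_power_def norm_ray)
qed

lemma branch_sqrt_ray_power5:
  assumes "0 < r"
  shows "branch_sqrt k (ray (central k) r) ^ 5 = of_real (r powr (5/2))"
proof -
  have "branch_sqrt k (ray (central k) r) ^ 5 = ((-1) powi k)^5 * of_real (sqrt r) ^ 5 * cis (central k / 2) ^ 5"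
    using assms by (simp add: branch_sqrt_ray power_mult_distrib)
  also have "cis (central k / 2) ^ 5 = cis (pi * of_int k)"
  proof -
    have "5 * (central k / 2) = pi * of_int k" by (simp add: central_def)
    then show ?thesis by (metis Complex.DeMoivre of_nat_numeral)
  qed
  also have "((-1) powi k)^5 * of_real (sqrt r) ^ 5 * cis (pi * of_int k) = of_real (sqrt r) ^ 5 * (cis (- (pi * of_int k)) * cis (pi * of_int k))"
    unfolding powi_minus_one_power5 by (simp only: mult_ac)
  also have "cis (- (pi * of_int k)) * cis (pi * of_int k) = 1" by (simp add: cis_mult)
  also have "of_real (sqrt r) ^ 5 * (1::complex) = of_real (sqrt r ^ 5)" by simp
  also have "sqrt r ^ 5 = r powr (5/2)"
    using assms by (simp add: powr_half_sqrt[symmetric] powr_power)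
  finally show ?thesis .
qed

lemma norm_branch_sqrt: "norm (branch_sqrt k l) = sqrt (norm l)"
  by (simp add: branch_sqrt_def norm_mult norm_power_int)

lemma norm_branch_power: "norm (branch_power k p l) = norm l powr p"
  by (simp add: branch_power_def norm_mult)

lemma branch_sqrt_square: 
  assumes "l \<noteq> 0" "is_Arg l \<theta>" "\<bar>\<theta> - central k\<bar> < 3 * pi / 5"
  shows "branch_sqrt k l ^ 2 = l"
proof -
  have b: "branch_arg k l = \<theta>" using assms by (intro branch_arg_eq) (auto simp: central_def)
  have "branch_sqrt k l ^ 2 = ((-1) powi k)^2 * of_real (sqrt (norm l)) ^ 2 * cis (\<theta> / 2) ^ 2"
    by (simp add: branch_sqrt_def b power_mult_distrib)
  also have "complex_of_real (sqrt (norm l)) ^ 2 = of_real (norm l)" by (simp flip: of_real_power)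
  also have "cis (\<theta> / 2) ^ 2 = cis \<theta>" by (simp add: Complex.DeMoivre)
  finally show ?thesis using assms(2) by (simp add: powi_minus_one_power is_Arg_def cis_conv_exp)
qed

lemma branch_power_add: "l \<noteq> 0 \<Longrightarrow> branch_power k (p + p') l = branch_power k p l * branch_power k p' l"
  by (simp add: branch_power_def powr_add ring_distribs cis_mult[symmetric])

lemma branch_power_half: "branch_power k (1/2) l = (-1) powi k * branch_sqrt k l"
proof -
  have "((-1::complex) powi k) * (-1) powi k = 1" using powi_minus_one_power[of k] by (simp add: power2_eq_square)
  then have "(-1) powi k * branch_sqrt k l = of_real (sqrt (norm l)) * cis (branch_arg k l / 2)"
    unfolding branch_sqrt_def by (simp flip: mult.assoc)
  then show ?thesis by (simp add: branch_power_def powr_half_sqrt)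
qed

text \<open>
  Decay beating \<open>exp (C r^2)\<close> survives all gauge factors and the growth of the flow in the
  deformation parameter.
\<close>

definition superdecay :: "int \<Rightarrow> (complex \<Rightarrow> complex) \<Rightarrow> bool" where
  "superdecay k h \<longleftrightarrow> (\<forall>C. ((\<lambda>r. norm (h (ray (central k) r)) * exp (C * r^2)) \<longlongrightarrow> 0) at_top)"

lemma superdecay_imp_tendsto:
  assumes "superdecay k h"
  shows "((\<lambda>r. h (ray (central k) r)) \<longlongrightarrow> 0) at_top"
  using assms[unfolded superdecay_def, rule_format, of 0] by (simp add: tendsto_norm_zero_iff)

lemma superdecay_bound:
  assumes "\<forall>\<^sub>F r in at_top. norm (h (ray (central k) r)) \<le> exp (B * r^2) * (norm (h1 (ray (central k) r)) + norm (h2 (ray (central k) r)))"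
    and "superdecay k h1" "superdecay k h2"
  shows "superdecay k h"
  unfolding superdecay_def
proof
  fix C
  have "((\<lambda>r. norm (h1 (ray (central k) r)) * exp ((B + C) * r^2) + norm (h2 (ray (central k) r)) * exp ((B + C) * r^2)) \<longlongrightarrow> 0 + 0) at_top"
    using assms(2,3) unfolding superdecay_def by (intro tendsto_add) auto
  then have L: "((\<lambda>r. norm (h1 (ray (central k) r)) * exp ((B + C) * r^2) + norm (h2 (ray (central k) r)) * exp ((B + C) * r^2)) \<longlongrightarrow> 0) at_top" by simp
  show "((\<lambda>r. norm (h (ray (central k) r)) * exp (C * r^2)) \<longlongrightarrow> 0) at_top"
  proof (rule Lim_null_comparison[OF _ L], use assms(1) in eventually_elim)
    case (elim r)
    have "norm (h (ray (central k) r)) * exp (C * r^2)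
       \<le> (exp (B * r^2) * (norm (h1 (ray (central k) r)) + norm (h2 (ray (central k) r)))) * exp (C * r^2)"
      using elim by (intro mult_right_mono) auto
    also have "\<dots> = norm (h1 (ray (central k) r)) * exp ((B + C) * r^2) + norm (h2 (ray (central k) r)) * exp ((B + C) * r^2)"
      by (simp add: ring_distribs exp_add mult_ac)
    finally show ?case by simp
  qed
qed

text \<open>On the central ray the branch of \<open>l^(5/2)\<close> is the positive number
  \<open>r powr (5/2)\<close>, so a bounded product with the phase means decay like
  \<open>exp (- 4/5 * r powr (5/2))\<close>; the square root term, powers of \<open>r\<close> and
  \<open>exp (C * r^2)\<close> are of lower order. The bound \<open>r powr (-2)\<close> lies below
  all the algebraic factors to which this is applied.\<close>

lemma superdecay_of_phase:
  fixes a L :: complex and g h :: "complex \<Rightarrow> complex"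
  assumes lim: "((\<lambda>r. exp (4 / 5 * branch_sqrt k (ray (central k) r) ^ 5 - a * branch_sqrt k (ray (central k) r))
      * g (ray (central k) r) * h (ray (central k) r)) \<longlongrightarrow> L) at_top"
    and g: "\<forall>\<^sub>F r in at_top. r powr (-2) \<le> norm (g (ray (central k) r))"
  shows "superdecay k h"
  unfolding superdecay_def
proof
  fix C
  define A where "A = norm a"
  define B where "B = norm L + 1"
  have L: "((\<lambda>r::real. B * r powr 2 * exp (A * sqrt r - 4/5 * r powr (5/2)) * exp (C * r^2)) \<longlongrightarrow> 0) at_top"
  proof -
    define D where "D = A + \<bar>C\<bar>"
    have "((\<lambda>r::real. r powr 2 * exp (D * r^2 - 4/5 * r powr (5/2))) \<longlongrightarrow> 0) at_top" by real_asymp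
    then have "((\<lambda>r::real. \<bar>B\<bar> * (r powr 2 * exp (D * r^2 - 4/5 * r powr (5/2)))) \<longlongrightarrow> 0) at_top"
      by (rule tendsto_mult_right_zero)
    then show ?thesis
    proof (rule Lim_null_comparison[rotated], use eventually_ge_at_top[of 1] in eventually_elim)
      case (elim r)
      have "sqrt r \<le> r" using elim by (intro real_le_lsqrt) (auto simp: power2_eq_square)
      also have "r \<le> r^2" using elim by (simp add: power2_eq_square)
      finally have "A * sqrt r \<le> A * r^2" by (intro mult_left_mono) (auto simp: A_def)
      moreover have "C * r^2 \<le> \<bar>C\<bar> * r^2" by (intro mult_right_mono) auto
      ultimately have "A * sqrt r - 4/5 * r powr (5/2) + C * r^2 \<le> D * r^2 - 4/5 * r powr (5/2)"
        by (simp add: D_def ring_distribs)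
      then have "exp (A * sqrt r - 4/5 * r powr (5/2) + C * r^2) \<le> exp (D * r^2 - 4/5 * r powr (5/2))" by simp
      from mult_left_mono[OF this, of "\<bar>B\<bar> * r powr 2"] show ?case
        by (simp add: exp_add abs_mult mult_ac)
    qed
  qed
  have ev: "\<forall>\<^sub>F r in at_top. norm (exp (4 / 5 * branch_sqrt k (ray (central k) r) ^ 5 - a * branch_sqrt k (ray (central k) r))
      * g (ray (central k) r) * h (ray (central k) r)) < B"
    by (rule order_tendstoD(2)[OF tendsto_norm[OF lim]]) (simp add: B_def)
  show "((\<lambda>r. norm (h (ray (central k) r)) * exp (C * r^2)) \<longlongrightarrow> 0) at_top"
  proof (rule Lim_null_comparison[OF _ L], use eventually_gt_at_top[of 0] g ev in eventually_elim)
    case (elim r)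
    let ?s = "branch_sqrt k (ray (central k) r)"
    let ?h = "norm (h (ray (central k) r))"
    have "\<bar>Re (a * ?s)\<bar> \<le> A * sqrt r"
      using abs_Re_le_cmod[of "a * ?s"] elim by (simp add: norm_mult norm_branch_sqrt norm_ray A_def)
    then have e: "exp (4/5 * r powr (5/2) - A * sqrt r) \<le> norm (exp (4 / 5 * ?s ^ 5 - a * ?s))"
      using elim by (simp add: norm_exp branch_sqrt_ray_power5)
    have "exp (4/5 * r powr (5/2) - A * sqrt r) * r powr (-2) * ?h
       \<le> norm (exp (4 / 5 * ?s ^ 5 - a * ?s)) * norm (g (ray (central k) r)) * ?h"
      using elim e by (intro mult_right_mono mult_mono) auto
    also have "\<dots> \<le> B" using elim by (simp add: norm_mult)
    finally have le_B: "exp (4/5 * r powr (5/2) - A * sqrt r) * r powr (-2) * ?h \<le> B" .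
    define X where "X = exp (A * sqrt r - 4/5 * r powr (5/2))"
    define Y where "Y = exp (4/5 * r powr (5/2) - A * sqrt r)"
    have XY: "X * Y = 1" by (simp add: X_def Y_def flip: exp_add)
    have rr: "r powr 2 * r powr (-2) = 1" unfolding powr_add[symmetric] using elim by simp
    have "?h = (r powr 2 * r powr (-2)) * (X * Y) * ?h" unfolding XY rr by simp
    also have "\<dots> = r powr 2 * X * (Y * r powr (-2) * ?h)" by (simp only: mult_ac)
    also have "\<dots> \<le> r powr 2 * X * B"
      using le_B by (intro mult_left_mono) (auto simp: X_def Y_def)
    finally have "?h \<le> B * r powr 2 * exp (A * sqrt r - 4/5 * r powr (5/2))"
      by (simp only: X_def mult_ac)
    then show ?case by (simp add: mult_right_mono)
  qed
qed

lemma ray_in_narrow_sector: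
  assumes "0 < r" "\<bar>\<theta> - ray_angle k \<psi>\<bar> < 2 * pi / 5 - \<delta>"
  shows "ray \<theta> r \<in> narrow_sector k \<psi> \<delta>"
  using assms is_Arg_ray[OF assms(1), of \<theta>] by (auto simp: narrow_sector_def ray_def)

lemma filterlim_ray_narrow_sector:
  assumes "\<bar>\<theta> - ray_angle k \<psi>\<bar> < 2 * pi / 5 - \<delta>"
  shows "filterlim (ray \<theta>) (inf at_infinity (principal (narrow_sector k \<psi> \<delta>))) at_top"
proof -
  have "\<forall>\<^sub>F r in at_top. ray \<theta> r \<in> narrow_sector k \<psi> \<delta>"
    using eventually_gt_at_top[of 0] by eventually_elim (rule ray_in_narrow_sector[OF _ assms])
  then show ?thesis by (simp add: filterlim_inf filterlim_principal filterlim_ray)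
qed

lemma cramer2:
  fixes x1 x2 p1 p2 q1 q2 :: complex
  shows "(p1 * q2 - q1 * p2) * x1 = (x1 * q2 - q1 * x2) * p1 + (p1 * x2 - x1 * p2) * q1"
    "(p1 * q2 - q1 * p2) * x2 = (x1 * q2 - q1 * x2) * p2 + (p1 * x2 - x1 * p2) * q2"
  by (simp_all add: algebra_simps)

section \<open>Decaying frames and their Wronskians\<close>

context lax_system
begin

abbreviation narrow :: "int \<Rightarrow> real \<Rightarrow> real \<Rightarrow> complex filter" where
  "narrow k \<psi> \<delta> \<equiv> inf at_infinity (principal (narrow_sector k \<psi> \<delta>))"

lemma asymptotic_ray:
  assumes "asymptotic (narrow k \<psi> \<delta>) k u w" "\<bar>\<theta> - ray_angle k \<psi>\<bar> < 2 * pi / 5 - \<delta>"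
  shows "((\<lambda>r. phase k (ray \<theta> r) * branch_power k \<nu> (ray \<theta> r) * w (ray \<theta> r)) \<longlongrightarrow> 1) at_top"
    and "((\<lambda>r. phase k (ray \<theta> r) * branch_power k \<nu> (ray \<theta> r) * (f (ray \<theta> r) / branch_sqrt k (ray \<theta> r) ^ 3) * u (ray \<theta> r)) \<longlongrightarrow> -2) at_top"
  using assms(1) filterlim_ray_narrow_sector[OF assms(2)] unfolding asymptotic_def
  by (auto intro: filterlim_compose)

lemma central_in:
  assumes "\<bar>\<psi>\<bar> < pi / 2" "\<delta> \<le> pi / 5"
  shows "\<bar>central k - ray_angle k \<psi>\<bar> < 2 * pi / 5 - \<delta>"
proof -
  have "central k - ray_angle k \<psi> = - (2 * \<psi> / 5)" by (simp add: central_def ray_angle_def)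
  then show ?thesis using assms by simp
qed

lemma eventually_f_ge: "\<forall>\<^sub>F r in at_top. 1 \<le> norm (f (ray \<theta> r))"
proof -
  have "\<forall>\<^sub>F r in at_top. norm (ray \<theta> r) \<ge> norm y0 + 1"
    using filterlim_ray[of \<theta>] by (auto simp: filterlim_at_infinity_conv_norm_at_top filterlim_at_top)
  then show ?thesis
  proof eventually_elim
    case (elim r)
    then have "1 \<le> norm (ray \<theta> r - y0)" using norm_triangle_ineq2[of "ray \<theta> r" y0] by linarith
    then have "1 ^ j \<le> norm (ray \<theta> r - y0) ^ j" by (intro power_mono) auto
    then show ?case by (simp add: f_def norm_mult norm_power)
  qed
qed

lemma superdecay_of_limits:
  assumes "((\<lambda>r. phase k (ray (central k) r) * branch_power k p (ray (central k) r) * h (ray (central k) r)) \<longlongrightarrow> L) at_top" "-2 \<le> p"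
  shows "superdecay k h"
proof (rule superdecay_of_phase[OF assms(1)[unfolded phase_def]])
  show "\<forall>\<^sub>F r in at_top. r powr (-2) \<le> norm (branch_power k p (ray (central k) r))"
    using eventually_ge_at_top[of 1]
    by eventually_elim (use assms(2) in \<open>simp add: norm_branch_power norm_ray powr_mono\<close>)
qed

lemma asymptotic_superdecay:
  assumes "asymptotic (narrow k \<psi> \<delta>) k u w" "\<bar>\<psi>\<bar> < pi / 2" "\<delta> \<le> pi / 5"
  shows "superdecay k u" "superdecay k w"
proof -
  note L = asymptotic_ray[OF assms(1) central_in[OF assms(2,3)]]
  show "superdecay k w" by (rule superdecay_of_limits[OF L(1)]) (use j in \<open>auto simp: \<nu>_def\<close>)
  have L2: "((\<lambda>r. exp (4 / 5 * branch_sqrt k (ray (central k) r) ^ 5 - a * branch_sqrt k (ray (central k) r))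
      * (branch_power k \<nu> (ray (central k) r) * (f (ray (central k) r) / branch_sqrt k (ray (central k) r) ^ 3))
      * u (ray (central k) r)) \<longlongrightarrow> -2) at_top"
    using L(2) by (simp add: phase_def mult.assoc)
  show "superdecay k u"
  proof (rule superdecay_of_phase[OF L2], use eventually_ge_at_top[of 1] eventually_f_ge[of "central k"] in eventually_elim)
    case (elim r)
    have "r powr (-2) \<le> r powr (\<nu> - 3/2)" using elim j by (intro powr_mono) (auto simp: \<nu>_def)
    also have "\<dots> = r powr \<nu> * (1 / sqrt r ^ 3)"
      using elim by (simp add: powr_diff powr_half_sqrt[symmetric] powr_power)
    also have "\<dots> \<le> r powr \<nu> * (norm (f (ray (central k) r)) / sqrt r ^ 3)"
      using elim by (intro mult_left_mono divide_right_mono) auto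
    finally show ?case
      using elim by (simp add: norm_mult norm_divide norm_power norm_branch_power norm_branch_sqrt norm_ray)
  qed
qed

lemma solution_det_zero:
  assumes "solution u w" "solution u' w'" "superdecay k u" "superdecay k w" "superdecay k u'" "superdecay k w'"
  shows "u l * w' l - u' l * w l = 0"
proof -
  let ?c = "central k"
  have "((\<lambda>r. u (ray ?c r) * w' (ray ?c r) - u' (ray ?c r) * w (ray ?c r)) \<longlongrightarrow> 0 * 0 - 0 * 0) at_top"
    using assms(3-6) by (intro tendsto_diff tendsto_mult superdecay_imp_tendsto)
  then have "((\<lambda>r. u 0 * w' 0 - u' 0 * w 0) \<longlongrightarrow> 0) (at_top :: real filter)"
    by (subst (asm) solution_det_constant[OF assms(1,2)]) simp
  then have "u 0 * w' 0 - u' 0 * w 0 = 0" by (simp add: tendsto_const_iff)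
  then show ?thesis using solution_det_constant[OF assms(1,2), of l] by simp
qed

text \<open>The pair is in fact unique: decay determines it up to a factor and the limit 1 fixes the
  factor. The parameters 0 and \<open>pi / 10\<close> leave a half-opening of 3 pi / 10, enough to
  reach the directions halfway to the neighbouring central rays, where consecutive frames are
  compared.\<close>

definition frame :: "int \<Rightarrow> (complex \<Rightarrow> complex) \<times> (complex \<Rightarrow> complex)" where
  "frame k = (SOME uw. solution (fst uw) (snd uw) \<and> asymptotic (narrow k 0 (pi / 10)) k (fst uw) (snd uw))"

definition "U k = fst (frame k)"
definition "W k = snd (frame k)"

lemma frame_solution: "solution (U k) (W k)"
  and frame_asymptotic0: "asymptotic (narrow k 0 (pi / 10)) k (U k) (W k)"
proof -
  have "\<exists>uw. solution (fst uw) (snd uw) \<and> asymptotic (narrow k 0 (pi / 10)) k (fst uw) (snd uw)"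
    using asymptotic_solution_exists[of 0 "pi / 10" k] by auto
  from someI_ex[OF this] show "solution (U k) (W k)" "asymptotic (narrow k 0 (pi / 10)) k (U k) (W k)"
    unfolding U_def W_def frame_def by auto
qed

lemma frame_superdecay: "superdecay k (U k)" "superdecay k (W k)"
  using asymptotic_superdecay[OF frame_asymptotic0] by auto

lemma neg_one_powi_Suc: "(-1::complex) powi (k + 1) = - ((-1) powi k)"
  by (simp add: power_int_add)

text \<open>On the ray halfway between the central directions of \<open>k\<close> and
  \<open>k + 1\<close> both asymptotics hold. There the two branches of the square root are
  opposite, the phases are inverse to each other and the powers agree, so the constant Wronskian can
  be read off as a limit.\<close>

lemma frame_det: "U k l * W (k + 1) l - U (k + 1) l * W k l = - 2 * (-1) powi k"
proof -
  define \<theta> where "\<theta> = central k + pi / 5"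
  have k1: "central (k + 1) = central k + 2 * pi / 5" by (simp add: central_def ring_distribs add_divide_distrib)
  have in0: "\<bar>\<theta> - ray_angle k 0\<bar> < 2 * pi / 5 - pi / 10" "\<bar>\<theta> - ray_angle (k + 1) 0\<bar> < 2 * pi / 5 - pi / 10"
  proof -
    have "\<theta> - ray_angle k 0 = pi / 5" "\<theta> - ray_angle (k + 1) 0 = - (pi / 5)"
      by (simp_all add: \<theta>_def ray_angle_def central_def ring_distribs add_divide_distrib)
    then show "\<bar>\<theta> - ray_angle k 0\<bar> < 2 * pi / 5 - pi / 10" "\<bar>\<theta> - ray_angle (k + 1) 0\<bar> < 2 * pi / 5 - pi / 10"
      using pi_gt_zero by (simp_all only:)
  qed
  have ink: "\<bar>\<theta> - central k\<bar> < 3 * pi / 5" "\<bar>\<theta> - central (k + 1)\<bar> < 3 * pi / 5"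
    using k1 by (auto simp: \<theta>_def)
  define D where "D = U k 0 * W (k + 1) 0 - U (k + 1) 0 * W k 0"
  have D: "U k l * W (k + 1) l - U (k + 1) l * W k l = D" for l
    unfolding D_def by (rule solution_det_constant[OF frame_solution frame_solution])
  define l where "l = ray \<theta>"
  define b where "b r = branch_power k \<nu> (l r)" for r
  define s where "s r = branch_sqrt k (l r)" for r
  have s': "branch_sqrt (k + 1) (l r) = - s r" if "0 < r" for r
    using that ink by (simp add: s_def l_def branch_sqrt_ray neg_one_powi_Suc)
  have b': "branch_power (k + 1) \<nu> (l r) = b r" if "0 < r" for r
    using that ink by (simp add: b_def l_def branch_power_ray)
  define e where "e r = exp (4 / 5 * s r ^ 5 - a * s r)" for r
  have ph: "phase k (l r) = e r" for r by (simp add: e_def phase_def s_def)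
  have ph': "phase (k + 1) (l r) = inverse (e r)" if "0 < r" for r
    by (simp add: e_def phase_def s'[OF that] exp_minus[symmetric])
  note L = asymptotic_ray[OF frame_asymptotic0 in0(1), folded l_def]
  note L' = asymptotic_ray[OF frame_asymptotic0 in0(2), folded l_def]
  have ev: "\<forall>\<^sub>F r in at_top. (0::real) < r" by (rule eventually_gt_at_top)
  have t1: "((\<lambda>r. (phase k (l r) * branch_power k \<nu> (l r) * (f (l r) / branch_sqrt k (l r) ^ 3) * U k (l r)) *
      (phase (k + 1) (l r) * branch_power (k + 1) \<nu> (l r) * W (k + 1) (l r)) +
      (phase k (l r) * branch_power k \<nu> (l r) * W k (l r)) *
      (phase (k + 1) (l r) * branch_power (k + 1) \<nu> (l r) * (f (l r) / branch_sqrt (k + 1) (l r) ^ 3) * U (k + 1) (l r))) \<longlongrightarrow> -2 * 1 + 1 * -2) at_top"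
    by (intro tendsto_add tendsto_mult L L')
  have t2: "\<forall>\<^sub>F r in at_top. (phase k (l r) * branch_power k \<nu> (l r) * (f (l r) / branch_sqrt k (l r) ^ 3) * U k (l r)) *
      (phase (k + 1) (l r) * branch_power (k + 1) \<nu> (l r) * W (k + 1) (l r)) +
      (phase k (l r) * branch_power k \<nu> (l r) * W k (l r)) *
      (phase (k + 1) (l r) * branch_power (k + 1) \<nu> (l r) * (f (l r) / branch_sqrt (k + 1) (l r) ^ 3) * U (k + 1) (l r))
      = b r ^ 2 * f (l r) / s r ^ 3 * D"
    using ev
  proof eventually_elim
    case (elim r)
    have e0: "e r \<noteq> 0" by (simp add: e_def)
    have "(e r * b r * (f (l r) / s r ^ 3) * U k (l r)) * (inverse (e r) * b r * W (k + 1) (l r)) +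
      (e r * b r * W k (l r)) * (inverse (e r) * b r * (f (l r) / (- s r) ^ 3) * U (k + 1) (l r))
      = b r ^ 2 * f (l r) / s r ^ 3 * (U k (l r) * W (k + 1) (l r) - U (k + 1) (l r) * W k (l r))"
    proof -
      have "(x * b r * F * y) * (x' * b r * z) + (x * b r * z') * (x' * b r * (- F) * y')
          = b r ^ 2 * F * (y * z - y' * z')" if "x * x' = 1" for x x' y y' z z' F :: complex
      proof -
        have "(x * b r * F * y) * (x' * b r * z) + (x * b r * z') * (x' * b r * (- F) * y')
            = (x * x') * (b r ^ 2 * F * (y * z - y' * z'))"
          by (simp add: power2_eq_square algebra_simps)
        then show ?thesis using that by simp
      qed
      from this[of "e r" "inverse (e r)" "f (l r) / s r ^ 3"] e0 show ?thesis by simp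
    qed
    then show ?case unfolding ph ph'[OF elim] s'[OF elim] b'[OF elim] D
      by (simp only: b_def[symmetric] s_def[symmetric])
  qed
  have lim: "((\<lambda>r. b r ^ 2 * f (l r) / s r ^ 3 * D) \<longlongrightarrow> -4) at_top"
    using Lim_transform_eventually[OF t1 t2] by simp
  have "((\<lambda>r. b r ^ 2 * f (l r) / s r ^ 3) \<longlongrightarrow> (-1) powi k * 2 * (1 - y0 * 0) ^ j) at_top"
  proof (rule Lim_transform_eventually)
    have "((\<lambda>r. inverse (l r)) \<longlongrightarrow> 0) at_top"
      unfolding l_def by (rule filterlim_compose[OF tendsto_inverse_0 filterlim_ray])
    then show "((\<lambda>r. (-1) powi k * 2 * (1 - y0 * inverse (l r)) ^ j) \<longlongrightarrow> (-1) powi k * 2 * (1 - y0 * 0) ^ j) at_top"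
      by (intro tendsto_intros)
    show "\<forall>\<^sub>F r in at_top. (-1) powi k * 2 * (1 - y0 * inverse (l r)) ^ j = b r ^ 2 * f (l r) / s r ^ 3"
      using ev
    proof eventually_elim
      case (elim r)
      have l0: "l r \<noteq> 0" using elim by (auto simp: l_def ray_def)
      have sh: "branch_power k (1/2) (l r) = (-1) powi k * s r" unfolding s_def by (rule branch_power_half)
      have s2: "s r ^ 2 = l r"
        unfolding s_def using branch_sqrt_square[OF l0 _ ink(1)] is_Arg_ray[OF elim] by (simp add: l_def)
      have s0: "s r \<noteq> 0" using s2 l0 by auto
      \<comment> \<open>Since \<open>2 * \<nu> + j = 3/2\<close>, the algebraic factors combine to
        the cube of the square root; \<open>(-1) powi k\<close> is the sign that
        \<open>branch_sqrt\<close> carries against \<open>branch_power\<close>.\<close>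
      have bj: "b r ^ 2 * l r ^ j = (-1) powi k * s r ^ 3"
      proof -
        have b2: "b r ^ 2 = branch_power k (2 * \<nu>) (l r)"
          using branch_power_add[OF l0, of k \<nu> \<nu>] by (simp add: b_def power2_eq_square)
        consider "j = 0" | "j = 1" using j by blast
        then show ?thesis
        proof cases
          case 1
          have "2 * \<nu> = 1/2 + (1/2 + 1/2)" unfolding \<nu>_def using 1 by simp
          then have "b r ^ 2 = branch_power k (1/2) (l r) * (branch_power k (1/2) (l r) * branch_power k (1/2) (l r))"
            using b2 by (simp only: branch_power_add[OF l0])
          then show ?thesis unfolding sh using 1 powi_minus_one_power[of k]
            by (simp add: power2_eq_square power3_eq_cube mult_ac)
        next
          case 2
          have "2 * \<nu> = 1/2" unfolding \<nu>_def using 2 by simp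
          then have "b r ^ 2 = (-1) powi k * s r" using b2 sh by (simp only:)
          then show ?thesis unfolding s2[symmetric] using 2 by (simp add: power2_eq_square power3_eq_cube)
        qed
      qed
      have "f (l r) = 2 * (l r * (1 - y0 * inverse (l r))) ^ j"
      proof -
        have "l r * (1 - y0 * inverse (l r)) = l r - y0" using l0 by (simp add: right_diff_distrib)
        then show ?thesis by (simp only: f_def)
      qed
      then have "b r ^ 2 * f (l r) / s r ^ 3 = 2 * (b r ^ 2 * l r ^ j) * (1 - y0 * inverse (l r)) ^ j / s r ^ 3"
        by (simp add: power_mult_distrib mult_ac)
      also have "\<dots> = (-1) powi k * 2 * (1 - y0 * inverse (l r)) ^ j"
        unfolding bj using s0 by simp
      finally show ?case ..
    qed
  qed
  then have "((\<lambda>r. b r ^ 2 * f (l r) / s r ^ 3 * D) \<longlongrightarrow> (-1) powi k * 2 * D) at_top"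
    by (intro tendsto_mult_right) simp
  then have eq: "(-1) powi k * 2 * D = -4" using lim by (rule tendsto_unique[OF trivial_limit_at_top_linorder])
  have "((-1) powi k)^2 * (2 * D) = (-1) powi k * ((-1) powi k * 2 * D)"
    by (simp only: power2_eq_square mult.assoc)
  also have "\<dots> = (-1) powi k * -4" by (simp only: eq)
  finally have "D = - 2 * (-1) powi k" unfolding powi_minus_one_power by simp
  then show ?thesis unfolding D .
qed

lemma frame_det_nonzero: "U k l * W (k + 1) l - U (k + 1) l * W k l \<noteq> 0"
  unfolding frame_det by simp

lemma solution_in_frame:
  assumes "solution u w"
  obtains s t where "\<And>l. u l = s * U k l + t * U (k + 1) l" "\<And>l. w l = s * W k l + t * W (k + 1) l"
    "\<And>l. - 2 * (-1) powi k * s = u l * W (k + 1) l - U (k + 1) l * w l"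
    "\<And>l. - 2 * (-1) powi k * t = U k l * w l - u l * W k l"
proof -
  define D where "D = - 2 * (-1::complex) powi k"
  have D: "D \<noteq> 0" "\<And>l. U k l * W (k + 1) l - U (k + 1) l * W k l = D" unfolding D_def frame_det by auto
  define s where "s = (u 0 * W (k + 1) 0 - U (k + 1) 0 * w 0) / D"
  define t where "t = (U k 0 * w 0 - u 0 * W k 0) / D"
  have s: "u l * W (k + 1) l - U (k + 1) l * w l = D * s" for l
  proof -
    have "u l * W (k + 1) l - U (k + 1) l * w l = u 0 * W (k + 1) 0 - U (k + 1) 0 * w 0"
      by (rule solution_det_constant[OF assms frame_solution])
    then show ?thesis using D(1) by (simp add: s_def)
  qed
  have t: "U k l * w l - u l * W k l = D * t" for l
  proof -
    have "U k l * w l - u l * W k l = U k 0 * w 0 - u 0 * W k 0"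
      by (rule solution_det_constant[OF frame_solution assms])
    then show ?thesis using D(1) by (simp add: t_def)
  qed
  have "D * u l = D * (s * U k l + t * U (k + 1) l)" "D * w l = D * (s * W k l + t * W (k + 1) l)" for l
    using cramer2[of "U k l" "W (k + 1) l" "U (k + 1) l" "W k l", where ?x1.0 = "u l" and ?x2.0 = "w l"]
    unfolding D(2) s t by (simp_all only: ring_distribs mult.assoc)
  with D(1) have "u l = s * U k l + t * U (k + 1) l" "w l = s * W k l + t * W (k + 1) l" for l by simp_all
  then show ?thesis using that s t unfolding D_def by simp
qed

text \<open>In the basis of indices \<open>k\<close> and \<open>k + 1\<close> the coefficient of the
  second vector is, up to a constant, the Wronskian of two solutions that decay on the same ray. It
  is constant and tends to 0, hence vanishes.\<close>

lemma superdecay_multiple: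
  assumes "solution u w" "superdecay k u" "superdecay k w"
  obtains s where "\<And>l. u l = s * U k l" "\<And>l. w l = s * W k l"
proof -
  obtain s t where st: "\<And>l. u l = s * U k l + t * U (k + 1) l" "\<And>l. w l = s * W k l + t * W (k + 1) l"
    "\<And>l. - 2 * (-1) powi k * t = U k l * w l - u l * W k l"
    using solution_in_frame[OF assms(1), of k] by metis
  have "U k 0 * w 0 - u 0 * W k 0 = 0"
    by (rule solution_det_zero[OF frame_solution assms(1) frame_superdecay assms(2,3)])
  then have "t = 0" using st(3)[of 0] by simp
  then show ?thesis using that[of s] st(1,2) by simp
qed

lemma multiple_unique:
  assumes "\<And>l. s * U k l = t * U k l" "\<And>l. s * W k l = t * W k l"
  shows "s = t"
  using frame_det_nonzero[of k 0] assms[of 0] by auto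

text \<open>The solution built on a ray rotated by \<psi> still decays on the central ray, so it is
  a multiple of the frame, and the limits there give the factor 1. The frame thus inherits the
  asymptotics of all rotated sectors.\<close>

lemma frame_asymptotic_narrow:
  assumes "\<bar>\<psi>\<bar> < pi / 2" "0 < \<delta>" "\<delta> \<le> pi / 5"
  shows "asymptotic (narrow k \<psi> \<delta>) k (U k) (W k)"
proof -
  obtain u w where uw: "solution u w" "asymptotic (narrow k \<psi> \<delta>) k u w"
    using asymptotic_solution_exists[OF assms(1,2)] by blast
  obtain s where s: "\<And>l. u l = s * U k l" "\<And>l. w l = s * W k l"
    using superdecay_multiple[OF uw(1) asymptotic_superdecay[OF uw(2) assms(1,3)]] by metis
  have "\<bar>central k - ray_angle k 0\<bar> < 2 * pi / 5 - pi / 10" by (rule central_in) auto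
  from tendsto_mult_left[OF asymptotic_ray(1)[OF frame_asymptotic0 this], of s]
  have "((\<lambda>r. phase k (ray (central k) r) * branch_power k \<nu> (ray (central k) r) * w (ray (central k) r)) \<longlongrightarrow> s * 1) at_top"
    by (simp add: s(2) mult_ac)
  then have "s * 1 = 1"
    using asymptotic_ray(1)[OF uw(2) central_in[OF assms(1,3)]] by (rule tendsto_unique[OF trivial_limit_at_top_linorder])
  then have "u = U k" "w = W k" using s by auto
  then show ?thesis using uw(2) by simp
qed

end

text \<open>Rotations close to \<plusminus> pi / 2 move the centre of a sector of half-opening
  nearly 2 pi / 5 by nearly pi / 5, and 2 pi / 5 + pi / 5 is the full half-opening 3 pi / 5. Two
  such sectors overlap around the central ray.\<close>

lemma sector_subset_narrow:
  assumes "0 < \<epsilon>" "\<epsilon> \<le> pi / 5"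
  shows "sector k \<epsilon> \<subseteq> narrow_sector k (pi / 2 - \<epsilon>) (\<epsilon> / 2) \<union> narrow_sector k (- (pi / 2 - \<epsilon>)) (\<epsilon> / 2)"
proof
  fix l assume "l \<in> sector k \<epsilon>"
  then obtain \<theta> where \<theta>: "l \<noteq> 0" "is_Arg l \<theta>" "\<bar>\<theta> - 2 * pi * of_int k / 5\<bar> < 3 * pi / 5 - \<epsilon>"
    by (auto simp: sector_def)
  define x where "x = \<theta> - 2 * pi * of_int k / 5"
  have x: "\<theta> = x + 2 * pi * of_int k / 5" "\<bar>x\<bar> < 3 * pi / 5 - \<epsilon>" using \<theta> by (auto simp: x_def)
  show "l \<in> narrow_sector k (pi / 2 - \<epsilon>) (\<epsilon> / 2) \<union> narrow_sector k (- (pi / 2 - \<epsilon>)) (\<epsilon> / 2)"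
  proof (cases "x \<ge> 0")
    case True
    have "\<bar>\<theta> - ray_angle k (pi / 2 - \<epsilon>)\<bar> < 2 * pi / 5 - \<epsilon> / 2"
      using True x assms by (simp add: ray_angle_def abs_less_iff field_simps)
    then show ?thesis using \<theta> by (auto simp: narrow_sector_def)
  next
    case False
    have "\<bar>\<theta> - ray_angle k (- (pi / 2 - \<epsilon>))\<bar> < 2 * pi / 5 - \<epsilon> / 2"
      using False x assms by (simp add: ray_angle_def abs_less_iff field_simps)
    then show ?thesis using \<theta> by (auto simp: narrow_sector_def)
  qed
qed

section \<open>Asymptotics in the full sector\<close>

context lax_system
begin

lemma asymptotic_mono: "F \<le> G \<Longrightarrow> asymptotic G k u w \<Longrightarrow> asymptotic F k u w"
  unfolding asymptotic_def by (blast intro: tendsto_mono)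

lemma asymptotic_sup: "asymptotic F k u w \<Longrightarrow> asymptotic G k u w \<Longrightarrow> asymptotic (sup F G) k u w"
  unfolding asymptotic_def by (blast intro: filterlim_sup)

lemma frame_asymptotic:
  assumes "0 < \<epsilon>"
  shows "asymptotic (sector_at_infinity k \<epsilon>) k (U k) (W k)"
proof -
  define e where "e = min \<epsilon> (pi / 5)"
  have e: "0 < e" "e \<le> pi / 5" "e \<le> \<epsilon>" using assms by (auto simp: e_def)
  have "sector k \<epsilon> \<subseteq> sector k e" using e by (auto simp: sector_def intro: order.strict_trans2)
  also have "\<dots> \<subseteq> narrow_sector k (pi / 2 - e) (e / 2) \<union> narrow_sector k (- (pi / 2 - e)) (e / 2)"
    by (rule sector_subset_narrow[OF e(1,2)])
  finally have "sector_at_infinity k \<epsilon> \<le> sup (narrow k (pi / 2 - e) (e / 2)) (narrow k (- (pi / 2 - e)) (e / 2))"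
    unfolding sector_at_infinity_def inf_sup_distrib1[symmetric] sup_principal by (intro inf_mono) auto
  moreover have "asymptotic (sup (narrow k (pi / 2 - e) (e / 2)) (narrow k (- (pi / 2 - e)) (e / 2))) k (U k) (W k)"
    using e by (intro asymptotic_sup frame_asymptotic_narrow) auto
  ultimately show ?thesis by (rule asymptotic_mono)
qed

end

text \<open>The additional argument 2 pi changes the sign of the half-angle factor and
  \<open>(-1) powi (k + 5)\<close> changes it back. So the phase has period 5 in \<open>k\<close>,
  while a power picks up its monodromy.\<close>

lemma branch_shift:
  assumes "0 < r"
  shows "branch_sqrt (k + 5) (ray (central k) r) = branch_sqrt k (ray (central k) r)"
    and "branch_power (k + 5) p (ray (central k) r) = cis (2 * pi * p) * branch_power k p (ray (central k) r)"
proof -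
  have c: "central (k + 5) = central k + 2 * pi" by (simp add: central_def ring_distribs add_divide_distrib)
  have eq: "ray (central k) r = ray (central (k + 5)) r" by (simp add: c ray_def flip: cis_mult)
  have "branch_sqrt (k + 5) (ray (central (k + 5)) r) = (-1) powi (k + 5) * of_real (sqrt r) * cis (central (k + 5) / 2)"
    using assms by (intro branch_sqrt_ray) auto
  moreover have "(-1::complex) powi (k + 5) = - ((-1) powi k)" by (simp add: power_int_add)
  moreover have "cis (central (k + 5) / 2) = - cis (central k / 2)" by (simp add: c add_divide_distrib flip: cis_mult)
  moreover have "branch_sqrt k (ray (central k) r) = (-1) powi k * of_real (sqrt r) * cis (central k / 2)"
    using assms by (intro branch_sqrt_ray) auto
  ultimately show "branch_sqrt (k + 5) (ray (central k) r) = branch_sqrt k (ray (central k) r)"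
    by (simp add: eq)
  have "branch_power (k + 5) p (ray (central (k + 5)) r) = of_real (r powr p) * cis (p * central (k + 5))"
    using assms by (intro branch_power_ray) auto
  moreover have "cis (p * central (k + 5)) = cis (2 * pi * p) * cis (p * central k)"
    by (simp add: c cis_mult ring_distribs add.commute mult_ac)
  moreover have "branch_power k p (ray (central k) r) = of_real (r powr p) * cis (p * central k)"
    using assms by (intro branch_power_ray) auto
  ultimately show "branch_power (k + 5) p (ray (central k) r) = cis (2 * pi * p) * branch_power k p (ray (central k) r)"
    by (simp add: eq)
qed

lemma superdecay_shift: "superdecay (k + 5) h \<longleftrightarrow> superdecay k h"
proof -
  have "ray (central (k + 5)) r = ray (central k) r" for r
    by (simp add: central_def ray_def ring_distribs add_divide_distrib flip: cis_mult)
  then show ?thesis by (simp add: superdecay_def)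
qed

lemma periodic_of_int_5:
  fixes g :: "int \<Rightarrow> 'a"
  assumes "\<And>k. g (k + 5) = g k" "(of_int k :: 5) = of_int k'"
  shows "g k = g k'"
proof -
  have mod: "k mod 5 = k' mod 5" using assms(2) by (simp only: of_int_5_eq_iff)
  have *: "g (k + 5 * int n) = g k" for k n
  proof (induction n)
    case (Suc n)
    have "g (k + 5 * int (Suc n)) = g (k + 5 * int n + 5)" by (simp add: algebra_simps)
    also have "\<dots> = g k" using assms(1) Suc by simp
    finally show ?case .
  qed simp
  have "g i = g (i mod 5)" for i
  proof (cases "i div 5 \<ge> 0")
    case True
    then obtain n where "i div 5 = int n" using nonneg_int_cases by blast
    then show ?thesis using *[of "i mod 5" n] by (metis add.commute mult_div_mod_eq)
  next
    case False
    then obtain n where n: "i div 5 = - int n" by (metis int_cases2 linear neg_0_le_iff_le of_nat_0_le_iff)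
    have "i + 5 * int n = i mod 5" using n mult_div_mod_eq[of 5 i] by simp
    then show ?thesis using *[of i n] by simp
  qed
  then show ?thesis using mod by metis
qed

section \<open>Stokes multipliers, their periodicity and their comparison\<close>

context lax_system
begin

text \<open>Cramer's rule for the Stokes relation; Wronskians being constant, they are evaluated at
  0.\<close>

definition stokes :: "int \<Rightarrow> complex" where
  "stokes k = (U (k - 1) 0 * W (k + 1) 0 - U (k + 1) 0 * W (k - 1) 0) / (- 2 * (-1) powi k)"

text \<open>The coefficient of index \<open>k + 1\<close> is 1 because consecutive frame Wronskians
  differ exactly by a sign.\<close>

lemma stokes_relation:
  "U (k - 1) l = U (k + 1) l + stokes k * U k l"
  "W (k - 1) l = W (k + 1) l + stokes k * W k l"
proof -
  obtain s t where st: "\<And>l. U (k - 1) l = s * U k l + t * U (k + 1) l" "\<And>l. W (k - 1) l = s * W k l + t * W (k + 1) l"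
    "\<And>l. - 2 * (-1) powi k * s = U (k - 1) l * W (k + 1) l - U (k + 1) l * W (k - 1) l"
    "\<And>l. - 2 * (-1) powi k * t = U k l * W (k - 1) l - U (k - 1) l * W k l"
    using solution_in_frame[OF frame_solution[of "k - 1"], of k] by metis
  have e: "(-1::complex) powi k = - ((-1) powi (k - 1))" using neg_one_powi_Suc[of "k - 1"] by simp
  have "(- 2 * (-1) powi k) * t = U k 0 * W (k - 1) 0 - U (k - 1) 0 * W k 0" by (rule st(4))
  also have "\<dots> = - (U (k - 1) 0 * W k 0 - U k 0 * W (k - 1) 0)" by simp
  also have "\<dots> = - (- 2 * (-1) powi (k - 1))" using frame_det[of "k - 1" 0] by simp
  also have "\<dots> = (- 2 * (-1) powi k) * 1" unfolding e by simp
  finally have "(- 2 * (-1) powi k) * t = (- 2 * (-1) powi k) * 1" .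
  then have "t = 1" by (subst (asm) mult_cancel_left) simp
  moreover have "stokes k = s"
    unfolding stokes_def st(3)[of 0, symmetric] by simp
  ultimately show "U (k - 1) l = U (k + 1) l + stokes k * U k l" "W (k - 1) l = W (k + 1) l + stokes k * W k l"
    using st(1,2)[of l] by (simp_all add: add.commute)
qed

lemma stokes_unique:
  assumes "\<And>l. U (k - 1) l = U (k + 1) l + \<sigma> * U k l" "\<And>l. W (k - 1) l = W (k + 1) l + \<sigma> * W k l"
  shows "\<sigma> = stokes k"
proof (rule multiple_unique)
  show "\<sigma> * U k l = stokes k * U k l" "\<sigma> * W k l = stokes k * W k l" for l
    using assms[of l] stokes_relation[of k l] by auto
qed

text \<open>This is \<open>- \<i>\<close> for \<nu> = 1/4 and \<open>\<i>\<close> for \<nu> = 3/4;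
  the opposite signs are the origin of \<open>sg\<close> in the comparison.\<close>

definition period :: complex where "period = cis (- (2 * pi * \<nu>))"

text \<open>Indices \<open>k\<close> and \<open>k + 5\<close> have the same central ray, hence
  proportional decaying solutions; the factor is the inverse of the monodromy of
  \<open>branch_power\<close>.\<close>

lemma frame_shift: "U (k + 5) l = period * U k l" "W (k + 5) l = period * W k l"
proof -
  obtain s where s: "\<And>l. U (k + 5) l = s * U k l" "\<And>l. W (k + 5) l = s * W k l"
    using superdecay_multiple[OF frame_solution[of "k + 5"], of k] frame_superdecay[of "k + 5"] superdecay_shift by metis
  define c where "c = central k"
  have in0: "\<bar>c - ray_angle k 0\<bar> < 2 * pi / 5 - pi / 10" unfolding c_def by (rule central_in) auto
  have in5: "\<bar>central (k + 5) - ray_angle (k + 5) 0\<bar> < 2 * pi / 5 - pi / 10" by (rule central_in) auto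
  have r5: "ray (central (k + 5)) r = ray c r" for r
    by (simp add: c_def central_def ray_def ring_distribs add_divide_distrib flip: cis_mult)
  have "((\<lambda>r. (cis (2 * pi * \<nu>) * s) * (phase k (ray c r) * branch_power k \<nu> (ray c r) * W k (ray c r))) \<longlongrightarrow> (cis (2 * pi * \<nu>) * s) * 1) at_top"
    by (intro tendsto_mult_left asymptotic_ray(1)[OF frame_asymptotic0 in0])
  moreover have "\<forall>\<^sub>F r in at_top. (cis (2 * pi * \<nu>) * s) * (phase k (ray c r) * branch_power k \<nu> (ray c r) * W k (ray c r))
     = phase (k + 5) (ray c r) * branch_power (k + 5) \<nu> (ray c r) * W (k + 5) (ray c r)"
    using eventually_gt_at_top[of 0]
  proof eventually_elim
    case (elim r)
    show ?case unfolding phase_def c_def branch_shift[OF elim] s by (simp only: mult_ac)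
  qed
  ultimately have "((\<lambda>r. phase (k + 5) (ray c r) * branch_power (k + 5) \<nu> (ray c r) * W (k + 5) (ray c r)) \<longlongrightarrow> (cis (2 * pi * \<nu>) * s) * 1) at_top"
    by (rule Lim_transform_eventually)
  moreover have "((\<lambda>r. phase (k + 5) (ray c r) * branch_power (k + 5) \<nu> (ray c r) * W (k + 5) (ray c r)) \<longlongrightarrow> 1) at_top"
    using asymptotic_ray(1)[OF frame_asymptotic0 in5] by (simp only: r5)
  ultimately have "(cis (2 * pi * \<nu>) * s) * 1 = 1" by (rule tendsto_unique[OF trivial_limit_at_top_linorder])
  then have "period * 1 = (period * cis (2 * pi * \<nu>)) * s" by (simp add: mult.assoc)
  then have "s = period" by (simp add: period_def cis_mult)
  then show "U (k + 5) l = period * U k l" "W (k + 5) l = period * W k l" using s by simp_all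
qed

lemma period_nonzero [simp]: "period \<noteq> 0" by (simp add: period_def)

lemma stokes_shift: "stokes (k + 5) = stokes k"
proof (rule sym, rule stokes_unique[symmetric, THEN sym, THEN sym])
  fix l
  have e: "k + 5 - 1 = (k - 1) + 5" "k + 5 + 1 = (k + 1) + 5" by simp_all
  show "U (k - 1) l = U (k + 1) l + stokes (k + 5) * U k l"
    using stokes_relation(1)[of "k + 5" l] unfolding e frame_shift
    by (simp add: mult.left_commute flip: ring_distribs)
  show "W (k - 1) l = W (k + 1) l + stokes (k + 5) * W k l"
    using stokes_relation(2)[of "k + 5" l] unfolding e frame_shift
    by (simp add: mult.left_commute flip: ring_distribs)
qed

text \<open>
  A decaying family determines the frame up to factors \<open>c k\<close>; the determinants force \<open>c k * c (k + 1)\<close> to be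
  constant, so \<open>c\<close> has period 2, and the shift by 5 compares its two values.
\<close>

lemma stokes_compare:
  fixes X Y :: "int \<Rightarrow> complex \<Rightarrow> complex" and \<sigma> :: "int \<Rightarrow> complex"
  assumes sol: "\<And>k. solution (X k) (Y k)" and dec: "\<And>k. superdecay k (X k)" "\<And>k. superdecay k (Y k)"
    and det: "\<And>k. X k 0 * Y (k + 1) 0 - X (k + 1) 0 * Y k 0 = D * (-1) powi k" and D: "D \<noteq> 0"
    and rel: "\<And>k l. X (k - 1) l = X (k + 1) l + \<sigma> k * X k l" "\<And>k l. Y (k - 1) l = Y (k + 1) l + \<sigma> k * Y k l"
    and per: "\<And>k l. X (k + 5) l = sg * period * X k l" "\<And>k l. Y (k + 5) l = sg * period * Y k l" and sg: "sg = 1 \<or> sg = -1"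
  shows "stokes k = sg * \<sigma> k"
proof -
  have "\<exists>s. \<forall>l. X k l = s * U k l \<and> Y k l = s * W k l" for k
    using superdecay_multiple[OF sol dec] by metis
  then obtain c where c: "\<And>k l. X k l = c k * U k l" "\<And>k l. Y k l = c k * W k l" by metis
  have cc: "c k * c (k + 1) = - D / 2" for k
  proof -
    have "D * (-1) powi k = c k * c (k + 1) * (U k 0 * W (k + 1) 0 - U (k + 1) 0 * W k 0)"
      unfolding det[symmetric] c by (simp add: algebra_simps)
    then have "D * (-1) powi k = (-1) powi k * (- 2 * (c k * c (k + 1)))" unfolding frame_det by (simp add: mult_ac)
    then have "(-1) powi k * D = (-1) powi k * (- 2 * (c k * c (k + 1)))" by (simp only: mult.commute)
    then have "D = - 2 * (c k * c (k + 1))" by (subst (asm) mult_cancel_left) simp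
    then show ?thesis by simp
  qed
  have c0: "c k \<noteq> 0" for k using cc[of k] D by auto
  have c2: "c (k + 2) = c k" for k
  proof -
    have "c (k + 1) * c (k + 2) = c (k + 1) * c k" using cc[of k] cc[of "k + 1"] by (simp add: mult.commute add.commute)
    then show ?thesis using c0 by simp
  qed
  have c5: "c (k + 5) = sg * c k" for k
  proof (rule multiple_unique)
    fix l
    have "period * (c (k + 5) * U k l) = period * (sg * c k * U k l)" "period * (c (k + 5) * W k l) = period * (sg * c k * W k l)"
      using per[of k l] unfolding c frame_shift by (simp_all add: mult_ac)
    then show "c (k + 5) * U k l = sg * c k * U k l" "c (k + 5) * W k l = sg * c k * W k l" by simp_all
  qed
  \<comment> \<open>Period 2 turns the shift by 5 into a shift by 1: neighbouring factors differ by
    \<open>sg\<close>, and this is the sign that reaches the multipliers.\<close>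
  have c1: "c (k + 1) = sg * c k" for k
    using c2[of "k + 1"] c2[of "k + 3"] c5[of k] by (simp add: add.assoc)
  have sg2: "sg * sg = 1" using sg by auto
  have cm: "c (k - 1) = sg * c k" using c1[of "k - 1"] sg2 by (simp flip: mult.assoc)
  have "sg * \<sigma> k = stokes k"
  proof (rule stokes_unique)
    fix l
    have "(sg * c k) * U (k - 1) l = (sg * c k) * (U (k + 1) l + sg * \<sigma> k * U k l)"
      "(sg * c k) * W (k - 1) l = (sg * c k) * (W (k + 1) l + sg * \<sigma> k * W k l)"
      using rel[of k l] sg2 unfolding c cm c1 by (simp_all add: algebra_simps)
    then show "U (k - 1) l = U (k + 1) l + sg * \<sigma> k * U k l" "W (k - 1) l = W (k + 1) l + sg * \<sigma> k * W k l"
      using c0[of k] sg by auto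
  qed
  then show ?thesis ..
qed

end

section \<open>The Lax pair and the cubic oscillator\<close>

lemma matrix_vector_2:
  fixes x :: "complex ^ 2"
  shows "(vector [vector [p, q], vector [r, s]] :: complex ^ 2 ^ 2) *v x = vector [p * x $ 1 + q * x $ 2, r * x $ 1 + s * x $ 2]"
  by (simp add: vec_eq_iff matrix_vector_mult_def sum_2 forall_2)

lemma tendsto_vec2:
  fixes g :: "'a \<Rightarrow> complex ^ 2"
  shows "(g \<longlongrightarrow> L) F \<longleftrightarrow> ((\<lambda>x. g x $ 1) \<longlongrightarrow> L $ 1) F \<and> ((\<lambda>x. g x $ 2) \<longlongrightarrow> L $ 2) F"
proof
  assume "((\<lambda>x. g x $ 1) \<longlongrightarrow> L $ 1) F \<and> ((\<lambda>x. g x $ 2) \<longlongrightarrow> L $ 2) F"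
  then have "((\<lambda>x. g x $ i) \<longlongrightarrow> L $ i) F" for i using exhaust_2[of i] by auto
  then show "(g \<longlongrightarrow> L) F" by (rule vec_tendstoI)
qed (auto intro: tendsto_vec_nth)

lemma filterlim_ray_sector:
  assumes "\<bar>\<theta> - central k\<bar> < 3 * pi / 5 - \<epsilon>"
  shows "filterlim (ray \<theta>) (sector_at_infinity k \<epsilon>) at_top"
proof -
  have "\<forall>\<^sub>F r in at_top. ray \<theta> r \<in> sector k \<epsilon>"
    using eventually_gt_at_top[of 0]
    by eventually_elim (use assms is_Arg_ray in \<open>auto simp: sector_def central_def ray_def\<close>)
  then show ?thesis by (simp add: sector_at_infinity_def filterlim_inf filterlim_principal filterlim_ray)
qed

text \<open>
  The parameters of the two instances are hidden behind constants, since the simplifier would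
  otherwise rewrite them inside every constant of the locale.
\<close>

definition lax_degree :: nat where "lax_degree = 1"

definition lax_entry :: "complex \<Rightarrow> complex \<Rightarrow> complex \<Rightarrow> complex" where
  "lax_entry x z l = 2 * l^2 + 2 * l * x - z + 2 * x^2"

definition cubic_entry :: "complex \<Rightarrow> complex \<Rightarrow> complex \<Rightarrow> complex" where
  "cubic_entry a b l = 2 * l^3 - a * l - 14 * b"

section \<open>The Lax system with coefficients frozen at one point\<close>

locale pi_point =
  fixes y :: "complex \<Rightarrow> complex" and z :: complex
begin

sublocale lax_system z "(deriv y z)^2 - 4 * (y z)^3 + 2 * z * y z" "deriv y z" "y z" lax_degree
  "lax_entry (y z) z"
proof
  show "lax_entry (y z) z holomorphic_on UNIV"
    unfolding lax_entry_def[abs_def] by (intro holomorphic_intros)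
  show "(deriv y z)^2 + 2 * (l - y z) ^ lax_degree * lax_entry (y z) z l =
      4 * l^3 - 2 * z * l + ((deriv y z)^2 - 4 * (y z)^3 + 2 * z * y z)" for l
    by (simp add: lax_entry_def lax_degree_def algebra_simps power2_eq_square power3_eq_cube)
qed (simp add: lax_degree_def)

lemma f_eq: "f l = 2 * (l - y z)"
  unfolding f_def unfolding lax_degree_def by simp

lemma nu_eq: "\<nu> = 1/4"
  unfolding \<nu>_def unfolding lax_degree_def by simp

lemma lax_matrix_solution:
  "(\<forall>l i. ((\<lambda>x. \<Phi> x $ i) has_field_derivative (PI_lax_matrix y z l *v \<Phi> l) $ i) (at l))
     \<longleftrightarrow> solution (\<lambda>l. \<Phi> l $ 1) (\<lambda>l. \<Phi> l $ 2)"
proof -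
  have "(2 * l - 2 * y z) * x - deriv y z * w = 2 * (l - y z) * x + - deriv y z * w" for l x w by (simp add: algebra_simps)
  then show ?thesis
    unfolding PI_lax_matrix_def matrix_vector_2 solution_def forall_2 f_eq lax_entry_def by (auto simp: vector_2)
qed

text \<open>Converts between the normalisations of the first component: \<open>asymptotic\<close>
  uses the power 1/4 times \<open>f / branch_sqrt k l ^ 3\<close>, the definition of the subdominant
  solution the power -1/4. The limit times -2 is the prescribed
  \<open>(-1) powi (k + 1)\<close>.\<close>

lemma l_over_f_tendsto: "((\<lambda>l. (-1) powi k * l / f l) \<longlongrightarrow> (-1) powi k / 2) at_infinity"
proof -
  have "((\<lambda>l::complex. (-1) powi k / (2 * (1 - y z * inverse l))) \<longlongrightarrow> (-1) powi k / (2 * (1 - y z * 0))) at_infinity"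
    by (intro tendsto_intros tendsto_inverse_0) auto
  moreover have "\<forall>\<^sub>F l in at_infinity. (-1) powi k / (2 * (1 - y z * inverse l)) = (-1) powi k * l / f l"
  proof -
    have "\<forall>\<^sub>F l in at_infinity. norm (l::complex) \<ge> 1" by (rule eventually_at_infinity[THEN iffD2]) blast
    then show ?thesis
    proof eventually_elim
      case (elim l)
      then have l: "l \<noteq> 0" by auto
      have "f l = l * (2 * (1 - y z * inverse l))" using l by (simp add: f_eq right_diff_distrib)
      then show ?case using l by simp
    qed
  qed
  ultimately show ?thesis using Lim_transform_eventually by fastforce
qed

lemma frame_is_subdominant: "is_PI_subdominant y z k (\<lambda>l. vector [U k l, W k l])"
  unfolding is_PI_subdominant_def lax_matrix_solution
proof (intro conjI allI impI)
  show "solution (\<lambda>l. (vector [U k l, W k l] :: complex ^ 2) $ 1) (\<lambda>l. (vector [U k l, W k l] :: complex ^ 2) $ 2)"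
    using frame_solution[of k] by simp
  fix \<epsilon> :: real assume \<epsilon>: "0 < \<epsilon>"
  let ?F = "sector_at_infinity k \<epsilon>"
  note A = frame_asymptotic[OF \<epsilon>, of k, unfolded asymptotic_def nu_eq]
  have "((\<lambda>l. ((-1) powi k * l / f l) * (phase k l * branch_power k (1/4) l * (f l / branch_sqrt k l ^ 3) * U k l)) \<longlongrightarrow> (-1) powi k / 2 * -2) ?F"
    using A by (intro tendsto_mult tendsto_mono[OF _ l_over_f_tendsto]) (auto simp: sector_at_infinity_def)
  moreover have "\<forall>\<^sub>F l in ?F. ((-1) powi k * l / f l) * (phase k l * branch_power k (1/4) l * (f l / branch_sqrt k l ^ 3) * U k l)
      = phase k l * (branch_power k (-1/4) l * U k l)"
  proof -
    have "\<forall>\<^sub>F l in ?F. norm l \<ge> norm (y z) + 1"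
      unfolding sector_at_infinity_def using eventually_at_infinity[of "\<lambda>l. norm l \<ge> norm (y z) + 1"]
      by (intro filter_leD[OF inf_le1]) blast
    moreover have "\<forall>\<^sub>F l in ?F. l \<in> sector k \<epsilon>" by (simp add: sector_at_infinity_def eventually_inf_principal)
    ultimately show ?thesis
    proof eventually_elim
      case (elim l)
      obtain \<theta> where \<theta>: "l \<noteq> 0" "is_Arg l \<theta>" "\<bar>\<theta> - central k\<bar> < 3 * pi / 5"
        using elim(2) \<epsilon> by (auto simp: sector_def central_def)
      have s2: "branch_sqrt k l ^ 2 = l" by (rule branch_sqrt_square[OF \<theta>])
      then have s0: "branch_sqrt k l \<noteq> 0" using \<theta>(1) by auto
      have f0: "f l \<noteq> 0" using elim(1) by (intro f_nonzero) auto
      have e: "branch_power k (1/4) l = branch_power k (-1/4) l * ((-1) powi k * branch_sqrt k l)"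
        using branch_power_add[OF \<theta>(1), of k "-1/4" "1/2"] by (simp add: branch_power_half)
      have gen: "((-1) powi k * x / F) * (p * (q * ((-1) powi k * s)) * (F / s ^ 3) * w) = p * (q * w)"
        if "F \<noteq> 0" "s \<noteq> 0" "x = s^2" for F s x p q w :: complex
      proof -
        have "((-1) powi k * x / F) * (p * (q * ((-1) powi k * s)) * (F / s ^ 3) * w) = ((-1) powi k)^2 * (p * (q * w))"
          using that by (simp add: power2_eq_square power3_eq_cube)
        then show ?thesis by (simp only: powi_minus_one_power mult_1)
      qed
      show ?case unfolding e by (rule gen[OF f0 s0 s2[symmetric]])
    qed
  qed
  ultimately have 1: "((\<lambda>l. phase k l * (branch_power k (-1/4) l * U k l)) \<longlongrightarrow> (-1) powi k / 2 * -2) ?F"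
    by (rule Lim_transform_eventually)
  have 2: "((\<lambda>l. phase k l * (branch_power k (1/4) l * W k l)) \<longlongrightarrow> 1) ?F"
    using A by (simp add: mult.assoc)
  show "((\<lambda>l. exp (4 / 5 * branch_sqrt k l ^ 5 - z * branch_sqrt k l) *s
                    ((vector [vector [branch_power k (- 1 / 4) l, 0],
                              vector [0, branch_power k (1 / 4) l]] :: complex ^ 2 ^ 2) *v vector [U k l, W k l]))
              \<longlongrightarrow> vector [(-1) powi (k + 1), 1]) ?F"
    unfolding tendsto_vec2 matrix_vector_2 using 1 2 by (simp add: phase_def neg_one_powi_Suc)
qed

text \<open>The two limits on the central ray give superdecay of both components, so any candidate
  is a multiple of the frame; the second limit fixes the factor.\<close>

lemma subdominant_unique:
  assumes "is_PI_subdominant y z k \<Phi>"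
  shows "\<Phi> = (\<lambda>l. vector [U k l, W k l])"
proof -
  have sol: "solution (\<lambda>l. \<Phi> l $ 1) (\<lambda>l. \<Phi> l $ 2)"
    using assms unfolding is_PI_subdominant_def lax_matrix_solution by blast
  have "((\<lambda>l. exp (4 / 5 * branch_sqrt k l ^ 5 - z * branch_sqrt k l) *s
                    ((vector [vector [branch_power k (- 1 / 4) l, 0],
                              vector [0, branch_power k (1 / 4) l]] :: complex ^ 2 ^ 2) *v \<Phi> l))
              \<longlongrightarrow> vector [(-1) powi (k + 1), 1]) (sector_at_infinity k (pi / 10))"
    using assms unfolding is_PI_subdominant_def by simp
  then have "((\<lambda>l. phase k l * (branch_power k (-1/4) l * \<Phi> l $ 1)) \<longlongrightarrow> (-1) powi (k + 1)) (sector_at_infinity k (pi / 10))"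
    "((\<lambda>l. phase k l * (branch_power k (1/4) l * \<Phi> l $ 2)) \<longlongrightarrow> 1) (sector_at_infinity k (pi / 10))"
    unfolding tendsto_vec2 matrix_vector_2 by (simp_all add: phase_def)
  note lims = this[THEN filterlim_compose, OF filterlim_ray_sector[of "central k"]]
  have 1: "((\<lambda>r. phase k (ray (central k) r) * branch_power k (-1/4) (ray (central k) r) * \<Phi> (ray (central k) r) $ 1) \<longlongrightarrow> (-1) powi (k + 1)) at_top"
    and 2: "((\<lambda>r. phase k (ray (central k) r) * branch_power k (1/4) (ray (central k) r) * \<Phi> (ray (central k) r) $ 2) \<longlongrightarrow> 1) at_top"
    using lims pi_gt_zero by (simp_all add: mult.assoc)
  have d: "superdecay k (\<lambda>l. \<Phi> l $ 1)" "superdecay k (\<lambda>l. \<Phi> l $ 2)"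
    using superdecay_of_limits[OF 1] superdecay_of_limits[OF 2] by simp_all
  have "\<exists>s. \<forall>l. \<Phi> l $ 1 = s * U k l \<and> \<Phi> l $ 2 = s * W k l"
    by (rule superdecay_multiple[OF sol d]) blast
  then obtain s where s: "\<And>l. \<Phi> l $ 1 = s * U k l" "\<And>l. \<Phi> l $ 2 = s * W k l" by blast
  have "((\<lambda>r. phase k (ray (central k) r) * branch_power k (1/4) (ray (central k) r) * W k (ray (central k) r)) \<longlongrightarrow> 1) at_top"
    using asymptotic_ray(1)[OF frame_asymptotic0 central_in[of 0 "pi / 10"]] pi_gt_zero by (simp add: nu_eq)
  from tendsto_mult_left[OF this, of s]
  have "((\<lambda>r. phase k (ray (central k) r) * branch_power k (1/4) (ray (central k) r) * \<Phi> (ray (central k) r) $ 2) \<longlongrightarrow> s * 1) at_top"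
    by (simp add: s mult.left_commute)
  then have "s * 1 = 1" using 2 by (rule tendsto_unique[OF trivial_limit_at_top_linorder])
  then show ?thesis using s by (auto simp: vec_eq_iff forall_2)
qed

lemma PI_subdominant_eq: "PI_subdominant y z k = (\<lambda>l. vector [U k l, W k l])"
  unfolding PI_subdominant_def using frame_is_subdominant subdominant_unique by (rule the_equality)

lemma PI_stokes_eq: "PI_stokes y z k = stokes k"
  unfolding PI_stokes_def PI_subdominant_eq
proof (rule the_equality)
  show "\<forall>l. vector [U (k - 1) l, W (k - 1) l] = vector [U (k + 1) l, W (k + 1) l] + stokes k *s (vector [U k l, W k l] :: complex ^ 2)"
    using stokes_relation[of k] by (simp add: vec_eq_iff forall_2)
  fix \<sigma> assume "\<forall>l. vector [U (k - 1) l, W (k - 1) l] = vector [U (k + 1) l, W (k + 1) l] + \<sigma> *s (vector [U k l, W k l] :: complex ^ 2)"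
  then show "\<sigma> = stokes k"
    by (intro stokes_unique) (simp_all add: vec_eq_iff forall_2)
qed

lemma PI_stokes_periodic: "PI_stokes y z (k + 5) = PI_stokes y z k"
  by (simp add: PI_stokes_eq stokes_shift)

end

section \<open>The cubic oscillator as a first-order system\<close>

locale cubic_oscillator =
  fixes a b :: complex
begin

sublocale lax_system a "- 28 * b" 0 0 0 "cubic_entry a b"
proof
  show "cubic_entry a b holomorphic_on UNIV"
    unfolding cubic_entry_def[abs_def] by (intro holomorphic_intros)
  show "0\<^sup>2 + 2 * (l - 0) ^ 0 * cubic_entry a b l = 4 * l^3 - 2 * a * l + - 28 * b" for l :: complex
    by (simp add: cubic_entry_def algebra_simps)
qed simp

lemma nu_eq: "\<nu> = 3/4"
  by (simp add: \<nu>_def)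

lemma solution_iff:
  "solution u w \<longleftrightarrow> (\<forall>l. (u has_field_derivative cubic_entry a b l * w l) (at l) \<and> (w has_field_derivative 2 * u l) (at l))"
  by (simp add: solution_def f_def)

text \<open>The frame tends to 1 where \<Psi>_k is required to tend to
  \<open>(-1) powi (k + 1)\<close>.\<close>

definition signed :: "int \<Rightarrow> complex \<Rightarrow> complex" where "signed k l = (-1) powi (k + 1) * W k l"

lemma signed_is_subdominant: "is_cubic_subdominant a b k (signed k)"
  unfolding is_cubic_subdominant_def
proof (intro conjI allI impI)
  have dU: "(U k has_field_derivative cubic_entry a b l * W k l) (at l)"
    and dW: "(W k has_field_derivative 2 * U k l) (at l)" for l
    using frame_solution[of k] by (auto simp: solution_iff)
  have ds: "(signed k has_field_derivative (-1) powi (k + 1) * (2 * U k l)) (at l)" for l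
    unfolding signed_def[abs_def] by (rule DERIV_cmult[OF dW])
  then show "signed k holomorphic_on UNIV" using holomorphic_on_open[of UNIV] by blast
  have d1: "deriv (signed k) = (\<lambda>l. (-1) powi (k + 1) * (2 * U k l))" using DERIV_imp_deriv[OF ds] by blast
  have d2: "deriv (\<lambda>l. (-1) powi (k + 1) * (2 * U k l)) l = (-1) powi (k + 1) * (2 * (cubic_entry a b l * W k l))" for l
    by (rule DERIV_imp_deriv[OF DERIV_cmult[OF DERIV_cmult[OF dU]]])
  show "(deriv ^^ 2) (signed k) l = (4 * l ^ 3 - 2 * a * l - 28 * b) * signed k l" for l
  proof -
    have "(deriv ^^ 2) (signed k) l = deriv (deriv (signed k)) l" by (simp add: eval_nat_numeral)
    also have "\<dots> = (-1) powi (k + 1) * (2 * (cubic_entry a b l * W k l))" by (simp only: d1 d2)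
    also have "\<dots> = (4 * l ^ 3 - 2 * a * l - 28 * b) * signed k l"
      by (simp add: signed_def cubic_entry_def algebra_simps)
    finally show ?thesis .
  qed
  fix \<epsilon> :: real assume "0 < \<epsilon>"
  then have "((\<lambda>l. phase k l * branch_power k (3/4) l * W k l) \<longlongrightarrow> 1) (sector_at_infinity k \<epsilon>)"
    using frame_asymptotic[of \<epsilon> k] by (simp add: asymptotic_def nu_eq)
  from tendsto_mult_left[OF this, of "(-1) powi (k + 1)"]
  show "((\<lambda>l. branch_power k (3 / 4) l * exp (4 / 5 * branch_sqrt k l ^ 5 - a * branch_sqrt k l) * signed k l)
              \<longlongrightarrow> (-1) powi (k + 1)) (sector_at_infinity k \<epsilon>)"
    by (simp add: phase_def signed_def mult_ac)
qed

text \<open>The asymptotic condition controls \<Psi> but not its derivative, so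
  \<open>superdecay_multiple\<close> cannot be applied at once. Instead, a component along index
  \<open>k + 1\<close> would force \<open>W (k + 1)\<close> to decay on the central ray of
  \<open>k\<close>, where its own asymptotics make it grow.\<close>

lemma signed_unique:
  assumes "is_cubic_subdominant a b k \<Psi>"
  shows "\<Psi> = signed k"
proof -
  have hol: "\<Psi> holomorphic_on UNIV" and ode: "\<And>l. (deriv ^^ 2) \<Psi> l = (4 * l ^ 3 - 2 * a * l - 28 * b) * \<Psi> l"
    using assms by (auto simp: is_cubic_subdominant_def)
  have sol: "solution (\<lambda>l. deriv \<Psi> l / 2) \<Psi>"
    unfolding solution_iff
  proof (intro allI conjI)
    fix l
    show "(\<Psi> has_field_derivative 2 * (deriv \<Psi> l / 2)) (at l)"
      using holomorphic_derivI[OF hol open_UNIV] by simp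
    have "(deriv \<Psi> has_field_derivative deriv (deriv \<Psi>) l) (at l)"
      using holomorphic_deriv[OF hol open_UNIV] by (intro holomorphic_derivI) auto
    then have "(deriv \<Psi> has_field_derivative (4 * l ^ 3 - 2 * a * l - 28 * b) * \<Psi> l) (at l)"
      using ode[of l] by (simp add: eval_nat_numeral)
    from DERIV_cdivide[OF this, of 2]
    show "((\<lambda>l. deriv \<Psi> l / 2) has_field_derivative cubic_entry a b l * \<Psi> l) (at l)"
      by (rule DERIV_cong) (simp add: cubic_entry_def field_simps)
  qed
  have "\<exists>s t. \<forall>l. \<Psi> l = s * W k l + t * W (k + 1) l"
    by (rule solution_in_frame[OF sol, of k]) blast
  then obtain s t where st: "\<And>l. \<Psi> l = s * W k l + t * W (k + 1) l" by blast
  let ?r = "ray (central k)"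
  have L: "((\<lambda>r. phase k (?r r) * branch_power k (3/4) (?r r) * \<Psi> (?r r)) \<longlongrightarrow> (-1) powi (k + 1)) at_top"
  proof -
    have "((\<lambda>l. branch_power k (3 / 4) l * exp (4 / 5 * branch_sqrt k l ^ 5 - a * branch_sqrt k l) * \<Psi> l)
              \<longlongrightarrow> (-1) powi (k + 1)) (sector_at_infinity k (pi / 10))"
      using assms by (simp add: is_cubic_subdominant_def)
    from filterlim_compose[OF this filterlim_ray_sector[of "central k"]]
    show ?thesis by (simp add: phase_def mult_ac)
  qed
  have LW: "((\<lambda>r. phase k (?r r) * branch_power k (3/4) (?r r) * W k (?r r)) \<longlongrightarrow> 1) at_top"
    using asymptotic_ray(1)[OF frame_asymptotic0 central_in[of 0 "pi / 10"]] pi_gt_zero by (simp add: nu_eq)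
  have t0: "t = 0"
  proof (rule ccontr)
    assume t: "t \<noteq> 0"
    have d: "superdecay k (\<lambda>l. 1/t * \<Psi> l - s/t * W k l)"
    proof (rule superdecay_bound)
      show "superdecay k (\<lambda>l. \<Psi> l)" "superdecay k (W k)"
        using superdecay_of_limits[OF L] frame_superdecay by auto
      define B where "B = norm (1/t) + norm (s/t)"
      have "\<forall>\<^sub>F r in at_top. B \<le> exp (1 * r^2)" by real_asymp
      then show "\<forall>\<^sub>F r in at_top. norm (1/t * \<Psi> (?r r) - s/t * W k (?r r)) \<le> exp (1 * r^2) * (norm (\<Psi> (?r r)) + norm (W k (?r r)))"
      proof eventually_elim
        case (elim r)
        have "norm (1/t * \<Psi> (?r r) - s/t * W k (?r r)) \<le> norm (1/t) * norm (\<Psi> (?r r)) + norm (s/t) * norm (W k (?r r))"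
          using norm_triangle_ineq4[of "1/t * \<Psi> (?r r)" "s/t * W k (?r r)"] by (simp only: norm_mult)
        also have "\<dots> \<le> B * norm (\<Psi> (?r r)) + B * norm (W k (?r r))"
          by (intro add_mono mult_right_mono) (auto simp: B_def)
        also have "\<dots> = B * (norm (\<Psi> (?r r)) + norm (W k (?r r)))" by (simp add: ring_distribs)
        also have "\<dots> \<le> exp (1 * r^2) * (norm (\<Psi> (?r r)) + norm (W k (?r r)))" using elim by (intro mult_right_mono) auto
        finally show ?case .
      qed
    qed
    have "(\<lambda>l. 1/t * \<Psi> l - s/t * W k l) = W (k + 1)" using t by (auto simp: st field_simps)
    with d have dW: "superdecay k (W (k + 1))" by simp
    have c1: "central (k + 1) = central k + 2 * pi / 5" by (simp add: central_def ring_distribs add_divide_distrib)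
    have "((\<lambda>r. phase (k + 1) (?r r) * branch_power (k + 1) (3/4) (?r r) * W (k + 1) (?r r)) \<longlongrightarrow> 1) at_top"
    proof -
      have "((\<lambda>l. phase (k + 1) l * branch_power (k + 1) (3/4) l * W (k + 1) l) \<longlongrightarrow> 1) (sector_at_infinity (k + 1) (pi / 10))"
        using frame_asymptotic[of "pi / 10" "k + 1"] by (simp add: asymptotic_def nu_eq)
      then show ?thesis by (rule filterlim_compose[OF _ filterlim_ray_sector]) (simp add: c1)
    qed
    \<comment> \<open>On this ray the main term of the exponent of index \<open>k + 1\<close> is
      negative, so the phase is at most \<open>exp (norm a * r^2)\<close>, and superdecay of
      \<open>W (k + 1)\<close> gives the limit 0.\<close>
    moreover have "((\<lambda>r. phase (k + 1) (?r r) * branch_power (k + 1) (3/4) (?r r) * W (k + 1) (?r r)) \<longlongrightarrow> 0) at_top"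
    proof -
      have z: "((\<lambda>r. norm (W (k + 1) (?r r)) * exp ((norm a + 1) * r^2)) \<longlongrightarrow> 0) at_top"
        using dW unfolding superdecay_def by blast
      have ev: "\<forall>\<^sub>F r::real in at_top. r powr (3/4) \<le> exp (1 * r^2)" by real_asymp
      show ?thesis
      proof (rule Lim_null_comparison[OF _ z], use eventually_ge_at_top[of 1] ev in eventually_elim)
        case (elim r)
        have s: "branch_sqrt (k + 1) (?r r) = - branch_sqrt k (?r r)"
          using elim by (simp add: branch_sqrt_ray c1 neg_one_powi_Suc)
        have sr: "sqrt r \<le> r^2"
        proof -
          have "sqrt r \<le> r" using elim by (intro real_le_lsqrt) (auto simp: power2_eq_square)
          also have "r \<le> r^2" using elim by (simp add: power2_eq_square)
          finally show ?thesis .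
        qed
        have "Re (a * branch_sqrt k (?r r)) \<le> norm a * sqrt r"
          using complex_Re_le_cmod[of "a * branch_sqrt k (?r r)"] elim by (simp add: norm_mult norm_branch_sqrt norm_ray)
        also have "\<dots> \<le> norm a * r^2" using sr by (intro mult_left_mono) auto
        finally have "norm (phase (k + 1) (?r r)) \<le> exp (norm a * r^2)"
          using elim powr_ge_zero[of r "5/2"] by (simp add: phase_def s norm_exp branch_sqrt_ray_power5 del: powr_ge_zero)
        then have "norm (phase (k + 1) (?r r)) * r powr (3/4) \<le> exp (norm a * r^2) * exp (1 * r^2)"
          using elim by (intro mult_mono) auto
        also have "\<dots> = exp ((norm a + 1) * r^2)" by (simp add: exp_add[symmetric] ring_distribs)
        finally have "norm (phase (k + 1) (?r r)) * r powr (3/4) * norm (W (k + 1) (?r r)) \<le> exp ((norm a + 1) * r^2) * norm (W (k + 1) (?r r))"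
          by (intro mult_right_mono) auto
        then show ?case using elim by (simp add: norm_mult norm_branch_power norm_ray mult_ac)
      qed
    qed
    ultimately show False using tendsto_unique[OF trivial_limit_at_top_linorder] by fastforce
  qed
  have "((\<lambda>r. phase k (?r r) * branch_power k (3/4) (?r r) * \<Psi> (?r r)) \<longlongrightarrow> s * 1) at_top"
    using tendsto_mult_left[OF LW, of s] by (simp add: st t0 mult.left_commute)
  then have "s * 1 = (-1) powi (k + 1)" using L by (rule tendsto_unique[OF trivial_limit_at_top_linorder])
  then show ?thesis using st t0 by (auto simp: signed_def)
qed

lemma cubic_subdominant_eq: "cubic_subdominant a b k = signed k"
  unfolding cubic_subdominant_def using signed_is_subdominant signed_unique by (rule the_equality)

lemma W_not_zero: "\<exists>l. W k l \<noteq> 0"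
proof (rule ccontr)
  assume "\<not> (\<exists>l. W k l \<noteq> 0)"
  then have W0: "W k = (\<lambda>l. 0)" by auto
  have "(W k has_field_derivative 2 * U k 0) (at 0)" using frame_solution[of k] by (simp add: solution_iff)
  then have "U k 0 = 0" using DERIV_unique[OF DERIV_const[of 0]] unfolding W0 by fastforce
  then show False using frame_det_nonzero[of k 0] by (simp add: W0)
qed

text \<open>The normalising signs agree for \<open>k - 1\<close> and \<open>k + 1\<close> and are
  opposite for \<open>k\<close>.\<close>

lemma cubic_stokes_eq: "cubic_stokes a b k = - stokes k"
  unfolding cubic_stokes_def cubic_subdominant_eq
proof (rule the_equality)
  have sg: "signed (k - 1) l = (-1) powi k * W (k - 1) l" "signed (k + 1) l = (-1) powi k * W (k + 1) l"
    "signed k l = (-1) powi k * (- W k l)" for l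
    by (simp_all add: signed_def power_int_add)
  have "signed (k - 1) l = signed (k + 1) l + - stokes k * signed k l" for l
    unfolding sg stokes_relation(2)[of k l] by (simp add: algebra_simps)
  then show "\<forall>l. signed (k - 1) l = signed (k + 1) l + - stokes k * signed k l" by blast
  fix \<sigma> assume h: "\<forall>l. signed (k - 1) l = signed (k + 1) l + \<sigma> * signed k l"
  obtain l where l: "W k l \<noteq> 0" using W_not_zero by blast
  have "(-1) powi k * W (k - 1) l = (-1) powi k * (W (k + 1) l - \<sigma> * W k l)"
    using h[rule_format, of l] unfolding sg by (simp add: algebra_simps)
  then have "W (k - 1) l = W (k + 1) l - \<sigma> * W k l" by (subst (asm) mult_cancel_left) simp
  then have "(stokes k + \<sigma>) * W k l = 0" using stokes_relation(2)[of k l] by (simp add: algebra_simps)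
  then have "stokes k + \<sigma> = 0" using l by simp
  then show "\<sigma> = - stokes k" by (simp add: eq_neg_iff_add_eq_0 add.commute)
qed

lemma cubic_stokes_periodic: "cubic_stokes a b (k + 5) = cubic_stokes a b k"
  by (simp add: cubic_stokes_eq stokes_shift)

end

section \<open>Reduction of the index modulo 5\<close>

lemma mod_5_cases:
  fixes j :: 5
  obtains k :: int where "of_int k = j"
  by (cases j rule: bit1_cases) auto

lemma cubic_monodromy_eq: "cubic_monodromy a b (of_int k) = cubic_stokes a b k"
  unfolding cubic_monodromy_def
proof (rule the_equality)
  show "\<forall>k'. of_int k' = (of_int k :: 5) \<longrightarrow> cubic_stokes a b k' = cubic_stokes a b k"
    using periodic_of_int_5[of "cubic_stokes a b"] cubic_oscillator.cubic_stokes_periodic by blast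
qed blast

section \<open>Isomonodromic deformation\<close>

text \<open>On the way to a pole the transformed systems have a diagonal that depends on
  \<open>l\<close>, so they leave the class \<open>lax_system\<close>; only the end points of the
  transport belong to it, up to a gauge.\<close>

definition lax_ode :: "(complex \<Rightarrow> complex) \<Rightarrow> (complex \<Rightarrow> complex) \<Rightarrow> (complex \<Rightarrow> complex) \<Rightarrow>
    (complex \<Rightarrow> complex) \<Rightarrow> (complex \<Rightarrow> complex) \<Rightarrow> bool" where
  "lax_ode a11 a12 a21 u w \<longleftrightarrow> (\<forall>l. (u has_field_derivative a11 l * u l + a12 l * w l) (at l) \<and>
     (w has_field_derivative a21 l * u l - a11 l * w l) (at l))"

text \<open>
  Zero curvature makes the flow in the deformation parameter \<open>z\<close> carry solutions in \<open>l\<close> to solutions in \<open>l\<close>.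
  Differentiability in \<open>l\<close> of the transported solution, with the right derivative, is a Gronwall estimate
  for its first order Taylor remainder.
\<close>

lemma isomonodromic_transport:
  fixes A11 A12 A21 A11' A12' A21' :: "complex \<Rightarrow> complex \<Rightarrow> complex" and p q s :: "complex \<Rightarrow> complex" and q1 q2 :: complex
  assumes S: "open S" "convex S" "z0 \<in> S" "z1 \<in> S"
    and hol: "p holomorphic_on S" "q holomorphic_on S" "s holomorphic_on S"
    and dA: "\<And>l z. z \<in> S \<Longrightarrow> (A11 l has_field_derivative A11' l z) (at z)"
      "\<And>l z. z \<in> S \<Longrightarrow> (A12 l has_field_derivative A12' l z) (at z)"
      "\<And>l z. z \<in> S \<Longrightarrow> (A21 l has_field_derivative A21' l z) (at z)"
    and curv: "\<And>l z. z \<in> S \<Longrightarrow> A11' l z = p z - (A12 l z * s z - (q z + q1 * l + q2 * l^2) * A21 l z)"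
      "\<And>l z. z \<in> S \<Longrightarrow> A12' l z = q1 + 2 * q2 * l - (2 * A11 l z * (q z + q1 * l + q2 * l^2) - 2 * A12 l z * (p z * l))"
      "\<And>l z. z \<in> S \<Longrightarrow> A21' l z = - (2 * A21 l z * (p z * l) - 2 * A11 l z * s z)"
  shows "\<exists>t11 t12 t21 t22 :: complex \<Rightarrow> complex. \<exists>C.
    (\<forall>u w. lax_ode (\<lambda>l. A11 l z0) (\<lambda>l. A12 l z0) (\<lambda>l. A21 l z0) u w \<longrightarrow>
       lax_ode (\<lambda>l. A11 l z1) (\<lambda>l. A12 l z1) (\<lambda>l. A21 l z1)
         (\<lambda>l. t11 l * u l + t12 l * w l) (\<lambda>l. t21 l * u l + t22 l * w l)) \<and>
    (\<forall>l. t11 l * t22 l - t12 l * t21 l = 1) \<and>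
    (\<forall>l. norm (t11 l) \<le> exp (C * (1 + norm l^2)) \<and> norm (t12 l) \<le> exp (C * (1 + norm l^2)) \<and>
         norm (t21 l) \<le> exp (C * (1 + norm l^2)) \<and> norm (t22 l) \<le> exp (C * (1 + norm l^2)))"
proof -
  \<comment> \<open>The deformation equation is \<open>X' = [[p l, B], [s, - p l]] X\<close> with
    \<open>B\<close> quadratic in \<open>l\<close>. This form covers both the Lax pair and its gauge
    transform near a pole, and its growth in \<open>l\<close> is what limits the flow to exp (C
    |l|^2).\<close>
  define B where "B l z = q z + q1 * l + q2 * l^2" for l z
  have Bhol: "(\<lambda>z. B l z) holomorphic_on S" "(\<lambda>z. p z * l) holomorphic_on S" "(\<lambda>z. - (p z * l)) holomorphic_on S" for l
    unfolding B_def by (intro holomorphic_intros hol)+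
  have "\<exists>f1 f2. (\<forall>z\<in>S. (f1 has_field_derivative (p z * l) * f1 z + B l z * f2 z) (at z) \<and>
      (f2 has_field_derivative s z * f1 z + (- (p z * l)) * f2 z) (at z)) \<and> f1 z0 = \<alpha> \<and> f2 z0 = \<beta>" for l \<alpha> \<beta>
    by (rule linear_ode_exists[OF S(1-3) Bhol(2)[of l] Bhol(1)[of l] hol(3) Bhol(3)[of l], of \<alpha> \<beta>]) blast
  then obtain Q1 Q2 where Q: "\<And>l \<alpha> \<beta> z. z \<in> S \<Longrightarrow> (Q1 l \<alpha> \<beta> has_field_derivative (p z * l) * Q1 l \<alpha> \<beta> z + B l z * Q2 l \<alpha> \<beta> z) (at z)"
      "\<And>l \<alpha> \<beta> z. z \<in> S \<Longrightarrow> (Q2 l \<alpha> \<beta> has_field_derivative s z * Q1 l \<alpha> \<beta> z + (- (p z * l)) * Q2 l \<alpha> \<beta> z) (at z)"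
      "\<And>l \<alpha> \<beta>. Q1 l \<alpha> \<beta> z0 = \<alpha>" "\<And>l \<alpha> \<beta>. Q2 l \<alpha> \<beta> z0 = \<beta>"
    by metis
  define F1 F2 G1 G2 where "F1 l = Q1 l 1 0" and "F2 l = Q2 l 1 0" and "G1 l = Q1 l 0 1" and "G2 l = Q2 l 0 1" for l :: complex
  have dF: "(F1 l has_field_derivative (p z * l) * F1 l z + B l z * F2 l z) (at z)"
      "(F2 l has_field_derivative s z * F1 l z + (- (p z * l)) * F2 l z) (at z)"
    and dG: "(G1 l has_field_derivative (p z * l) * G1 l z + B l z * G2 l z) (at z)"
      "(G2 l has_field_derivative s z * G1 l z + (- (p z * l)) * G2 l z) (at z)" if "z \<in> S" for l z
    using Q(1,2)[OF that] by (simp_all only: F1_def F2_def G1_def G2_def)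
  have init: "F1 l z0 = 1" "F2 l z0 = 0" "G1 l z0 = 0" "G2 l z0 = 1" for l
    using Q(3,4) by (simp_all add: F1_def F2_def G1_def G2_def)
  define seg where "seg = closed_segment z0 z1"
  have seg: "seg \<subseteq> S" "compact seg" using S closed_segment_subset by (auto simp: seg_def)
  have bdd: "\<exists>K\<ge>0. \<forall>z\<in>seg. norm (g z) \<le> K" if "continuous_on seg g" for g :: "complex \<Rightarrow> complex"
  proof -
    have "bounded (g ` seg)" using that seg(2) by (intro compact_imp_bounded compact_continuous_image)
    then obtain K where "\<And>z. z \<in> seg \<Longrightarrow> norm (g z) \<le> K" by (auto simp: bounded_iff)
    then show ?thesis by (intro exI[of _ "\<bar>K\<bar>"]) force
  qed
  have cont: "continuous_on seg p" "continuous_on seg q" "continuous_on seg s"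
    using hol seg(1) by (meson continuous_on_subset holomorphic_on_imp_continuous_on)+
  obtain P where P: "P \<ge> 0" "\<And>z. z \<in> seg \<Longrightarrow> norm (p z) \<le> P" using bdd[OF cont(1)] by blast
  obtain Qb where Qb: "Qb \<ge> 0" "\<And>z. z \<in> seg \<Longrightarrow> norm (q z) \<le> Qb" using bdd[OF cont(2)] by blast
  obtain Sb where Sb: "Sb \<ge> 0" "\<And>z. z \<in> seg \<Longrightarrow> norm (s z) \<le> Sb" using bdd[OF cont(3)] by blast
  define k0 where "k0 = P + Qb + Sb + norm q1 + norm q2"
  define K where "K x = k0 * (1 + x + x^2)" for x :: real
  have k0: "k0 \<ge> 0" using P Qb Sb by (simp add: k0_def)
  have Kb: "norm (p z * l) \<le> K x" "norm (B l z) \<le> K x" "norm (s z) \<le> K x" "norm (- (p z * l)) \<le> K x"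
    if z: "z \<in> seg" and x: "norm l \<le> x" for z l x
  proof -
    have x0: "0 \<le> x" using x norm_ge_zero order_trans by blast
    have le: "\<And>c. 0 \<le> c \<Longrightarrow> c \<le> k0 \<Longrightarrow> c * x \<le> k0 * x" "\<And>c. 0 \<le> c \<Longrightarrow> c \<le> k0 \<Longrightarrow> c * x^2 \<le> k0 * x^2"
      using x0 by (auto intro: mult_right_mono)
    have k: "P \<le> k0" "Qb \<le> k0" "Sb \<le> k0" "norm q1 \<le> k0" "norm q2 \<le> k0"
      using P Qb Sb by (auto simp: k0_def)
    have pl: "norm (p z * l) \<le> P * x" unfolding norm_mult using P z x by (intro mult_mono) auto
    have K_ge: "k0 \<le> K x" "k0 * x \<le> K x" using k0 x0 by (auto simp: K_def ring_distribs)
    have "P * x \<le> k0 * x" using k x0 by (intro mult_right_mono)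
    then show "norm (p z * l) \<le> K x" "norm (- (p z * l)) \<le> K x" using pl K_ge by auto
    show "norm (s z) \<le> K x" using Sb(2)[OF z] k K_ge by linarith
    have "norm (B l z) \<le> norm (q z) + norm (q1 * l) + norm (q2 * l^2)"
      unfolding B_def by (meson add_mono norm_triangle_ineq order_trans order_refl)
    also have "\<dots> \<le> Qb + norm q1 * x + norm q2 * x^2"
      unfolding norm_mult norm_power using Qb(2)[OF z] x by (intro add_mono mult_left_mono power_mono) auto
    also have "\<dots> \<le> k0 + k0 * x + k0 * x^2"
      using k x0 by (intro add_mono mult_right_mono) auto
    finally show "norm (B l z) \<le> K x" by (simp add: K_def ring_distribs)
  qed
  define L where "L = norm (z1 - z0)"
  have L: "L \<ge> 0" by (simp add: L_def)
  have K0: "K x \<ge> 0" if "0 \<le> x" for x using that k0 by (simp add: K_def)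
  have gron: "norm (f1 z1)^2 + norm (f2 z1)^2 \<le> exp (L * (4 * K (norm l) + 1)) * (norm (f1 z0)^2 + norm (f2 z0)^2)"
    if f1: "\<And>z. z \<in> S \<Longrightarrow> (f1 has_field_derivative (p z * l) * f1 z + B l z * f2 z) (at z)"
      and f2: "\<And>z. z \<in> S \<Longrightarrow> (f2 has_field_derivative s z * f1 z + (- (p z * l)) * f2 z) (at z)" for f1 f2 l
  proof -
    have "norm (f1 z1)^2 + norm (f2 z1)^2 \<le> exp (norm (z1 - z0) * (4 * K (norm l) + 1)) * (norm (f1 z0)^2 + norm (f2 z0)^2 + 2 * norm (z1 - z0) * 0^2)"
    proof (rule linear_ode_gronwall[where ?m11.0 = "\<lambda>z. p z * l" and ?m12.0 = "B l" and ?m21.0 = s and ?m22.0 = "\<lambda>z. - (p z * l)"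
          and ?h1.0 = "\<lambda>_. 0" and ?h2.0 = "\<lambda>_. 0"])
      fix z assume "z \<in> closed_segment z0 z1"
      then have z: "z \<in> seg" "z \<in> S" using seg(1) by (auto simp: seg_def)
      show "(f1 has_field_derivative (p z * l) * f1 z + B l z * f2 z + 0) (at z)"
        "(f2 has_field_derivative s z * f1 z + (- (p z * l)) * f2 z + 0) (at z)"
        using f1[OF z(2)] f2[OF z(2)] by simp_all
      show "norm (p z * l) \<le> K (norm l)" "norm (B l z) \<le> K (norm l)" "norm (s z) \<le> K (norm l)" "norm (- (p z * l)) \<le> K (norm l)"
        using Kb[OF z(1) order_refl] by blast+
    qed simp_all
    then show ?thesis by (simp add: L_def)
  qed
  have grow: "norm (F1 l z1)^2 + norm (F2 l z1)^2 \<le> exp (L * (4 * K (norm l) + 1))"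
    "norm (G1 l z1)^2 + norm (G2 l z1)^2 \<le> exp (L * (4 * K (norm l) + 1))" for l
    using gron[OF dF] gron[OF dG] by (simp_all add: init)
  \<comment> \<open>By \<open>2 * norm l \<le> 1 + norm l^2\<close>, the Gronwall rate
    \<open>4 * K (norm l) + 1\<close> is at most
    \<open>(8 * k0 + 1) * (1 + norm l^2)\<close>.\<close>
  define C where "C = L * (8 * k0 + 1)"
  have small: "norm x \<le> exp (C * (1 + norm l^2))" if "norm x^2 + e \<le> exp (L * (4 * K (norm l) + 1))" "0 \<le> e" for x l :: complex and e
  proof -
    have "0 \<le> (norm l - 1)^2" by simp
    then have "2 * norm l \<le> 1 + norm l^2" by (simp add: power2_eq_square algebra_simps)
    have arith: "1 + x + N \<le> 2 * (1 + N)" if "2 * x \<le> 1 + N" "0 \<le> N" for x N :: real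
      using that by simp
    have "1 + norm l + norm l^2 \<le> 2 * (1 + norm l^2)"
      by (rule arith[OF \<open>2 * norm l \<le> 1 + norm l^2\<close> zero_le_power2])
    then have "K (norm l) \<le> k0 * (2 * (1 + norm l^2))" unfolding K_def using k0 by (rule mult_left_mono)
    moreover have "4 * x + 1 \<le> (8 * k0 + 1) * (1 + N)" if "x \<le> k0 * (2 * (1 + N))" "0 \<le> N" for x N :: real
      using that by (simp add: algebra_simps)
    ultimately have "4 * K (norm l) + 1 \<le> (8 * k0 + 1) * (1 + norm l^2)" using zero_le_power2 by blast
    then have "L * (4 * K (norm l) + 1) \<le> C * (1 + norm l^2)" using L by (simp add: C_def mult_left_mono mult.assoc)
    then have "norm x^2 \<le> exp (C * (1 + norm l^2))" using that by (smt (verit) exp_le_cancel_iff)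
    moreover have "exp (C * (1 + norm l^2)) \<le> exp (C * (1 + norm l^2))^2"
    proof -
      have "1 \<le> exp (C * (1 + norm l^2))" using L k0 by (simp add: C_def)
      then show ?thesis by (simp add: power2_eq_square)
    qed
    ultimately have "norm x^2 \<le> exp (C * (1 + norm l^2))^2" by linarith
    then show ?thesis by (rule power2_le_imp_le) simp
  qed
  have det: "F1 l z1 * G2 l z1 - G1 l z1 * F2 l z1 = 1" for l
  proof -
    have "((\<lambda>z. F1 l z * G2 l z - G1 l z * F2 l z) has_field_derivative 0) (at z)" if z: "z \<in> S" for z
    proof -
      note DERIV_diff[OF DERIV_mult[OF dF(1)[OF z, of l] dG(2)[OF z, of l]] DERIV_mult[OF dG(1)[OF z, of l] dF(2)[OF z, of l]]]
      then show ?thesis by (simp add: algebra_simps)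
    qed
    then have "(\<lambda>z. F1 l z * G2 l z - G1 l z * F2 l z) constant_on S"
      using S convex_connected by (intro has_field_derivative_0_imp_constant_on) auto
    then have "F1 l z1 * G2 l z1 - G1 l z1 * F2 l z1 = F1 l z0 * G2 l z0 - G1 l z0 * F2 l z0"
      using S(3,4) unfolding constant_on_def by metis
    then show ?thesis by (simp add: init)
  qed
  have main: "((\<lambda>l. F1 l z1 * u l + G1 l z1 * w l) has_field_derivative
               A11 l0 z1 * (F1 l0 z1 * u l0 + G1 l0 z1 * w l0) + A12 l0 z1 * (F2 l0 z1 * u l0 + G2 l0 z1 * w l0)) (at l0) \<and>
            ((\<lambda>l. F2 l z1 * u l + G2 l z1 * w l) has_field_derivative
               A21 l0 z1 * (F1 l0 z1 * u l0 + G1 l0 z1 * w l0) - A11 l0 z1 * (F2 l0 z1 * u l0 + G2 l0 z1 * w l0)) (at l0)"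
    if uw: "\<And>l. (u has_field_derivative A11 l z0 * u l + A12 l z0 * w l) (at l)"
      "\<And>l. (w has_field_derivative A21 l z0 * u l - A11 l z0 * w l) (at l)" for u w l0
  proof -
    define X1 where "X1 l z = F1 l z * u l + G1 l z * w l" for l z
    define X2 where "X2 l z = F2 l z * u l + G2 l z * w l" for l z
    have dX1: "(X1 l has_field_derivative (p z * l) * X1 l z + B l z * X2 l z) (at z)"
      and dX2: "(X2 l has_field_derivative s z * X1 l z + (- (p z * l)) * X2 l z) (at z)" if z: "z \<in> S" for l z
    proof -
      note DERIV_add[OF DERIV_cmult_right[OF dF(1)[OF z, of l], of "u l"] DERIV_cmult_right[OF dG(1)[OF z, of l], of "w l"]]
      then show "(X1 l has_field_derivative (p z * l) * X1 l z + B l z * X2 l z) (at z)"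
        unfolding X1_def[abs_def] X2_def by (simp add: algebra_simps)
      note DERIV_add[OF DERIV_cmult_right[OF dF(2)[OF z, of l], of "u l"] DERIV_cmult_right[OF dG(2)[OF z, of l], of "w l"]]
      then show "(X2 l has_field_derivative s z * X1 l z + (- (p z * l)) * X2 l z) (at z)"
        unfolding X2_def[abs_def] X1_def by (simp add: algebra_simps)
    qed
    \<comment> \<open>\<open>Y = A X\<close> is the candidate for the derivative of the transported
      solution in \<open>l\<close>. Zero curvature makes it satisfy the deformation equation
      formally differentiated in \<open>l\<close>, before differentiability in \<open>l\<close> is
      known.\<close>
    define Y1 where "Y1 z = A11 l0 z * X1 l0 z + A12 l0 z * X2 l0 z" for z
    define Y2 where "Y2 z = A21 l0 z * X1 l0 z - A11 l0 z * X2 l0 z" for z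
    have dY1: "(Y1 has_field_derivative p z * X1 l0 z + (q1 + 2 * q2 * l0) * X2 l0 z + (p z * l0) * Y1 z + B l0 z * Y2 z) (at z)"
      and dY2: "(Y2 has_field_derivative - (p z) * X2 l0 z + s z * Y1 z - (p z * l0) * Y2 z) (at z)" if z: "z \<in> S" for z
    proof -
      note DERIV_add[OF DERIV_mult[OF dA(1)[OF z, of l0] dX1[OF z, of l0]] DERIV_mult[OF dA(2)[OF z, of l0] dX2[OF z, of l0]]]
      then show "(Y1 has_field_derivative p z * X1 l0 z + (q1 + 2 * q2 * l0) * X2 l0 z + (p z * l0) * Y1 z + B l0 z * Y2 z) (at z)"
        unfolding Y1_def[abs_def] Y2_def curv(1)[OF z] curv(2)[OF z] B_def[symmetric]
        by (rule DERIV_cong) (simp add: algebra_simps)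
      note DERIV_diff[OF DERIV_mult[OF dA(3)[OF z, of l0] dX1[OF z, of l0]] DERIV_mult[OF dA(1)[OF z, of l0] dX2[OF z, of l0]]]
      then show "(Y2 has_field_derivative - (p z) * X2 l0 z + s z * Y1 z - (p z * l0) * Y2 z) (at z)"
        unfolding Y2_def[abs_def] Y1_def curv(1)[OF z] curv(3)[OF z] B_def[symmetric]
        by (rule DERIV_cong) (simp add: algebra_simps)
    qed
    have cX: "continuous_on seg (X1 l0)" "continuous_on seg (X2 l0)" "continuous_on seg Y1" "continuous_on seg Y2"
      using seg(1) by (auto intro!: DERIV_continuous_on has_field_derivative_at_within[OF dX1] has_field_derivative_at_within[OF dX2]
        has_field_derivative_at_within[OF dY1] has_field_derivative_at_within[OF dY2])
    obtain x2 where x2: "x2 \<ge> 0" "\<And>z. z \<in> seg \<Longrightarrow> norm (X2 l0 z) \<le> x2" using bdd[OF cX(2)] by blast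
    obtain y1 where y1: "y1 \<ge> 0" "\<And>z. z \<in> seg \<Longrightarrow> norm (Y1 z) \<le> y1" using bdd[OF cX(3)] by blast
    obtain y2 where y2: "y2 \<ge> 0" "\<And>z. z \<in> seg \<Longrightarrow> norm (Y2 z) \<le> y2" using bdd[OF cX(4)] by blast
    define q3 where "q3 = norm q1 + norm q2 * (2 * norm l0 + 1)"
    define M where "M = norm q2 * x2 + (P * y1 + q3 * y2) + P * y2"
    have M: "norm q2 * x2 + (P * y1 + q3 * y2) \<le> M" "P * y2 \<le> M"
      using P(1) x2(1) y1(1) y2(1) by (auto simp: M_def q3_def)
    define E where "E = exp (L * (4 * K (norm l0 + 1) + 1))"
    have E: "E > 0" by (simp add: E_def)
    \<comment> \<open>This remainder solves the deformation equation at \<open>l0 + h\<close> up to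
      an inhomogeneity of size |h|^2. At \<open>z0\<close> it is o(h), because \<open>u\<close> and
      \<open>w\<close> solve the system there; Gronwall carries o(h) to \<open>z1\<close>.\<close>
    define D1 where "D1 h z = X1 (l0 + h) z - X1 l0 z - h * Y1 z" for h z
    define D2 where "D2 h z = X2 (l0 + h) z - X2 l0 z - h * Y2 z" for h z
    have est: "norm (D1 h z1)^2 + norm (D2 h z1)^2 \<le> E * (norm (D1 h z0)^2 + norm (D2 h z0)^2 + 2 * L * (norm h^2 * M)^2)"
      if h: "norm h \<le> 1" for h
      unfolding E_def L_def
    proof (rule linear_ode_gronwall[where ?m11.0 = "\<lambda>z. p z * (l0 + h)" and ?m12.0 = "B (l0 + h)" and ?m21.0 = s and ?m22.0 = "\<lambda>z. - (p z * (l0 + h))"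
          and ?h1.0 = "\<lambda>z. h^2 * (q2 * X2 l0 z + (p z * Y1 z + (q1 + q2 * (2 * l0 + h)) * Y2 z))" and ?h2.0 = "\<lambda>z. h^2 * (- (p z * Y2 z))"])
      have nl: "norm (l0 + h) \<le> norm l0 + 1" using h norm_triangle_ineq[of l0 h] by linarith
      fix z assume z': "z \<in> closed_segment z0 z1"
      then have zs: "z \<in> seg" by (simp add: seg_def)
      then have z: "z \<in> S" using seg(1) by blast
      have Bd: "B (l0 + h) z = B l0 z + h * (q1 + q2 * (2 * l0 + h))" by (simp add: B_def power2_eq_square algebra_simps)
      show "(D1 h has_field_derivative p z * (l0 + h) * D1 h z + B (l0 + h) z * D2 h z
          + h^2 * (q2 * X2 l0 z + (p z * Y1 z + (q1 + q2 * (2 * l0 + h)) * Y2 z))) (at z)"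
        unfolding D1_def[abs_def] D2_def
        by (rule DERIV_cong[OF DERIV_diff[OF DERIV_diff[OF dX1[OF z, of "l0 + h"] dX1[OF z, of l0]] DERIV_cmult[OF dY1[OF z], of h]]])
          (simp only: Bd, simp add: power2_eq_square algebra_simps)
      show "(D2 h has_field_derivative s z * D1 h z + (- (p z * (l0 + h))) * D2 h z + h^2 * (- (p z * Y2 z))) (at z)"
        unfolding D2_def[abs_def] D1_def
        by (rule DERIV_cong[OF DERIV_diff[OF DERIV_diff[OF dX2[OF z, of "l0 + h"] dX2[OF z, of l0]] DERIV_cmult[OF dY2[OF z], of h]]])
          (simp add: power2_eq_square algebra_simps)
      show "norm (p z * (l0 + h)) \<le> K (norm l0 + 1)" "norm (B (l0 + h) z) \<le> K (norm l0 + 1)"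
        "norm (s z) \<le> K (norm l0 + 1)" "norm (- (p z * (l0 + h))) \<le> K (norm l0 + 1)"
        using Kb[OF zs nl] by auto
      have q3: "norm (q1 + q2 * (2 * l0 + h)) \<le> q3"
      proof -
        have "norm (q1 + q2 * (2 * l0 + h)) \<le> norm q1 + norm q2 * norm (2 * l0 + h)"
          by (metis norm_mult norm_triangle_ineq)
        also have "\<dots> \<le> norm q1 + norm q2 * (2 * norm l0 + 1)"
          using h norm_triangle_ineq[of "2 * l0" h] by (intro add_left_mono mult_left_mono) (auto simp: norm_mult)
        finally show ?thesis by (simp add: q3_def)
      qed
      have "norm (q2 * X2 l0 z + (p z * Y1 z + (q1 + q2 * (2 * l0 + h)) * Y2 z))
          \<le> norm (q2 * X2 l0 z) + (norm (p z * Y1 z) + norm ((q1 + q2 * (2 * l0 + h)) * Y2 z))"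
        by (meson add_left_mono norm_triangle_ineq order_trans)
      also have "\<dots> \<le> norm q2 * x2 + (P * y1 + q3 * y2)"
        unfolding norm_mult using x2 y1 y2 P q3 zs order_trans[OF norm_ge_zero q3]
        by (intro add_mono mult_mono) auto
      also have "\<dots> \<le> M" by (rule M)
      finally show "norm (h^2 * (q2 * X2 l0 z + (p z * Y1 z + (q1 + q2 * (2 * l0 + h)) * Y2 z))) \<le> norm h^2 * M"
        by (simp add: norm_mult norm_power mult_left_mono)
      have "norm (- (p z * Y2 z)) \<le> P * y2"
        using P y2 zs by (simp add: norm_mult mult_mono)
      also have "\<dots> \<le> M" by (rule M)
      finally show "norm (h^2 * (- (p z * Y2 z))) \<le> norm h^2 * M"
        by (simp add: norm_mult norm_power mult_left_mono)
    qed
    have X0: "X1 l z0 = u l" "X2 l z0 = w l" for l by (simp_all add: X1_def X2_def init)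
    have i1: "((\<lambda>h. D1 h z0 / h) \<longlongrightarrow> 0) (at 0)" 
    proof -
      have "((\<lambda>h. (u (l0 + h) - u l0) / h - Y1 z0) \<longlongrightarrow> 0) (at 0)"
        using uw(1)[of l0] unfolding DERIV_def by (simp add: Y1_def X0 LIM_zero)
      then show ?thesis
        by (rule Lim_transform_eventually) (auto simp: eventually_at D1_def X0 diff_divide_distrib intro!: exI[of _ 1])
    qed
    have i2: "((\<lambda>h. D2 h z0 / h) \<longlongrightarrow> 0) (at 0)" 
    proof -
      have "((\<lambda>h. (w (l0 + h) - w l0) / h - Y2 z0) \<longlongrightarrow> 0) (at 0)"
        using uw(2)[of l0] unfolding DERIV_def by (simp add: Y2_def X0 LIM_zero)
      then show ?thesis
        by (rule Lim_transform_eventually) (auto simp: eventually_at D2_def X0 diff_divide_distrib intro!: exI[of _ 1])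
    qed
    have "((\<lambda>h. E * (norm (D1 h z0 / h)^2 + norm (D2 h z0 / h)^2 + 2 * L * (norm h * M)^2)) \<longlongrightarrow> E * (norm (0::complex)^2 + norm (0::complex)^2 + 2 * L * (norm (0::complex) * M)^2)) (at 0)"
      by (intro tendsto_intros i1 i2)
    then have lim: "((\<lambda>h. E * (norm (D1 h z0 / h)^2 + norm (D2 h z0 / h)^2 + 2 * L * (norm h * M)^2)) \<longlongrightarrow> 0) (at 0)" by simp
    have ev: "\<forall>\<^sub>F h in at 0. norm (D1 h z1 / h)^2 + norm (D2 h z1 / h)^2
        \<le> E * (norm (D1 h z0 / h)^2 + norm (D2 h z0 / h)^2 + 2 * L * (norm h * M)^2)"
    proof -
      have "\<forall>\<^sub>F h in at (0::complex). h \<noteq> 0 \<and> norm h \<le> 1" by (auto simp: eventually_at intro!: exI[of _ 1])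
      then show ?thesis
      proof eventually_elim
        case (elim h)
        have "(norm (D1 h z1)^2 + norm (D2 h z1)^2) / norm h^2 \<le> (E * (norm (D1 h z0)^2 + norm (D2 h z0)^2 + 2 * L * (norm h^2 * M)^2)) / norm h^2"
          using est[of h] elim by (intro divide_right_mono) auto
        also have "\<dots> = E * (norm (D1 h z0 / h)^2 + norm (D2 h z0 / h)^2 + 2 * L * (norm h * M)^2)"
        proof -
          have "(E * (x^2 + x'^2 + 2 * L * (n^2 * M)^2)) / n^2 = E * ((x / n)^2 + (x' / n)^2 + 2 * L * (n * M)^2)"
            if "n \<noteq> 0" for x x' n :: real
            using that by (simp add: field_simps power2_eq_square)
          from this[of "norm h" "norm (D1 h z0)" "norm (D2 h z0)"] elim show ?thesis by (simp only: norm_divide) simp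
        qed
        finally show ?case by (simp add: norm_divide power_divide add_divide_distrib)
      qed
    qed
    have sq: "((\<lambda>h. D h z1 / h) \<longlongrightarrow> 0) (at 0)" if "\<And>h. norm (D h z1 / h)^2 \<le> norm (D1 h z1 / h)^2 + norm (D2 h z1 / h)^2" for D :: "complex \<Rightarrow> complex \<Rightarrow> complex"
    proof -
      have "((\<lambda>h. norm (D h z1 / h)^2) \<longlongrightarrow> 0) (at 0)"
        by (rule Lim_null_comparison[OF _ lim], use ev in eventually_elim) (use that order_trans in auto)
      then have "((\<lambda>h. sqrt (norm (D h z1 / h)^2)) \<longlongrightarrow> sqrt 0) (at 0)" by (rule tendsto_real_sqrt)
      then show ?thesis by (simp add: tendsto_norm_zero_iff del: norm_divide)
    qed
    have "((\<lambda>h. (X1 (l0 + h) z1 - X1 l0 z1) / h - Y1 z1) \<longlongrightarrow> 0) (at 0)"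
      by (rule Lim_transform_eventually[OF sq[of D1]]) (auto simp: eventually_at D1_def diff_divide_distrib intro!: exI[of _ 1])
    moreover have "((\<lambda>h. (X2 (l0 + h) z1 - X2 l0 z1) / h - Y2 z1) \<longlongrightarrow> 0) (at 0)"
      by (rule Lim_transform_eventually[OF sq[of D2]]) (auto simp: eventually_at D2_def diff_divide_distrib intro!: exI[of _ 1])
    ultimately have "((\<lambda>l. X1 l z1) has_field_derivative Y1 z1) (at l0)" "((\<lambda>l. X2 l z1) has_field_derivative Y2 z1) (at l0)"
      by (auto simp: DERIV_def LIM_zero_iff)
    then show ?thesis by (simp only: X1_def X2_def Y1_def Y2_def)
  qed
  show ?thesis
    unfolding lax_ode_def
  proof (rule exI[of _ "\<lambda>l. F1 l z1"], rule exI[of _ "\<lambda>l. G1 l z1"], rule exI[of _ "\<lambda>l. F2 l z1"], rule exI[of _ "\<lambda>l. G2 l z1"],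
      rule exI[of _ C], intro conjI allI impI)
    fix l
    show "F1 l z1 * G2 l z1 - G1 l z1 * F2 l z1 = 1" by (rule det)
    show "norm (F1 l z1) \<le> exp (C * (1 + norm l^2))" by (rule small[OF grow(1)[of l]]) simp
    show "norm (F2 l z1) \<le> exp (C * (1 + norm l^2))"
      using grow(1)[of l] by (intro small[of _ "norm (F1 l z1)^2"]) (auto simp: add.commute)
    show "norm (G1 l z1) \<le> exp (C * (1 + norm l^2))" by (rule small[OF grow(2)[of l]]) simp
    show "norm (G2 l z1) \<le> exp (C * (1 + norm l^2))"
      using grow(2)[of l] by (intro small[of _ "norm (G1 l z1)^2"]) (auto simp: add.commute)
  qed (use main in blast)+
qed

lemma exp_bound_superdecay:
  assumes t: "\<And>l. norm (t l) \<le> exp (C * (1 + norm l^2))" "\<And>l. norm (t' l) \<le> exp (C * (1 + norm l^2))"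
    and u: "superdecay k u" "superdecay k w"
  shows "superdecay k (\<lambda>l. t l * u l + t' l * w l)"
proof (rule superdecay_bound[OF _ u])
  show "\<forall>\<^sub>F r in at_top. norm (t (ray (central k) r) * u (ray (central k) r) + t' (ray (central k) r) * w (ray (central k) r))
      \<le> exp (2 * \<bar>C\<bar> * r^2) * (norm (u (ray (central k) r)) + norm (w (ray (central k) r)))"
    using eventually_ge_at_top[of 1]
  proof eventually_elim
    case (elim r)
    let ?l = "ray (central k) r"
    have "1 \<le> r * r" using mult_mono[OF elim elim] elim by simp
    then have "\<bar>C\<bar> * (1 + r^2) \<le> \<bar>C\<bar> * (2 * r^2)"
      by (intro mult_left_mono) (auto simp: power2_eq_square)
    moreover have "C * (1 + r^2) \<le> \<bar>C\<bar> * (1 + r^2)" by (intro mult_right_mono) auto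
    ultimately have e: "exp (C * (1 + norm ?l^2)) \<le> exp (2 * \<bar>C\<bar> * r^2)" by (simp add: norm_ray)
    have "norm (t ?l * u ?l + t' ?l * w ?l) \<le> norm (t ?l) * norm (u ?l) + norm (t' ?l) * norm (w ?l)"
      using norm_triangle_ineq[of "t ?l * u ?l" "t' ?l * w ?l"] by (simp only: norm_mult)
    also have "\<dots> \<le> exp (2 * \<bar>C\<bar> * r^2) * norm (u ?l) + exp (2 * \<bar>C\<bar> * r^2) * norm (w ?l)"
      using order_trans[OF t(1) e] order_trans[OF t(2) e] by (intro add_mono mult_right_mono) auto
    finally show ?case by (simp add: ring_distribs)
  qed
qed

section \<open>Invariance of the multipliers under transport\<close>

locale lax_pair = L0: lax_system a0 c0 d0 e0 j0 m0 + L1: lax_system a1 c1 d1 e1 j1 m1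
  for a0 c0 d0 e0 j0 m0 a1 c1 d1 e1 j1 m1
begin

text \<open>The images of the first frame decay, obey the same Stokes relations and have Wronskians
  rescaled by \<tau>, so \<open>stokes_compare\<close> applies to them; \<open>sg\<close> is the
  ratio of the two periods.\<close>

lemma stokes_transport:
  assumes sol: "\<And>u w. L0.solution u w \<Longrightarrow> L1.solution (\<lambda>l. t11 l * u l + t12 l * w l) (\<lambda>l. t21 l * u l + t22 l * w l)"
    and det: "\<And>l. t11 l * t22 l - t12 l * t21 l = \<tau>" "\<tau> \<noteq> 0"
    and grow: "\<And>l. norm (t11 l) \<le> exp (C * (1 + norm l^2))" "\<And>l. norm (t12 l) \<le> exp (C * (1 + norm l^2))"
      "\<And>l. norm (t21 l) \<le> exp (C * (1 + norm l^2))" "\<And>l. norm (t22 l) \<le> exp (C * (1 + norm l^2))"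
    and per: "L0.period = sg * L1.period" "sg = 1 \<or> sg = -1"
  shows "L1.stokes k = sg * L0.stokes k"
proof (rule L1.stokes_compare[where X = "\<lambda>k l. t11 l * L0.U k l + t12 l * L0.W k l" and Y = "\<lambda>k l. t21 l * L0.U k l + t22 l * L0.W k l"
      and D = "-2 * \<tau>"])
  fix k
  show "L1.solution (\<lambda>l. t11 l * L0.U k l + t12 l * L0.W k l) (\<lambda>l. t21 l * L0.U k l + t22 l * L0.W k l)"
    by (rule sol[OF L0.frame_solution])
  show "superdecay k (\<lambda>l. t11 l * L0.U k l + t12 l * L0.W k l)" "superdecay k (\<lambda>l. t21 l * L0.U k l + t22 l * L0.W k l)"
    by (rule exp_bound_superdecay[OF grow(1,2) L0.frame_superdecay], rule exp_bound_superdecay[OF grow(3,4) L0.frame_superdecay])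
  have "(t11 0 * L0.U k 0 + t12 0 * L0.W k 0) * (t21 0 * L0.U (k + 1) 0 + t22 0 * L0.W (k + 1) 0)
      - (t11 0 * L0.U (k + 1) 0 + t12 0 * L0.W (k + 1) 0) * (t21 0 * L0.U k 0 + t22 0 * L0.W k 0)
      = (t11 0 * t22 0 - t12 0 * t21 0) * (L0.U k 0 * L0.W (k + 1) 0 - L0.U (k + 1) 0 * L0.W k 0)"
    by (simp add: algebra_simps)
  then show "(t11 0 * L0.U k 0 + t12 0 * L0.W k 0) * (t21 0 * L0.U (k + 1) 0 + t22 0 * L0.W (k + 1) 0)
      - (t11 0 * L0.U (k + 1) 0 + t12 0 * L0.W (k + 1) 0) * (t21 0 * L0.U k 0 + t22 0 * L0.W k 0) = - 2 * \<tau> * (-1) powi k"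
    unfolding det L0.frame_det by simp
  fix l
  show "t11 l * L0.U (k - 1) l + t12 l * L0.W (k - 1) l = t11 l * L0.U (k + 1) l + t12 l * L0.W (k + 1) l
      + L0.stokes k * (t11 l * L0.U k l + t12 l * L0.W k l)"
    "t21 l * L0.U (k - 1) l + t22 l * L0.W (k - 1) l = t21 l * L0.U (k + 1) l + t22 l * L0.W (k + 1) l
      + L0.stokes k * (t21 l * L0.U k l + t22 l * L0.W k l)"
    unfolding L0.stokes_relation[of k l] by (simp_all add: algebra_simps)
  show "t11 l * L0.U (k + 5) l + t12 l * L0.W (k + 5) l = sg * L1.period * (t11 l * L0.U k l + t12 l * L0.W k l)"
    "t21 l * L0.U (k + 5) l + t22 l * L0.W (k + 5) l = sg * L1.period * (t21 l * L0.U k l + t22 l * L0.W k l)"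
    unfolding L0.frame_shift per(1)[symmetric] by (simp_all add: algebra_simps)
qed (use det(2) per(2) in auto)

end

text \<open>The deformation matrix of the Lax pair is \<open>[[0, - l - 2 y], [-1, 0]]\<close>. With
  it the first curvature condition is the Painleve equation, and the other two are
  identities.\<close>

lemma PI_stokes_ball:
  assumes S: "open S" "convex S" "z0 \<in> S" "z1 \<in> S"
    and y: "\<And>z. z \<in> S \<Longrightarrow> (y has_field_derivative deriv y z) (at z)"
      "\<And>z. z \<in> S \<Longrightarrow> (deriv y has_field_derivative 6 * y z ^ 2 - z) (at z)"
  shows "PI_stokes y z1 k = PI_stokes y z0 k"
proof -
  interpret P0: pi_point y z0 .
  interpret P1: pi_point y z1 .
  have yhol: "y holomorphic_on S" using y(1) S(1) by (auto simp: holomorphic_on_open)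
  have "\<exists>t11 t12 t21 t22 :: complex \<Rightarrow> complex. \<exists>C.
    (\<forall>u w. lax_ode (\<lambda>l. deriv y z0) (lax_entry (y z0) z0) (\<lambda>l. 2 * (l - y z0)) u w \<longrightarrow>
       lax_ode (\<lambda>l. deriv y z1) (lax_entry (y z1) z1) (\<lambda>l. 2 * (l - y z1))
         (\<lambda>l. t11 l * u l + t12 l * w l) (\<lambda>l. t21 l * u l + t22 l * w l)) \<and>
    (\<forall>l. t11 l * t22 l - t12 l * t21 l = 1) \<and>
    (\<forall>l. norm (t11 l) \<le> exp (C * (1 + norm l^2)) \<and> norm (t12 l) \<le> exp (C * (1 + norm l^2)) \<and>
         norm (t21 l) \<le> exp (C * (1 + norm l^2)) \<and> norm (t22 l) \<le> exp (C * (1 + norm l^2)))"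
  proof (rule isomonodromic_transport[where ?A11.0 = "\<lambda>l. deriv y" and ?A12.0 = "\<lambda>l z. lax_entry (y z) z l" and ?A21.0 = "\<lambda>l z. 2 * (l - y z)"
      and A11' = "\<lambda>l z. 6 * y z ^ 2 - z" and A12' = "\<lambda>l z. 2 * l * deriv y z - 1 + 4 * y z * deriv y z"
      and A21' = "\<lambda>l z. - 2 * deriv y z" and p = "\<lambda>z. 0" and q = "\<lambda>z. - 2 * y z" and s = "\<lambda>z. -1" and ?q1.0 = "-1" and ?q2.0 = 0, OF S])
    show "(\<lambda>z. - 2 * y z) holomorphic_on S" by (intro holomorphic_intros yhol)
    fix l z assume z: "z \<in> S"
    show "(deriv y has_field_derivative 6 * (y z)\<^sup>2 - z) (at z)" by (rule y(2)[OF z])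
    show "((\<lambda>z. lax_entry (y z) z l) has_field_derivative 2 * l * deriv y z - 1 + 4 * y z * deriv y z) (at z)"
      unfolding lax_entry_def by (rule derivative_eq_intros y(1)[OF z] refl | simp)+
    show "((\<lambda>z. 2 * (l - y z)) has_field_derivative - 2 * deriv y z) (at z)"
      by (rule derivative_eq_intros y(1)[OF z] refl | simp)+
  qed (simp_all add: lax_entry_def algebra_simps power2_eq_square)
  then obtain t11 t12 t21 t22 C where t:
    "\<forall>u w. lax_ode (\<lambda>l. deriv y z0) (lax_entry (y z0) z0) (\<lambda>l. 2 * (l - y z0)) u w \<longrightarrow>
       lax_ode (\<lambda>l. deriv y z1) (lax_entry (y z1) z1) (\<lambda>l. 2 * (l - y z1))
         (\<lambda>l. t11 l * u l + t12 l * w l) (\<lambda>l. t21 l * u l + t22 l * w l)"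
    "\<forall>l. t11 l * t22 l - t12 l * t21 l = 1"
    "\<forall>l. norm (t11 l) \<le> exp (C * (1 + norm l^2)) \<and> norm (t12 l) \<le> exp (C * (1 + norm l^2)) \<and>
         norm (t21 l) \<le> exp (C * (1 + norm l^2)) \<and> norm (t22 l) \<le> exp (C * (1 + norm l^2))"
    by blast
  have sol: "P0.solution u w \<longleftrightarrow> lax_ode (\<lambda>l. deriv y z0) (lax_entry (y z0) z0) (\<lambda>l. 2 * (l - y z0)) u w"
    "P1.solution u w \<longleftrightarrow> lax_ode (\<lambda>l. deriv y z1) (lax_entry (y z1) z1) (\<lambda>l. 2 * (l - y z1)) u w" for u w
    unfolding P0.solution_def P1.solution_def P0.f_eq P1.f_eq lax_ode_def by (rule refl)+
  interpret lax_pair z0 "(deriv y z0)^2 - 4 * (y z0)^3 + 2 * z0 * y z0" "deriv y z0" "y z0" lax_degree "lax_entry (y z0) z0"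
    z1 "(deriv y z1)^2 - 4 * (y z1)^3 + 2 * z1 * y z1" "deriv y z1" "y z1" lax_degree "lax_entry (y z1) z1"
    by unfold_locales
  have "P1.stokes k = 1 * P0.stokes k"
    by (rule stokes_transport[where ?t11.0 = t11 and ?t12.0 = t12 and ?t21.0 = t21 and ?t22.0 = t22 and C = C and \<tau> = 1])
      (use t in \<open>auto simp: sol\<close>)
  then show ?thesis by (simp add: P0.PI_stokes_eq P1.PI_stokes_eq)
qed

section \<open>Regular points of a transcendent\<close>

lemma PI_transcendent_at:
  assumes "PI_transcendent y" "\<not> is_pole y z"
  shows "y analytic_on {z}" "(y has_field_derivative deriv y z) (at z)"
    "(deriv y has_field_derivative 6 * y z ^ 2 - z) (at z)"
proof -
  have an: "y analytic_on {z}" and ode: "(deriv ^^ 2) y z = 6 * y z ^ 2 - z"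
    using assms by (auto simp: PI_transcendent_def)
  show "y analytic_on {z}" by fact
  show "(y has_field_derivative deriv y z) (at z)"
    using analytic_on_imp_differentiable_at[OF an] by (simp add: field_differentiable_derivI)
  have "deriv y analytic_on {z}" using an by (rule analytic_deriv)
  then have "(deriv y has_field_derivative deriv (deriv y) z) (at z)"
    using analytic_on_imp_differentiable_at by (blast intro: field_differentiable_derivI)
  then show "(deriv y has_field_derivative 6 * y z ^ 2 - z) (at z)"
    using ode by (simp add: eval_nat_numeral)
qed

lemma open_nonpoles:
  assumes "PI_transcendent y"
  shows "open {z. \<not> is_pole y z}"
  unfolding open_contains_ball
proof
  fix z assume "z \<in> {z. \<not> is_pole y z}"
  then have "y analytic_on {z}" using PI_transcendent_at(1)[OF assms] by simp
  then obtain r where r: "r > 0" "y holomorphic_on ball z r" by (auto simp: analytic_on_def)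
  then have "ball z r \<subseteq> {z. \<not> is_pole y z}" using not_is_pole_holomorphic[OF open_ball] by blast
  then show "\<exists>e>0. ball z e \<subseteq> {z. \<not> is_pole y z}" using r(1) by blast
qed

text \<open>Poles are sparse, hence countable, and the plane minus a countable set is
  connected.\<close>

lemma connected_nonpoles:
  assumes "PI_transcendent y"
  shows "connected {z. \<not> is_pole y z}" "\<exists>z. \<not> is_pole y z"
proof -
  have "eventually (\<lambda>z. \<not> is_pole y z) (cosparse UNIV)"
    using assms by (intro meromorphic_on_imp_not_pole_cosparse) (auto simp: PI_transcendent_def)
  then have "{z. is_pole y z} sparse_in UNIV" by (simp add: eventually_cosparse)
  then have cnt: "countable {z. is_pole y z}" using sparse_imp_countable[of UNIV "{z. is_pole y z}"] by auto
  have eq: "{z. \<not> is_pole y z} = UNIV - {z. is_pole y z}" by auto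
  show "connected {z. \<not> is_pole y z}"
    unfolding eq by (rule connected_open_diff_countable) (use cnt in auto)
  show "\<exists>z. \<not> is_pole y z"
    using cnt uncountable_UNIV_complex by (metis UNIV_eq_I mem_Collect_eq)
qed

lemma PI_stokes_constant:
  assumes PI: "PI_transcendent y" and z: "\<not> is_pole y z" "\<not> is_pole y z'"
  shows "PI_stokes y z k = PI_stokes y z' k"
proof -
  let ?N = "{z. \<not> is_pole y z}"
  have "(\<lambda>z. PI_stokes y z k) constant_on ?N"
  proof (rule locally_constant_imp_constant[OF connected_nonpoles(1)[OF PI]])
    fix w assume w: "w \<in> ?N"
    then obtain r where r: "r > 0" "ball w r \<subseteq> ?N" using open_nonpoles[OF PI] open_contains_ball by metis
    have const: "PI_stokes y x k = PI_stokes y w k" if "x \<in> ball w r" for x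
      by (rule PI_stokes_ball[of "ball w r"]) (use r that PI_transcendent_at(2,3)[OF PI] in auto)
    have op: "openin (top_of_set ?N) (ball w r)" using r(2) by (intro open_subset) auto
    show "\<exists>T. openin (top_of_set ?N) T \<and> w \<in> T \<and> (\<forall>x\<in>T. PI_stokes y x k = PI_stokes y w k)"
    proof (intro exI conjI ballI)
      show "openin (top_of_set ?N) (ball w r)" by (rule op)
      show "w \<in> ball w r" using r(1) by simp
    qed (rule const)
  qed
  then obtain c where "\<And>w. w \<in> ?N \<Longrightarrow> PI_stokes y w k = c" by (auto simp: constant_on_def)
  then show ?thesis using z by simp
qed

section \<open>Monodromy data at a regular point\<close>

lemma PI_monodromy_eq:
  assumes PI: "PI_transcendent y" and z: "\<not> is_pole y z"
  shows "PI_monodromy y (of_int k) = PI_stokes y z k"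
  unfolding PI_monodromy_def
proof (rule the_equality)
  show "\<forall>k' z'. of_int k' = (of_int k :: 5) \<longrightarrow> \<not> is_pole y z' \<longrightarrow> PI_stokes y z' k' = PI_stokes y z k"
  proof (intro allI impI)
    fix k' z' assume k': "of_int k' = (of_int k :: 5)" and z': "\<not> is_pole y z'"
    have k: "PI_stokes y z k' = PI_stokes y z k"
      by (rule periodic_of_int_5[where g = "PI_stokes y z", OF pi_point.PI_stokes_periodic k'])
    show "PI_stokes y z' k' = PI_stokes y z k"
      unfolding k[symmetric] by (rule PI_stokes_constant[OF PI z' z])
  qed
  fix \<sigma> assume "\<forall>k' z'. of_int k' = (of_int k :: 5) \<longrightarrow> \<not> is_pole y z' \<longrightarrow> PI_stokes y z' k' = \<sigma>"
  from this[rule_format, OF refl z] show "\<sigma> = PI_stokes y z k" by simp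
qed

lemma monodromy_eq_iff:
  assumes PI: "PI_transcendent y" and z: "\<not> is_pole y z"
  shows "PI_monodromy y = cubic_monodromy a b \<longleftrightarrow> (\<forall>k. PI_stokes y z k = cubic_stokes a b k)"
proof
  assume "PI_monodromy y = cubic_monodromy a b"
  then show "\<forall>k. PI_stokes y z k = cubic_stokes a b k"
    unfolding PI_monodromy_eq[OF assms, symmetric] cubic_monodromy_eq[symmetric] by simp
next
  assume h: "\<forall>k. PI_stokes y z k = cubic_stokes a b k"
  show "PI_monodromy y = cubic_monodromy a b"
  proof
    fix j :: 5
    obtain k where "of_int k = j" by (rule mod_5_cases)
    then show "PI_monodromy y j = cubic_monodromy a b j"
      using h PI_monodromy_eq[OF assms, of k] cubic_monodromy_eq[of a b k] by simp
  qed
qed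

section \<open>The system near a pole\<close>

lemma eq_at_0_if_eq_punctured:
  fixes F G :: "complex \<Rightarrow> complex"
  assumes "F holomorphic_on ball 0 r" "G holomorphic_on ball 0 r" "0 < r"
    and eq: "\<And>t. t \<in> ball 0 r \<Longrightarrow> t \<noteq> 0 \<Longrightarrow> F t = G t"
  shows "F 0 = G 0"
proof -
  have "isCont F 0" "isCont G 0"
    using assms(1-3) by (auto simp: continuous_on_eq_continuous_at dest!: holomorphic_on_imp_continuous_on)
  then have FG: "(F \<longlongrightarrow> F 0) (at 0)" "(G \<longlongrightarrow> G 0) (at 0)" by (simp_all add: isCont_def)
  have "\<forall>\<^sub>F t in at 0. F t = G t"
    using eq assms(3) by (auto simp: eventually_at intro!: exI[of _ r])
  from Lim_transform_eventually[OF FG(1) this] FG(2) show ?thesis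
    by (rule tendsto_unique[OF at_neq_bot])
qed

section \<open>Laurent expansion at a pole\<close>

lemma PI_pole_factor:
  assumes PI: "PI_transcendent y" and pole: "is_pole y a"
  obtains r g n where "0 < r" "0 < n" "g holomorphic_on ball 0 r" "g 0 \<noteq> 0"
    "\<And>t. t \<in> ball 0 r \<Longrightarrow> t \<noteq> 0 \<Longrightarrow> \<not> is_pole y (a + t)"
    "\<And>t. t \<in> ball 0 r \<Longrightarrow> t \<noteq> 0 \<Longrightarrow> y (a + t) = g t / t ^ n"
proof -
  have "y meromorphic_on {a}" using PI by (auto simp: PI_transcendent_def intro: meromorphic_on_subset)
  then have "isolated_singularity_at y a" by (simp add: meromorphic_at_iff)
  then obtain R where R: "R > 0" "y analytic_on ball a R - {a}" by (auto simp: isolated_singularity_at_def)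
  then have hol: "y holomorphic_on ball a R - {a}" by (simp add: analytic_imp_holomorphic)
  define n where "n = nat (- zorder y a)"
  define g where "g = (\<lambda>t. zor_poly y a (a + t))"
  obtain r where r: "zorder y a < 0" "zor_poly y a a \<noteq> 0" "r > 0" "cball a r \<subseteq> ball a R"
    "zor_poly y a holomorphic_on cball a r"
    "\<And>w. w \<in> cball a r - {a} \<Longrightarrow> y w = zor_poly y a w / (w - a) ^ nat (- zorder y a)"
    using zorder_exist_pole[OF hol open_ball _ pole] R(1) by auto
  show ?thesis
  proof (rule that[of r n g])
    show "0 < r" "0 < n" "g 0 \<noteq> 0" using r by (auto simp: n_def g_def)
    have "(zor_poly y a \<circ> (\<lambda>t::complex. a + t)) holomorphic_on ball 0 r"
      by (intro holomorphic_on_compose_gen[OF _ r(5)] holomorphic_intros) (auto simp: dist_norm)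
    then show "g holomorphic_on ball 0 r" by (simp add: g_def o_def)
    fix t :: complex assume t: "t \<in> ball 0 r" "t \<noteq> 0"
    then have m: "a + t \<in> cball a r - {a}" by (auto simp: dist_norm)
    then have "a + t \<in> ball a R - {a}" using r(4) by blast
    then show "\<not> is_pole y (a + t)" by (intro not_is_pole_holomorphic[OF _ _ hol]) auto
    show "y (a + t) = g t / t ^ n" using r(6)[OF m] by (simp add: g_def n_def)
  qed
qed

text \<open>This is the Painleve equation for \<open>g / t^n\<close> multiplied by
  \<open>t^(2 * n + 2)\<close>, which clears the denominators so that it can be evaluated at
  0.\<close>

lemma PI_pole_factor_ode:
  assumes PI: "PI_transcendent y" and r: "0 < r" and g: "g holomorphic_on ball 0 r"
    and np: "\<And>t. t \<in> ball 0 r \<Longrightarrow> t \<noteq> 0 \<Longrightarrow> \<not> is_pole y (a + t)"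
    and eq: "\<And>t. t \<in> ball 0 r \<Longrightarrow> t \<noteq> 0 \<Longrightarrow> y (a + t) = g t / t ^ n"
    and t: "t \<in> ball 0 r" "t \<noteq> 0"
  shows "t ^ n * (t^2 * deriv (deriv g) t - 2 * of_nat n * t * deriv g t + of_nat n * of_nat (n + 1) * g t)
     = 6 * g t ^ 2 * t^2 - (a + t) * t ^ (2 * n + 2)"
proof -
  define S where "S = ball (0::complex) r - {0}"
  have S: "open S" by (simp add: S_def open_Diff)
  have dg: "(g has_field_derivative deriv g t) (at t)" if "t \<in> S" for t
    using that g by (intro holomorphic_derivI[of g "ball 0 r"]) (auto simp: S_def)
  have dg1: "(deriv g has_field_derivative deriv (deriv g) t) (at t)" if "t \<in> S" for t
    using that holomorphic_deriv[OF g open_ball] by (intro holomorphic_derivI[of "deriv g" "ball 0 r"]) (auto simp: S_def)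
  define Y where "Y = (\<lambda>t. (t * deriv g t - of_nat n * g t) / t ^ (n + 1))"
  have sh: "((\<lambda>t. a + t) has_field_derivative 1) (at t)" for t :: complex
    by (auto intro!: derivative_eq_intros)
  have dY: "deriv y (a + t) = Y t" if t: "t \<in> S" for t
  proof -
    have t0: "t \<noteq> 0" using t by (simp add: S_def)
    have 1: "((\<lambda>t. y (a + t)) has_field_derivative deriv y (a + t) * 1) (at t)"
      using t np PI_transcendent_at(2)[OF PI] by (intro DERIV_chain2[OF _ sh]) (auto simp: S_def)
    have "((\<lambda>t. g t / t ^ n) has_field_derivative (deriv g t * t ^ n - g t * (of_nat n * t ^ (n - 1))) / (t ^ n * t ^ n)) (at t)"
      using t0 by (intro DERIV_divide dg t) (auto intro!: derivative_eq_intros)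
    moreover have "((\<lambda>t. g t / t ^ n) has_field_derivative deriv y (a + t) * 1) (at t)"
      by (rule has_field_derivative_transform_within_open[OF 1 S t]) (use eq in \<open>simp add: S_def\<close>)
    ultimately have "deriv y (a + t) * 1 = (deriv g t * t ^ n - g t * (of_nat n * t ^ (n - 1))) / (t ^ n * t ^ n)"
      by (rule DERIV_unique[symmetric])
    also have "\<dots> = Y t"
      using t0 by (cases n) (simp_all add: Y_def field_simps power_add)
    finally show ?thesis by simp
  qed
  have tS: "t \<in> S" using t by (simp add: S_def)
  have 1: "((\<lambda>t. deriv y (a + t)) has_field_derivative (6 * y (a + t) ^ 2 - (a + t)) * 1) (at t)"
    using t np PI_transcendent_at(3)[OF PI] by (intro DERIV_chain2[OF _ sh]) auto
  have pw: "((\<lambda>t::complex. t ^ (n + 1)) has_field_derivative of_nat (n + 1) * t ^ n) (at t)"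
    using DERIV_power[OF DERIV_ident[of "at t"], of "n + 1"] by simp
  have "(Y has_field_derivative (((1 * deriv g t + deriv (deriv g) t * t) - of_nat n * deriv g t) * t ^ (n + 1)
      - (t * deriv g t - of_nat n * g t) * (of_nat (n + 1) * t ^ n)) / (t ^ (n + 1) * t ^ (n + 1))) (at t)"
    unfolding Y_def using t(2)
    by (intro DERIV_divide[OF DERIV_diff[OF DERIV_mult[OF DERIV_ident dg1[OF tS]] DERIV_cmult[OF dg[OF tS]]] pw]) simp
  moreover have "(Y has_field_derivative (6 * y (a + t) ^ 2 - (a + t)) * 1) (at t)"
    by (rule has_field_derivative_transform_within_open[OF 1 S tS]) (rule dY)
  ultimately have e: "6 * y (a + t) ^ 2 - (a + t) = (((1 * deriv g t + deriv (deriv g) t * t) - of_nat n * deriv g t) * t ^ (n + 1)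
      - (t * deriv g t - of_nat n * g t) * (of_nat (n + 1) * t ^ n)) / (t ^ (n + 1) * t ^ (n + 1))"
    using DERIV_unique by fastforce
  have "6 * g t ^ 2 * t^2 - (a + t) * t ^ (2 * n + 2) = (6 * y (a + t) ^ 2 - (a + t)) * (t ^ (n + 1) * t ^ (n + 1))"
    unfolding eq[OF t] using t(2) by (simp add: power_divide power_add power_mult power2_eq_square algebra_simps)
  also have "\<dots> = ((1 * deriv g t + deriv (deriv g) t * t) - of_nat n * deriv g t) * t ^ (n + 1)
      - (t * deriv g t - of_nat n * g t) * (of_nat (n + 1) * t ^ n)"
    unfolding e using t(2) by simp
  also have "\<dots> = t ^ n * (t^2 * deriv (deriv g) t - 2 * of_nat n * t * deriv g t + of_nat n * of_nat (n + 1) * g t)"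
    by (simp add: algebra_simps power2_eq_square)
  finally show ?thesis ..
qed

text \<open>Balance of leading terms: for \<open>n = 1\<close> the second derivative dominates and
  yields \<open>n * (n + 1) * g 0 = 0\<close>, for \<open>n \<ge> 3\<close> the square dominates and
  yields \<open>6 * g 0 ^ 2 = 0\<close>.\<close>

lemma PI_pole_order:
  assumes r: "0 < r" and n: "0 < n" and g: "g holomorphic_on ball 0 r" "g 0 \<noteq> 0"
    and ode: "\<And>t. t \<in> ball 0 r \<Longrightarrow> t \<noteq> 0 \<Longrightarrow>
      t ^ n * (t^2 * deriv (deriv g) t - 2 * of_nat n * t * deriv g t + of_nat n * of_nat (n + 1) * g t)
        = 6 * g t ^ 2 * t^2 - (a + t) * t ^ (2 * n + 2)"
  shows "n = 2"
proof -
  have g1: "deriv g holomorphic_on ball 0 r" using g(1) by (rule holomorphic_deriv) simp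
  have g2: "deriv (deriv g) holomorphic_on ball 0 r" using g1 by (rule holomorphic_deriv) simp
  define E where "E = (\<lambda>t. t^2 * deriv (deriv g) t - 2 * of_nat n * t * deriv g t + of_nat n * of_nat (n + 1) * g t)"
  have E: "E holomorphic_on ball 0 r" unfolding E_def by (intro holomorphic_intros g g1 g2)
  have E0: "E 0 = of_nat n * of_nat (n + 1) * g 0" by (simp add: E_def)
  have "n \<noteq> 1"
  proof
    assume 1: "n = 1"
    have "E 0 = (\<lambda>t. 6 * g t ^ 2 * t - (a + t) * t ^ 3) 0"
    proof (rule eq_at_0_if_eq_punctured[OF E _ r])
      show "(\<lambda>t. 6 * g t ^ 2 * t - (a + t) * t ^ 3) holomorphic_on ball 0 r" by (intro holomorphic_intros g)
      fix t assume t: "t \<in> ball 0 r" "t \<noteq> (0::complex)"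
      have "t * E t = t * (6 * g t ^ 2 * t - (a + t) * t ^ 3)"
        using ode[OF t] by (simp add: 1 E_def algebra_simps eval_nat_numeral)
      then show "E t = 6 * g t ^ 2 * t - (a + t) * t ^ 3" using t(2) by simp
    qed
    then show False using g(2) n by (simp add: E0 1)
  qed
  moreover have "\<not> n \<ge> 3"
  proof
    assume "n \<ge> 3"
    then obtain m where m: "n = m + 3" using le_Suc_ex by (metis add.commute)
    have "(\<lambda>t. t ^ (m + 1) * E t) 0 = (\<lambda>t. 6 * g t ^ 2 - (a + t) * t ^ (2 * n)) 0"
    proof (rule eq_at_0_if_eq_punctured[OF _ _ r])
      show "(\<lambda>t. t ^ (m + 1) * E t) holomorphic_on ball 0 r" "(\<lambda>t. 6 * g t ^ 2 - (a + t) * t ^ (2 * n)) holomorphic_on ball 0 r"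
        by (intro holomorphic_intros g E)+
      fix t assume t: "t \<in> ball 0 r" "t \<noteq> (0::complex)"
      have "t ^ n = t^2 * t ^ (m + 1)" unfolding m by (simp add: eval_nat_numeral)
      moreover have "t ^ n * E t = t^2 * (6 * g t ^ 2 - (a + t) * t ^ (2 * n))"
        unfolding E_def ode[OF t] by (simp add: algebra_simps power_add power2_eq_square)
      ultimately have "t^2 * (t ^ (m + 1) * E t) = t^2 * (6 * g t ^ 2 - (a + t) * t ^ (2 * n))" by (simp only: mult.assoc)
      then show "t ^ (m + 1) * E t = 6 * g t ^ 2 - (a + t) * t ^ (2 * n)" using t(2) by simp
    qed
    then show False using g(2) by (simp add: m power_0_left)
  qed
  ultimately show ?thesis using n by linarith
qed

text \<open>After the terms \<open>12 * G_0 * G_n\<close> are moved to the left, the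
  \<open>n\<close>-th coefficient, \<open>n > 0\<close>, carries the factor
  \<open>(n + 1) * (n - 6)\<close>. So everything below 6 is determined, while the sixth coefficient
  is free: the resonance that leaves room for \<open>b\<close>.\<close>

lemma PI_pole_coefficients:
  fixes G :: "complex fps"
  assumes "fps_X ^ 2 * fps_deriv (fps_deriv G) - fps_const 4 * (fps_X * fps_deriv G) + fps_const 6 * G
      = fps_const 6 * (G * G) - (fps_const a * fps_X ^ 4 + fps_X ^ 5)"
    and G0: "fps_nth G 0 \<noteq> 0"
  shows "fps_nth G 0 = 1" "fps_nth G (Suc 0) = 0" "fps_nth G 2 = 0" "fps_nth G 3 = 0" "fps_nth G 4 = a / 10" "fps_nth G 5 = 1 / 6"
proof -
  have L: "fps_nth (fps_X ^ 2 * fps_deriv (fps_deriv G) - fps_const 4 * (fps_X * fps_deriv G) + fps_const 6 * G) n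
      = (of_nat n * (of_nat n - 1) - 4 * of_nat n + 6) * fps_nth G n" for n
  proof -
    consider "n = 0" | "n = 1" | m where "n = Suc (Suc m)" by (metis One_nat_def old.nat.exhaust)
    then show ?thesis
    proof cases
      case 3
      have "fps_nth (fps_X ^ 2 * fps_deriv (fps_deriv G)) n = of_nat (Suc m) * (of_nat (Suc (Suc m)) * fps_nth G n)"
        unfolding 3 by (simp add: fps_X_power_mult_nth)
      moreover have "fps_nth (fps_X * fps_deriv G) n = of_nat n * fps_nth G n"
        unfolding 3 by simp
      ultimately show ?thesis unfolding 3 by (simp add: algebra_simps)
    qed (simp_all add: fps_X_power_mult_nth)
  qed
  have R: "(of_nat n * (of_nat n - 1) - 4 * of_nat n + 6) * fps_nth G n
     = 6 * (\<Sum>i=0..n. fps_nth G i * fps_nth G (n - i)) - ((if n = 4 then a else 0) + (if n = 5 then 1 else 0))" for n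
  proof -
    have "fps_nth (fps_const 6 * (G * G) - (fps_const a * fps_X ^ 4 + fps_X ^ 5)) n
        = 6 * fps_nth (G * G) n - ((if n = 4 then a else 0) + (if n = 5 then 1 else 0))"
      by (simp add: fps_X_power_nth)
    then show ?thesis unfolding L[symmetric] assms(1) by (simp only: fps_mult_nth)
  qed
  show c0: "fps_nth G 0 = 1" using R[of 0] G0 by simp
  show c1: "fps_nth G (Suc 0) = 0" using R[of 1] by (simp add: c0)
  show c2: "fps_nth G 2 = 0" using R[of 2] by (simp add: eval_nat_numeral c0 c1)
  show c3: "fps_nth G 3 = 0" using R[of 3] c2 by (simp add: eval_nat_numeral c0 c1)
  show c4: "fps_nth G 4 = a / 10" using R[of 4] c2 c3 by (simp add: eval_nat_numeral c0 c1 mult.commute eq_divide_eq)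
  show c5: "fps_nth G 5 = 1 / 6" using R[of 5] c2 c3 c4 by (simp add: eval_nat_numeral c0 c1 mult.commute eq_divide_eq)
qed

text \<open>Subtracting the determined coefficients from \<open>t^2 * y (a + t)\<close> and dividing
  by \<open>t^6\<close> isolates \<beta>, whose value at 0 is the free coefficient. The singular
  equation for \<beta> serves later to eliminate its second derivative.\<close>

lemma PI_pole_expansion:
  assumes PI: "PI_transcendent y" and pole: "is_pole y a"
  obtains r \<beta> where "0 < r" "\<beta> holomorphic_on ball 0 r"
    "\<And>t. t \<in> ball 0 r \<Longrightarrow> t \<noteq> 0 \<Longrightarrow> \<not> is_pole y (a + t)"
    "\<And>t. t \<in> ball 0 r \<Longrightarrow> t \<noteq> 0 \<Longrightarrow> y (a + t) = 1 / t^2 + t^2 * (a / 10 + t / 6 + t^2 * \<beta> t)"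
    "\<And>t. t \<in> ball 0 r \<Longrightarrow> t * deriv (deriv \<beta>) t + 8 * deriv \<beta> t = 6 * t * (a / 10 + t / 6 + t^2 * \<beta> t)^2"
proof -
  obtain r g n where r: "0 < r" and n: "0 < n" and g: "g holomorphic_on ball 0 r" "g 0 \<noteq> 0"
    and np: "\<And>t. t \<in> ball 0 r \<Longrightarrow> t \<noteq> 0 \<Longrightarrow> \<not> is_pole y (a + t)"
    and eq: "\<And>t. t \<in> ball 0 r \<Longrightarrow> t \<noteq> 0 \<Longrightarrow> y (a + t) = g t / t ^ n"
    by (rule PI_pole_factor[OF PI pole]) (rule that; assumption)
  have ode: "t ^ n * (t^2 * deriv (deriv g) t - 2 * of_nat n * t * deriv g t + of_nat n * of_nat (n + 1) * g t)
        = 6 * g t ^ 2 * t^2 - (a + t) * t ^ (2 * n + 2)" if t: "t \<in> ball 0 r" "t \<noteq> 0" for t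
    by (rule PI_pole_factor_ode[OF PI r g(1) np eq t])
  have n2: "n = 2" by (rule PI_pole_order[OF r n g ode])
  have g1: "deriv g holomorphic_on ball 0 r" using g(1) by (rule holomorphic_deriv) simp
  have g2: "deriv (deriv g) holomorphic_on ball 0 r" using g1 by (rule holomorphic_deriv) simp
  have E: "t^2 * deriv (deriv g) t - 4 * (t * deriv g t) + 6 * g t = 6 * (g t * g t) - (a * t ^ 4 + t ^ 5)"
    if t: "t \<in> ball 0 r" "t \<noteq> 0" for t
  proof -
    have "t^2 * (t^2 * deriv (deriv g) t - 4 * (t * deriv g t) + 6 * g t) = t^2 * (6 * (g t * g t) - (a * t ^ 4 + t ^ 5))"
      using ode[OF t] by (simp add: n2 algebra_simps eval_nat_numeral)
    then show ?thesis using t(2) by simp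
  qed
  define G where "G = fps_expansion g 0"
  have an: "g analytic_on {0}" using g(1) r by (auto simp: analytic_at intro!: exI[of _ "ball 0 r"])
  have G: "g has_fps_expansion G" unfolding G_def by (rule analytic_at_imp_has_fps_expansion_0[OF an])
  have fl: "(\<lambda>t. t^2 * deriv (deriv g) t - 4 * (t * deriv g t) + 6 * g t) has_fps_expansion
      fps_X ^ 2 * fps_deriv (fps_deriv G) - fps_const 4 * (fps_X * fps_deriv G) + fps_const 6 * G"
    by (intro fps_expansion_intros G)
  have fr: "(\<lambda>t. 6 * (g t * g t) - (a * t ^ 4 + t ^ 5)) has_fps_expansion
      fps_const 6 * (G * G) - (fps_const a * fps_X ^ 4 + fps_X ^ 5)"
    by (intro fps_expansion_intros G)
  have E0: "(\<lambda>t. t^2 * deriv (deriv g) t - 4 * (t * deriv g t) + 6 * g t) 0 = (\<lambda>t. 6 * (g t * g t) - (a * t ^ 4 + t ^ 5)) 0"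
    by (rule eq_at_0_if_eq_punctured[OF _ _ r E]) (intro holomorphic_intros g g1 g2)+
  have ev: "\<forall>\<^sub>F t in nhds 0. t^2 * deriv (deriv g) t - 4 * (t * deriv g t) + 6 * g t = 6 * (g t * g t) - (a * t ^ 4 + t ^ 5)"
    unfolding eventually_nhds_metric
  proof (intro exI[of _ r] conjI allI impI)
    fix t :: complex assume "dist t 0 < r"
    then have "t \<in> ball 0 r" by (simp add: dist_commute)
    then show "t^2 * deriv (deriv g) t - 4 * (t * deriv g t) + 6 * g t = 6 * (g t * g t) - (a * t ^ 4 + t ^ 5)"
      using E E0 by (cases "t = 0") auto
  qed (rule r)
  have "(\<lambda>t. 6 * (g t * g t) - (a * t ^ 4 + t ^ 5)) has_fps_expansion
      fps_X ^ 2 * fps_deriv (fps_deriv G) - fps_const 4 * (fps_X * fps_deriv G) + fps_const 6 * G"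
    by (rule has_fps_expansion_cong[OF ev refl, THEN iffD1, OF fl])
  then have Geq: "fps_X ^ 2 * fps_deriv (fps_deriv G) - fps_const 4 * (fps_X * fps_deriv G) + fps_const 6 * G
      = fps_const 6 * (G * G) - (fps_const a * fps_X ^ 4 + fps_X ^ 5)"
    by (rule fps_expansion_unique_complex[OF _ fr])
  have "fps_nth G 0 = g 0" using has_fps_expansion_imp_0_eq_fps_nth_0[OF G] by simp
  then have "fps_nth G 0 \<noteq> 0" using g(2) by simp
  note c = PI_pole_coefficients[OF Geq this]
  define F where "F = G - (1 + fps_const (a / 10) * fps_X ^ 4 + fps_const (1 / 6) * fps_X ^ 5)"
  have F: "(\<lambda>t. g t - (1 + a / 10 * t ^ 4 + 1 / 6 * t ^ 5)) has_fps_expansion F"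
    unfolding F_def by (intro fps_expansion_intros G)
  have F_low: "fps_nth F i = 0" if "i < 6" for i
  proof -
    have "i = 0 \<or> i = Suc 0 \<or> i = 2 \<or> i = 3 \<or> i = 4 \<or> i = 5" using that by linarith
    then show ?thesis by (elim disjE) (simp_all add: F_def c fps_X_power_nth)
  qed
  define B where "B = fps_shift 6 F"
  have FB: "F = B * fps_X ^ 6"
    by (rule fps_ext) (auto simp: B_def fps_X_power_mult_right_nth F_low)
  have Frad: "fps_conv_radius F > 0" and Fev: "\<forall>\<^sub>F t in nhds 0. eval_fps F t = g t - (1 + a / 10 * t ^ 4 + 1 / 6 * t ^ 5)"
    using F by (auto simp: has_fps_expansion_def)
  have Brad: "fps_conv_radius B > 0" using Frad by (simp add: B_def)
  obtain r1 where r1: "r1 > 0" "\<And>t. dist t 0 < r1 \<Longrightarrow> eval_fps F t = g t - (1 + a / 10 * t ^ 4 + 1 / 6 * t ^ 5)"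
    using Fev unfolding eventually_nhds_metric by blast
  obtain r2 where r2: "r2 > 0" "ereal r2 < fps_conv_radius B"
    using ereal_dense2[OF Brad] by (auto simp: zero_ereal_def)
  define \<rho> where "\<rho> = min r (min r1 r2)"
  have \<rho>: "0 < \<rho>" "\<rho> \<le> r" "\<rho> \<le> r1" "\<rho> \<le> r2" using r r1 r2 by (auto simp: \<rho>_def)
  define \<beta> where "\<beta> = eval_fps B"
  have inB: "ereal (norm t) < fps_conv_radius B" if "t \<in> ball 0 \<rho>" for t
    using that \<rho>(4) r2(2) by (auto intro: le_less_trans[of _ "ereal r2"])
  have \<beta>: "\<beta> holomorphic_on ball 0 \<rho>"
    unfolding \<beta>_def by (rule holomorphic_on_eval_fps) (use inB in auto)
  define v where "v t = a / 10 + t / 6 + t^2 * \<beta> t" for t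
  have gv: "g t = 1 + t ^ 4 * v t" if t: "t \<in> ball 0 \<rho>" for t
  proof -
    have "eval_fps F t = \<beta> t * t ^ 6"
      unfolding FB \<beta>_def using inB[OF t] by (subst eval_fps_mult) (auto simp: eval_fps_X_power)
    moreover have "eval_fps F t = g t - (1 + a / 10 * t ^ 4 + 1 / 6 * t ^ 5)" using r1(2) t \<rho>(3) by auto
    ultimately have "g t = 1 + a / 10 * t ^ 4 + 1 / 6 * t ^ 5 + \<beta> t * t ^ 6" by (simp add: algebra_simps)
    then show ?thesis by (simp add: v_def algebra_simps eval_nat_numeral)
  qed
  have \<beta>1: "deriv \<beta> holomorphic_on ball 0 \<rho>" using \<beta> by (rule holomorphic_deriv) simp
  have \<beta>2: "deriv (deriv \<beta>) holomorphic_on ball 0 \<rho>" using \<beta>1 by (rule holomorphic_deriv) simp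
  have db: "(\<beta> has_field_derivative deriv \<beta> t) (at t)" "(deriv \<beta> has_field_derivative deriv (deriv \<beta>) t) (at t)" if "t \<in> ball 0 \<rho>" for t
    using that \<beta> \<beta>1 by (auto intro: holomorphic_derivI)
  have dg: "deriv g t = a * (2 / 5) * t^3 + 5 / 6 * t ^ 4 + 6 * t ^ 5 * \<beta> t + t ^ 6 * deriv \<beta> t" if t: "t \<in> ball 0 \<rho>" for t
  proof -
    have "((\<lambda>t. 1 + t ^ 4 * v t) has_field_derivative a * (2 / 5) * t^3 + 5 / 6 * t ^ 4 + 6 * t ^ 5 * \<beta> t + t ^ 6 * deriv \<beta> t) (at t)"
      unfolding v_def
      by (rule derivative_eq_intros db(1)[OF t] refl | simp)+ (simp add: field_simps eval_nat_numeral)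
    then have "(g has_field_derivative a * (2 / 5) * t^3 + 5 / 6 * t ^ 4 + 6 * t ^ 5 * \<beta> t + t ^ 6 * deriv \<beta> t) (at t)"
      by (rule has_field_derivative_transform_within_open[OF _ open_ball t]) (simp add: gv)
    then show ?thesis by (rule DERIV_imp_deriv)
  qed
  have dg2: "deriv (deriv g) t = a * (6 / 5) * t^2 + 10 / 3 * t ^ 3 + 30 * t ^ 4 * \<beta> t + 12 * t ^ 5 * deriv \<beta> t + t ^ 6 * deriv (deriv \<beta>) t"
    if t: "t \<in> ball 0 \<rho>" for t
  proof -
    have "((\<lambda>t. a * (2 / 5) * t^3 + 5 / 6 * t ^ 4 + 6 * t ^ 5 * \<beta> t + t ^ 6 * deriv \<beta> t) has_field_derivative
       a * (6 / 5) * t^2 + 10 / 3 * t ^ 3 + 30 * t ^ 4 * \<beta> t + 12 * t ^ 5 * deriv \<beta> t + t ^ 6 * deriv (deriv \<beta>) t) (at t)"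
      by (rule derivative_eq_intros db[OF t] refl | simp)+
    then have "(deriv g has_field_derivative
       a * (6 / 5) * t^2 + 10 / 3 * t ^ 3 + 30 * t ^ 4 * \<beta> t + 12 * t ^ 5 * deriv \<beta> t + t ^ 6 * deriv (deriv \<beta>) t) (at t)"
      by (rule has_field_derivative_transform_within_open[OF _ open_ball t]) (simp add: dg)
    then show ?thesis by (rule DERIV_imp_deriv)
  qed
  have bode': "t * deriv (deriv \<beta>) t + 8 * deriv \<beta> t = 6 * t * (v t)^2" if t: "t \<in> ball 0 \<rho>" "t \<noteq> 0" for t
  proof -
    have tr: "t \<in> ball 0 r" using t \<rho>(2) by auto
    \<comment> \<open>By the resonance the terms linear in \<beta> itself drop out, 30 - 24 + 6 - 12
      = 0, and 12 - 4 = 8 remains in front of the first derivative.\<close>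
    have "t^7 * (t * deriv (deriv \<beta>) t + 8 * deriv \<beta> t)
      = (t^2 * deriv (deriv g) t - 4 * (t * deriv g t) + 6 * g t) - 6 * (g t * g t) + (a * t ^ 4 + t ^ 5) + 6 * t ^ 8 * (v t)^2"
      unfolding dg[OF t(1)] dg2[OF t(1)] gv[OF t(1)] by (simp add: v_def field_simps eval_nat_numeral)
    also have "\<dots> = 6 * t ^ 8 * (v t)^2"
      unfolding E[OF tr t(2)] by simp
    also have "\<dots> = t^7 * (6 * t * (v t)^2)"
      using power_add[of t 7 1] by (simp add: mult_ac)
    finally show ?thesis by (rule mult_left_cancel[THEN iffD1, rotated]) (use t(2) in simp)
  qed
  have "(\<lambda>t. t * deriv (deriv \<beta>) t + 8 * deriv \<beta> t) holomorphic_on ball 0 \<rho>"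
    by (auto intro!: holomorphic_on_add holomorphic_on_mult \<beta>1 \<beta>2)
  moreover have "(\<lambda>t. 6 * t * (v t)^2) holomorphic_on ball 0 \<rho>"
    unfolding v_def by (auto intro!: holomorphic_intros \<beta>)
  ultimately have "(\<lambda>t. t * deriv (deriv \<beta>) t + 8 * deriv \<beta> t) 0 = (\<lambda>t. 6 * t * (v t)^2) 0"
    by (rule eq_at_0_if_eq_punctured[OF _ _ \<rho>(1) bode'])
  then have bode: "t * deriv (deriv \<beta>) t + 8 * deriv \<beta> t = 6 * t * (v t)^2" if "t \<in> ball 0 \<rho>" for t
    using that bode' by (cases "t = 0") auto
  show ?thesis
  proof (rule that[of \<rho> \<beta>])
    fix t :: complex assume t: "t \<in> ball 0 \<rho>"
    show "t * deriv (deriv \<beta>) t + 8 * deriv \<beta> t = 6 * t * (a / 10 + t / 6 + t^2 * \<beta> t)^2"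
      using bode[OF t] by (simp add: v_def)
    assume t0: "t \<noteq> 0"
    have tr: "t \<in> ball 0 r" using t \<rho>(2) by auto
    show "\<not> is_pole y (a + t)" by (rule np[OF tr t0])
    have "y (a + t) = (1 + t ^ 4 * v t) / t^2" using eq[OF tr t0] gv[OF t] by (simp add: n2)
    also have "\<dots> = 1 / t^2 + t^2 * v t" using t0 by (simp add: field_simps eval_nat_numeral)
    finally show "y (a + t) = 1 / t^2 + t^2 * (a / 10 + t / 6 + t^2 * \<beta> t)" by (simp add: v_def)
  qed (use \<rho> \<beta> in auto)
qed

text \<open>The gauge matrix is \<open>[[- 1 / t, 1 / t^2 + l], [0, t]]\<close>, of determinant -1.
  Against the Laurent expansion of \<open>y\<close> it cancels all negative powers of
  \<open>t\<close>. At \<open>t = 0\<close> there remain \<open>A22 = 0\<close>,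
  \<open>A21 = 2\<close> and \<open>A12 = 2 l^3 - a l - 14 \<beta>\<close>, the oscillator in the
  unknowns (\<Psi>' / 2, \<Psi>): the linear term comes from \<open>10 * v\<close>, as
  \<open>v = a / 10\<close> there.\<close>

lemma lax_gauge:
  fixes t l a v v1 \<beta> \<beta>1 Y d u w :: complex
  assumes t: "t \<noteq> 0" and v: "v = a / 10 + t / 6 + t^2 * \<beta>" and v1: "v1 = 1 / 6 + 2 * t * \<beta> + t^2 * \<beta>1"
    and Y: "Y = 1 / t^2 + t^2 * v" and d: "d = - 2 / t^3 + 2 * t * v + t^2 * v1"
  defines "A22 \<equiv> 2 * t * l^2 - 2 * t^3 * v * l - 4 * t * v - t^2 * v1"
    and "A12 \<equiv> 2 * l^3 - 2 * t^2 * v * l^2 - (10 * v + 2 * t * v1) * l - 14 * \<beta> - 2 * t * \<beta>1 - 2 * t^2 * v^2"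
    and "A21 \<equiv> 2 - 2 * t^2 * l + 2 * t^4 * v"
  shows "- (d * u + lax_entry Y (a + t) l * w) / t + (w + (1 / t^2 + l) * (2 * (l - Y) * u - d * w))
      = - A22 * (- u / t + (1 / t^2 + l) * w) + A12 * (t * w)"
    and "t * (2 * (l - Y) * u - d * w) = A21 * (- u / t + (1 / t^2 + l) * w) - (- A22) * (t * w)"
proof -
  have a: "a = 10 * (v - t / 6 - t^2 * \<beta>)" unfolding v by simp
  have 1: "- d / t + (1 / t^2 + l) * (2 * (l - Y)) = A22 / t"
    unfolding A22_def d Y using t by (simp add: field_simps eval_nat_numeral)
  have 2: "- lax_entry Y (a + t) l / t + 1 - (1 / t^2 + l) * d = - A22 * (1 / t^2 + l) + A12 * t"
    unfolding A22_def A12_def d Y lax_entry_def a v1 using t by (simp add: field_simps eval_nat_numeral)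
  have "- (d * u + lax_entry Y (a + t) l * w) / t + (w + (1 / t^2 + l) * (2 * (l - Y) * u - d * w))
      = (- d / t + (1 / t^2 + l) * (2 * (l - Y))) * u + (- lax_entry Y (a + t) l / t + 1 - (1 / t^2 + l) * d) * w"
    using t by (simp add: divide_simps) (simp add: algebra_simps)
  also have "\<dots> = - A22 * (- u / t + (1 / t^2 + l) * w) + A12 * (t * w)"
    unfolding 1 2 using t by (simp add: divide_simps) (simp add: algebra_simps)
  finally show "- (d * u + lax_entry Y (a + t) l * w) / t + (w + (1 / t^2 + l) * (2 * (l - Y) * u - d * w))
      = - A22 * (- u / t + (1 / t^2 + l) * w) + A12 * (t * w)" .
  show "t * (2 * (l - Y) * u - d * w) = A21 * (- u / t + (1 / t^2 + l) * w) - (- A22) * (t * w)"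
    unfolding A22_def A21_def d Y using t by (simp add: field_simps eval_nat_numeral)
qed

section \<open>Passage to the oscillator at the pole\<close>

lemma PI_pole_stokes:
  assumes PI: "PI_transcendent y" and pole: "is_pole y a"
  shows "\<exists>b z. \<not> is_pole y z \<and> (\<forall>k. PI_stokes y z k = cubic_stokes a b k)"
proof -
  obtain r \<beta> where r: "0 < r" and \<beta>: "\<beta> holomorphic_on ball 0 r"
    and np: "\<And>t. t \<in> ball 0 r \<Longrightarrow> t \<noteq> 0 \<Longrightarrow> \<not> is_pole y (a + t)"
    and eq: "\<And>t. t \<in> ball 0 r \<Longrightarrow> t \<noteq> 0 \<Longrightarrow> y (a + t) = 1 / t^2 + t^2 * (a / 10 + t / 6 + t^2 * \<beta> t)"
    and ode: "\<And>t. t \<in> ball 0 r \<Longrightarrow> t * deriv (deriv \<beta>) t + 8 * deriv \<beta> t = 6 * t * (a / 10 + t / 6 + t^2 * \<beta> t)^2"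
    by (rule PI_pole_expansion[OF PI pole]) (rule that; assumption)
  define S where "S = ball (0::complex) r"
  have S: "open S" "convex S" "0 \<in> S" using r by (auto simp: S_def)
  define \<beta>1 where "\<beta>1 = deriv \<beta>"
  have \<beta>1h: "\<beta>1 holomorphic_on S" unfolding \<beta>1_def S_def using \<beta> by (rule holomorphic_deriv) simp
  have db: "(\<beta> has_field_derivative \<beta>1 t) (at t)" "(\<beta>1 has_field_derivative deriv \<beta>1 t) (at t)" if "t \<in> S" for t
    using that \<beta> \<beta>1h S(1) unfolding \<beta>1_def S_def by (auto intro: holomorphic_derivI)
  define v where "v = (\<lambda>t. a / 10 + t / 6 + t^2 * \<beta> t)"
  define v1 where "v1 = (\<lambda>t. 1 / 6 + 2 * t * \<beta> t + t^2 * \<beta>1 t)"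
  have \<beta>S: "\<beta> holomorphic_on S" using \<beta> by (simp add: S_def)
  have vh: "v holomorphic_on S" unfolding v_def by (intro holomorphic_intros \<beta>S) auto
  have dv: "(v has_field_derivative v1 t) (at t)" if "t \<in> S" for t
    unfolding v_def v1_def by (rule derivative_eq_intros db(1)[OF that] refl | simp)+
  \<comment> \<open>\<open>TV\<close> is \<open>t * v2\<close> with the second derivative of \<beta>
    eliminated by its equation; in this form the curvature conditions become polynomial
    identities.\<close>
  define TV where "TV = (\<lambda>t. 2 * t * \<beta> t + 4 * t^2 * \<beta>1 t + t^2 * (6 * t * (v t)^2 - 8 * \<beta>1 t))"
  define v2 where "v2 = (\<lambda>t. 2 * \<beta> t + 4 * t * \<beta>1 t + t^2 * deriv \<beta>1 t)"
  have dv1: "(v1 has_field_derivative v2 t) (at t)" if "t \<in> S" for t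
    unfolding v1_def v2_def by (rule derivative_eq_intros db[OF that] refl | simp)+
  have tb2: "t * deriv \<beta>1 t = 6 * t * (v t)^2 - 8 * \<beta>1 t" if "t \<in> S" for t
    using ode[of t] that by (simp add: S_def \<beta>1_def v_def algebra_simps)
  have tv2: "t * v2 t = TV t" if "t \<in> S" for t
    unfolding TV_def tb2[OF that, symmetric] v2_def by (simp add: algebra_simps power2_eq_square)
  define A22 where "A22 l t = 2 * t * l^2 - 2 * t^3 * v t * l - 4 * t * v t - t^2 * v1 t" for l t
  define A12 where "A12 l t = 2 * l^3 - 2 * t^2 * v t * l^2 - (10 * v t + 2 * t * v1 t) * l - 14 * \<beta> t - 2 * t * \<beta>1 t - 2 * t^2 * (v t)^2" for l t
  define A21 where "A21 l t = 2 - 2 * t^2 * l + 2 * t^4 * v t" for l t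
  define t0 where "t0 = complex_of_real (r / 2)"
  have t0: "t0 \<in> S" "t0 \<noteq> 0" using r by (auto simp: t0_def S_def)
  have "\<exists>t11 t12 t21 t22 :: complex \<Rightarrow> complex. \<exists>C.
    (\<forall>u w. lax_ode (\<lambda>l. - A22 l t0) (\<lambda>l. A12 l t0) (\<lambda>l. A21 l t0) u w \<longrightarrow>
       lax_ode (\<lambda>l. - A22 l 0) (\<lambda>l. A12 l 0) (\<lambda>l. A21 l 0)
         (\<lambda>l. t11 l * u l + t12 l * w l) (\<lambda>l. t21 l * u l + t22 l * w l)) \<and>
    (\<forall>l. t11 l * t22 l - t12 l * t21 l = 1) \<and>
    (\<forall>l. norm (t11 l) \<le> exp (C * (1 + norm l^2)) \<and> norm (t12 l) \<le> exp (C * (1 + norm l^2)) \<and>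
         norm (t21 l) \<le> exp (C * (1 + norm l^2)) \<and> norm (t22 l) \<le> exp (C * (1 + norm l^2)))"
  \<comment> \<open>The gauge transform of \<open>[[0, - l - 2 y], [-1, 0]]\<close> is
    \<open>[[t l, 2 v - l^2], [t^2, - t l]]\<close>, which has no pole at \<open>t = 0\<close>; this
    gives \<open>p\<close>, \<open>q\<close>, \<open>s\<close>, \<open>q1\<close> and
    \<open>q2\<close>.\<close>
  proof (rule isomonodromic_transport[where ?A11.0 = "\<lambda>l t. - A22 l t" and ?A12.0 = A12 and ?A21.0 = A21
      and A11' = "\<lambda>l t. - (2 * l^2 - (6 * t^2 * v t + 2 * t^3 * v1 t) * l - 4 * v t - 6 * t * v1 t - t * TV t)"
      and A12' = "\<lambda>l t. - (4 * t * v t + 2 * t^2 * v1 t) * l^2 - (12 * v1 t + 2 * TV t) * l - 16 * \<beta>1 t - 2 * (6 * t * (v t)^2 - 8 * \<beta>1 t) - 4 * t * (v t)^2 - 4 * t^2 * v t * v1 t"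
      and A21' = "\<lambda>l t. - 4 * t * l + 8 * t^3 * v t + 2 * t^4 * v1 t"
      and p = "\<lambda>t. t" and q = "\<lambda>t. 2 * v t" and s = "\<lambda>t. t^2" and ?q1.0 = 0 and ?q2.0 = "-1", OF S(1,2) t0(1) S(3)])
    show "(\<lambda>t. t) holomorphic_on S" "(\<lambda>t. 2 * v t) holomorphic_on S" "(\<lambda>t. t^2) holomorphic_on S"
      by (intro holomorphic_intros vh)+
    fix l t assume t: "t \<in> S"
    have "((\<lambda>t. - A22 l t) has_field_derivative - (2 * l^2 - (6 * t^2 * v t + 2 * t^3 * v1 t) * l - 4 * v t - 6 * t * v1 t - t * (t * v2 t))) (at t)"
      unfolding A22_def by (rule derivative_eq_intros dv[OF t] dv1[OF t] refl | simp)+ (simp add: algebra_simps eval_nat_numeral)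
    then show "((\<lambda>t. - A22 l t) has_field_derivative - (2 * l^2 - (6 * t^2 * v t + 2 * t^3 * v1 t) * l - 4 * v t - 6 * t * v1 t - t * TV t)) (at t)"
      unfolding tv2[OF t] .
    have "(A12 l has_field_derivative - (4 * t * v t + 2 * t^2 * v1 t) * l^2 - (12 * v1 t + 2 * (t * v2 t)) * l - 16 * \<beta>1 t - 2 * (t * deriv \<beta>1 t) - 4 * t * (v t)^2 - 4 * t^2 * v t * v1 t) (at t)"
      unfolding A12_def[abs_def] by (rule derivative_eq_intros dv[OF t] dv1[OF t] db[OF t] refl | simp)+ (simp add: algebra_simps eval_nat_numeral)
    then show "(A12 l has_field_derivative - (4 * t * v t + 2 * t^2 * v1 t) * l^2 - (12 * v1 t + 2 * TV t) * l - 16 * \<beta>1 t - 2 * (6 * t * (v t)^2 - 8 * \<beta>1 t) - 4 * t * (v t)^2 - 4 * t^2 * v t * v1 t) (at t)"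
      unfolding tv2[OF t] tb2[OF t] .
    show "(A21 l has_field_derivative - 4 * t * l + 8 * t^3 * v t + 2 * t^4 * v1 t) (at t)"
      unfolding A21_def[abs_def] by (rule derivative_eq_intros dv[OF t] refl | simp)+
    show "- (2 * l^2 - (6 * t^2 * v t + 2 * t^3 * v1 t) * l - 4 * v t - 6 * t * v1 t - t * TV t)
       = t - (A12 l t * t^2 - (2 * v t + 0 * l + -1 * l^2) * A21 l t)"
      unfolding A12_def A21_def TV_def v1_def by (simp add: algebra_simps eval_nat_numeral)
    show "- (4 * t * v t + 2 * t^2 * v1 t) * l^2 - (12 * v1 t + 2 * TV t) * l - 16 * \<beta>1 t - 2 * (6 * t * (v t)^2 - 8 * \<beta>1 t) - 4 * t * (v t)^2 - 4 * t^2 * v t * v1 t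
       = 0 + 2 * -1 * l - (2 * (- A22 l t) * (2 * v t + 0 * l + -1 * l^2) - 2 * A12 l t * (t * l))"
      unfolding A12_def A22_def TV_def v1_def by (simp add: algebra_simps eval_nat_numeral)
    show "- 4 * t * l + 8 * t^3 * v t + 2 * t^4 * v1 t = - (2 * A21 l t * (t * l) - 2 * (- A22 l t) * t^2)"
      unfolding A21_def A22_def by (simp add: algebra_simps eval_nat_numeral)
  qed
  then obtain t11 t12 t21 t22 C where t:
    "\<forall>u w. lax_ode (\<lambda>l. - A22 l t0) (\<lambda>l. A12 l t0) (\<lambda>l. A21 l t0) u w \<longrightarrow>
       lax_ode (\<lambda>l. - A22 l 0) (\<lambda>l. A12 l 0) (\<lambda>l. A21 l 0)
         (\<lambda>l. t11 l * u l + t12 l * w l) (\<lambda>l. t21 l * u l + t22 l * w l)"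
    "\<forall>l. t11 l * t22 l - t12 l * t21 l = 1"
    "\<forall>l. norm (t11 l) \<le> exp (C * (1 + norm l^2)) \<and> norm (t12 l) \<le> exp (C * (1 + norm l^2)) \<and>
         norm (t21 l) \<le> exp (C * (1 + norm l^2)) \<and> norm (t22 l) \<le> exp (C * (1 + norm l^2))"
    by blast
  define z where "z = a + t0"
  define b where "b = \<beta> 0"
  interpret P: pi_point y z .
  interpret O: cubic_oscillator a b .
  interpret lax_pair z "(deriv y z)^2 - 4 * (y z)^3 + 2 * z * y z" "deriv y z" "y z" lax_degree "lax_entry (y z) z"
    a "- 28 * b" 0 0 0 "cubic_entry a b"
    by unfold_locales
  have npz: "\<not> is_pole y z" using np[of t0] t0 by (simp add: z_def S_def)
  have yz: "y z = 1 / t0^2 + t0^2 * v t0" using eq[of t0] t0 by (simp add: z_def S_def v_def)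
  have dz: "deriv y z = - 2 / t0^3 + 2 * t0 * v t0 + t0^2 * v1 t0"
  proof -
    have "((\<lambda>t. y (a + t)) has_field_derivative deriv y z * 1) (at t0)"
      using PI_transcendent_at(2)[OF PI npz] unfolding z_def
      by (intro DERIV_chain2) (auto intro!: derivative_eq_intros)
    then have "((\<lambda>t. 1 / t^2 + t^2 * v t) has_field_derivative deriv y z * 1) (at t0)"
    proof (rule has_field_derivative_transform_within_open)
      show "open (S - {0})" using S(1) by (simp add: open_Diff)
      show "t0 \<in> S - {0}" using t0 by simp
      show "y (a + t) = 1 / t^2 + t^2 * v t" if "t \<in> S - {0}" for t
        using eq[of t] that by (simp add: S_def v_def)
    qed
    moreover have "((\<lambda>t. 1 / t^2 + t^2 * v t) has_field_derivative - 2 / t0^3 + (2 * t0 * v t0 + t0^2 * v1 t0)) (at t0)"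
    proof (rule DERIV_add)
      have "((\<lambda>t. t^2) has_field_derivative 2 * t0) (at t0)" by (auto intro!: derivative_eq_intros)
      then have "((\<lambda>t. inverse (t^2)) has_field_derivative - (inverse (t0^2) * (2 * t0) * inverse (t0^2))) (at t0)"
        by (rule DERIV_inverse') (use t0(2) in simp)
      moreover have "- (inverse (t0^2) * (2 * t0) * inverse (t0^2)) = - 2 / t0^3"
        using t0(2) by (simp add: field_simps eval_nat_numeral)
      ultimately show "((\<lambda>t. 1 / t^2) has_field_derivative - 2 / t0^3) (at t0)"
        by (simp only: inverse_eq_divide)
      show "((\<lambda>t. t^2 * v t) has_field_derivative 2 * t0 * v t0 + t0^2 * v1 t0) (at t0)"
        by (rule derivative_eq_intros dv[OF t0(1)] refl | simp)+
    qed
    ultimately have "deriv y z * 1 = - 2 / t0^3 + (2 * t0 * v t0 + t0^2 * v1 t0)" by (rule DERIV_unique)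
    then show ?thesis by simp
  qed
  \<comment> \<open>The transport multiplied on the right by the gauge matrix at \<open>t0\<close>,
    which turns its determinant 1 into -1.\<close>
  define s11 where "s11 l = - t11 l / t0" for l
  define s12 where "s12 l = t11 l * (1 / t0^2 + l) + t12 l * t0" for l
  define s21 where "s21 l = - t21 l / t0" for l
  define s22 where "s22 l = t21 l * (1 / t0^2 + l) + t22 l * t0" for l
  have sol: "O.solution (\<lambda>l. s11 l * u l + s12 l * w l) (\<lambda>l. s21 l * u l + s22 l * w l)" if uw: "P.solution u w" for u w
  proof -
    define X1 where "X1 l = - u l / t0 + (1 / t0^2 + l) * w l" for l
    define X2 where "X2 l = t0 * w l" for l
    have du: "(u has_field_derivative deriv y z * u l + lax_entry (y z) z l * w l) (at l)"
      and dw: "(w has_field_derivative 2 * (l - y z) * u l - deriv y z * w l) (at l)" for l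
      using uw unfolding P.solution_def P.f_eq by auto
    have "lax_ode (\<lambda>l. - A22 l t0) (\<lambda>l. A12 l t0) (\<lambda>l. A21 l t0) X1 X2"
      unfolding lax_ode_def
    proof (intro allI conjI)
      fix l
      have lin: "((\<lambda>l. 1 / t0^2 + l) has_field_derivative 1) (at l)" by (auto intro!: derivative_eq_intros)
      have "(X1 has_field_derivative - (deriv y z * u l + lax_entry (y z) z l * w l) / t0
          + (1 * w l + (2 * (l - y z) * u l - deriv y z * w l) * (1 / t0^2 + l))) (at l)"
        unfolding X1_def[abs_def] by (intro DERIV_add DERIV_mult DERIV_cdivide DERIV_minus du dw lin)
      then show "(X1 has_field_derivative - A22 l t0 * X1 l + A12 l t0 * X2 l) (at l)"
        using lax_gauge(1)[OF t0(2) v_def[THEN fun_cong] v1_def[THEN fun_cong] yz dz, of "u l" l "w l"]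
        unfolding X1_def X2_def A22_def A12_def z_def[symmetric] by (simp only: mult_1 mult.commute[of "1 / t0^2 + l"])
      have "(X2 has_field_derivative t0 * (2 * (l - y z) * u l - deriv y z * w l)) (at l)"
        unfolding X2_def[abs_def] by (intro DERIV_cmult dw)
      then show "(X2 has_field_derivative A21 l t0 * X1 l - - A22 l t0 * X2 l) (at l)"
        using lax_gauge(2)[OF t0(2) v_def[THEN fun_cong] v1_def[THEN fun_cong] yz dz, of l "u l" "w l"]
        unfolding X1_def X2_def A22_def A21_def by (simp only:)
    qed
    then have L: "lax_ode (\<lambda>l. - A22 l 0) (\<lambda>l. A12 l 0) (\<lambda>l. A21 l 0)
         (\<lambda>l. t11 l * X1 l + t12 l * X2 l) (\<lambda>l. t21 l * X1 l + t22 l * X2 l)"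
      using t(1) by blast
    have eqs: "(\<lambda>l. t11 l * X1 l + t12 l * X2 l) = (\<lambda>l. s11 l * u l + s12 l * w l)"
      "(\<lambda>l. t21 l * X1 l + t22 l * X2 l) = (\<lambda>l. s21 l * u l + s22 l * w l)"
      by (simp_all add: X1_def X2_def s11_def s12_def s21_def s22_def algebra_simps)
    have A0: "A22 l 0 = 0" "A12 l 0 = cubic_entry a b l" "A21 l 0 = 2" for l
      by (simp_all add: A22_def A12_def A21_def cubic_entry_def v_def b_def)
    show ?thesis
      using L unfolding eqs O.solution_iff lax_ode_def A0 by simp
  qed
  \<comment> \<open>The entries of the gauge matrix are at most \<open>c * (1 + norm l^2)\<close>,
    and x \<le> exp x moves this factor into the exponent.\<close>
  define c where "c = 1 / norm t0 + 1 / norm t0^2 + norm t0 + 1"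
  have c: "0 \<le> c" by (simp add: c_def)
  have grow: "norm (x / t0) \<le> exp ((C + c) * (1 + norm l^2))" "norm (x * (1 / t0^2 + l) + x' * t0) \<le> exp ((C + c) * (1 + norm l^2))"
    if x: "norm x \<le> exp (C * (1 + norm l^2))" "norm x' \<le> exp (C * (1 + norm l^2))" for x x' l
  proof -
    define E where "E = exp (C * (1 + norm l^2))"
    have E: "0 \<le> E" by (simp add: E_def)
    have "0 \<le> (norm l - 1)^2" by simp
    then have "2 * norm l \<le> 1 + norm l^2" by (simp add: power2_eq_square algebra_simps)
    then have nl: "norm l \<le> 1 + norm l^2" using norm_ge_zero[of l] by linarith
    have n1: "1 \<le> 1 + norm l^2" by simp
    have e1: "c * (1 + norm l^2) \<le> exp (c * (1 + norm l^2))" using exp_ge_add_one_self[of "c * (1 + norm l^2)"] by linarith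
    have e2: "E * exp (c * (1 + norm l^2)) = exp ((C + c) * (1 + norm l^2))"
      by (simp add: E_def exp_add[symmetric] ring_distribs)
    have c1: "1 / norm t0 \<le> c * (1 + norm l^2)"
    proof -
      have "1 / norm t0 * 1 \<le> c * (1 + norm l^2)" using n1 c by (intro mult_mono) (auto simp: c_def)
      then show ?thesis by simp
    qed
    have c2: "1 / norm t0^2 + norm l + norm t0 \<le> c * (1 + norm l^2)"
    proof -
      have "A + n + N \<le> (B + A + N + 1) * p"
        if "0 \<le> A" "0 \<le> N" "0 \<le> B" "1 \<le> p" "n \<le> p" for A n N B p :: real
      proof -
        have "A * 1 \<le> A * p" "N * 1 \<le> N * p" "0 \<le> B * p" by (intro mult_left_mono mult_nonneg_nonneg; use that in auto)+
        then show ?thesis using that(5) unfolding ring_distribs by linarith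
      qed
      from this[of "1 / norm t0^2" "norm t0" "1 / norm t0" "1 + norm l^2" "norm l"]
      show ?thesis using nl unfolding c_def by simp
    qed
    have "norm (x / t0) = norm x * (1 / norm t0)" by (simp add: norm_divide)
    also have "\<dots> \<le> E * (c * (1 + norm l^2))" using x(1) c1 E by (intro mult_mono) (auto simp: E_def)
    also have "\<dots> \<le> E * exp (c * (1 + norm l^2))" using e1 E by (rule mult_left_mono)
    finally show "norm (x / t0) \<le> exp ((C + c) * (1 + norm l^2))" unfolding e2 .
    have "norm (x * (1 / t0^2 + l) + x' * t0) \<le> norm x * norm (1 / t0^2 + l) + norm x' * norm t0"
      using norm_triangle_ineq[of "x * (1 / t0^2 + l)" "x' * t0"] by (simp only: norm_mult)
    also have "\<dots> \<le> E * (1 / norm t0^2 + norm l) + E * norm t0"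
      using x E norm_triangle_ineq[of "1 / t0^2" l] by (intro add_mono mult_mono) (auto simp: E_def norm_divide norm_power)
    also have "\<dots> = E * (1 / norm t0^2 + norm l + norm t0)" by (simp add: ring_distribs)
    also have "\<dots> \<le> E * (c * (1 + norm l^2))" using c2 E by (rule mult_left_mono)
    also have "\<dots> \<le> E * exp (c * (1 + norm l^2))" using e1 E by (rule mult_left_mono)
    finally show "norm (x * (1 / t0^2 + l) + x' * t0) \<le> exp ((C + c) * (1 + norm l^2))" unfolding e2 .
  qed
  \<comment> \<open>The periods are \<open>- \<i>\<close> and \<open>\<i>\<close>, so the
    multipliers of the frames change sign; the sign in \<open>cubic_stokes_eq\<close> undoes
    this.\<close>
  have per: "P.period = -1 * O.period"
  proof -
    have "cis (- (3 * pi / 2)) = cis (- (pi / 2)) * cis (- pi)"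
      unfolding cis_mult by (rule arg_cong[of _ _ cis]) simp
    then have "cis (- (3 * pi / 2)) = \<i>" by (simp add: complex_eq_iff)
    then show ?thesis unfolding P.period_def O.period_def P.nu_eq O.nu_eq by simp
  qed
  have "O.stokes k = -1 * P.stokes k" for k
  proof (rule stokes_transport[where \<tau> = "-1", OF sol])
    fix l
    show "s11 l * s22 l - s12 l * s21 l = -1"
    proof -
      have "s11 l * s22 l - s12 l * s21 l = - (t11 l * t22 l - t12 l * t21 l)"
        using t0(2) by (simp add: s11_def s12_def s21_def s22_def field_simps)
      then show ?thesis using t(2) by simp
    qed
    have T: "norm (t11 l) \<le> exp (C * (1 + norm l^2))" "norm (t12 l) \<le> exp (C * (1 + norm l^2))"
      "norm (t21 l) \<le> exp (C * (1 + norm l^2))" "norm (t22 l) \<le> exp (C * (1 + norm l^2))"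
      using t(3) by auto
    show "norm (s11 l) \<le> exp ((C + c) * (1 + norm l^2))" "norm (s12 l) \<le> exp ((C + c) * (1 + norm l^2))"
      "norm (s21 l) \<le> exp ((C + c) * (1 + norm l^2))" "norm (s22 l) \<le> exp ((C + c) * (1 + norm l^2))"
      using grow(1)[OF T(1,2)] grow(2)[OF T(1,2)] grow(1)[OF T(3,4)] grow(2)[OF T(3,4)]
      unfolding s11_def s12_def s21_def s22_def by (simp_all only: minus_divide_left[symmetric] norm_minus_cancel)
  qed (use per in auto)
  then have "PI_stokes y z k = cubic_stokes a b k" for k by (simp add: P.PI_stokes_eq O.cubic_stokes_eq)
  then show ?thesis using npz by blast
qed

section \<open>Points that are not poles\<close>

text \<open>Finitely many closed sectors between consecutive central rays cover all directions, so
  limits in each of them combine to a limit at infinity.\<close>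

lemma sector_halves:
  assumes "l \<noteq> 0"
  obtains k :: int and \<theta> where "k \<in> {-3..3}" "is_Arg l \<theta>" "\<bar>\<theta> - (central k + pi / 5)\<bar> \<le> pi / 5"
proof -
  define \<theta> where "\<theta> = Arg l"
  have \<theta>: "is_Arg l \<theta>" "- pi < \<theta>" "\<theta> \<le> pi" using assms by (auto simp: \<theta>_def is_Arg_Arg mpi_less_Arg Arg_le_pi)
  define k where "k = \<lfloor>\<theta> * 5 / (2 * pi)\<rfloor>"
  have k: "of_int k \<le> \<theta> * 5 / (2 * pi)" "\<theta> * 5 / (2 * pi) < of_int k + 1" by (auto simp: k_def)
  have c: "central k \<le> \<theta>" "\<theta> < central k + 2 * pi / 5"
    using k pi_gt_zero by (auto simp: central_def field_simps)
  have "-3 \<le> k"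
  proof -
    have "- (5/2) < \<theta> * 5 / (2 * pi)" using \<theta>(2) pi_gt_zero by (simp add: field_simps)
    then show ?thesis unfolding k_def by linarith
  qed
  moreover have "k \<le> 3"
  proof -
    have "\<theta> * 5 / (2 * pi) \<le> 5/2" using \<theta>(3) pi_gt_zero by (simp add: field_simps)
    then show ?thesis unfolding k_def by linarith
  qed
  moreover have "\<bar>\<theta> - (central k + pi / 5)\<bar> \<le> pi / 5" using c by linarith
  ultimately show ?thesis using that \<theta>(1) by auto
qed

text \<open>
  With equal Stokes multipliers the functions \<open>U_k \<Psi>_(k+1) - U_(k+1) \<Psi>_k\<close> agree up to sign for all \<open>k\<close>, hence
  vanish at infinity in all directions: the exponentials cancel, and the algebraic factors decay because
  the two systems have different formal exponents.
\<close>

lemma no_common_stokes: "\<exists>k. PI_stokes y a k \<noteq> cubic_stokes a b k"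
proof (rule ccontr)
  interpret P: pi_point y a .
  interpret O: cubic_oscillator a b .
  assume "\<nexists>k. PI_stokes y a k \<noteq> cubic_stokes a b k"
  then have st: "P.stokes k = - O.stokes k" for k by (simp add: P.PI_stokes_eq O.cubic_stokes_eq)
  \<comment> \<open>The alternating sign turns the recursion of the oscillator frame, with
    multipliers \<open>- P.stokes k\<close>, into the recursion of the Lax frame.\<close>
  define Q where "Q k l = (-1) powi k * O.W k l" for k l
  have Qrel: "Q (k - 1) l = Q (k + 1) l + P.stokes k * Q k l" for k l
    unfolding Q_def st O.stokes_relation(2)[of k l] by (simp add: power_int_add power_int_diff algebra_simps)
  \<comment> \<open>The closed sector between the central rays of \<open>k\<close> and
    \<open>k + 1\<close>, where the asymptotics of both indices hold and their phases have
    reciprocal moduli.\<close>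
  define T where "T k = inf at_infinity (principal {l. l \<noteq> 0 \<and> (\<exists>\<theta>. is_Arg l \<theta> \<and> \<bar>\<theta> - (central k + pi / 5)\<bar> \<le> pi / 5)})" for k
  have c1: "central (k + 1) = central k + 2 * pi / 5" for k by (simp add: central_def ring_distribs add_divide_distrib)
  have T1: "T k \<le> sector_at_infinity k (pi / 10)" "T k \<le> sector_at_infinity (k + 1) (pi / 10)" for k
  proof -
    have "\<bar>\<theta> - central k\<bar> < 3 * pi / 5 - pi / 10" "\<bar>\<theta> - central (k + 1)\<bar> < 3 * pi / 5 - pi / 10"
      if "\<bar>\<theta> - (central k + pi / 5)\<bar> \<le> pi / 5" for \<theta>
      using that pi_gt_zero c1[of k] by linarith+
    then show "T k \<le> sector_at_infinity k (pi / 10)" "T k \<le> sector_at_infinity (k + 1) (pi / 10)"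
      unfolding T_def sector_at_infinity_def sector_def central_def by (intro inf_mono; auto)+
  qed
  have Targ: "\<forall>\<^sub>F l in T k. norm (P.phase k l) * norm (P.phase (k + 1) l) = 1" for k
    unfolding T_def eventually_inf_principal
  proof (rule always_eventually, intro allI impI)
    fix l assume "l \<in> {l. l \<noteq> 0 \<and> (\<exists>\<theta>. is_Arg l \<theta> \<and> \<bar>\<theta> - (central k + pi / 5)\<bar> \<le> pi / 5)}"
    then obtain \<theta> where \<theta>: "l \<noteq> 0" "is_Arg l \<theta>" "\<bar>\<theta> - (central k + pi / 5)\<bar> \<le> pi / 5" by blast
    have "\<bar>\<theta> - central k\<bar> < 3 * pi / 5" "\<bar>\<theta> - central (k + 1)\<bar> < 3 * pi / 5"
      using \<theta>(3) pi_gt_zero c1[of k] by linarith+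
    then have "branch_arg k l = \<theta>" "branch_arg (k + 1) l = \<theta>"
      using \<theta> by (auto intro!: branch_arg_eq simp: central_def)
    then have "branch_sqrt (k + 1) l = - branch_sqrt k l"
      by (simp add: branch_sqrt_def power_int_add)
    then show "norm (P.phase k l) * norm (P.phase (k + 1) l) = 1"
      by (simp add: P.phase_def norm_exp exp_add[symmetric])
  qed
  have big: "\<forall>\<^sub>F l in T k. 1 \<le> norm l \<and> 2 * norm (y a) \<le> norm l" for k
  proof -
    have "\<forall>\<^sub>F l in at_infinity. 1 \<le> norm (l::complex) \<and> 2 * norm (y a) \<le> norm l"
      unfolding eventually_at_infinity by (intro exI[of _ "max 1 (2 * norm (y a))"]) auto
    then show ?thesis unfolding T_def by (rule filter_leD[OF inf_le1])
  qed
  have inv0: "((\<lambda>l. norm l powr (-1/2)) \<longlongrightarrow> 0) (T k)" for k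
    unfolding T_def
    by (intro tendsto_mono[OF inf_le1] tendsto_neg_powr filterlim_norm_at_top) auto
  have lim: "((\<lambda>l. P.U i l * O.W i' l) \<longlongrightarrow> 0) (T k)" "((\<lambda>l. P.W i l * O.W i' l) \<longlongrightarrow> 0) (T k)"
    if i: "i = k \<and> i' = k + 1 \<or> i = k + 1 \<and> i' = k" for i i' k
  proof -
    have le: "T k \<le> sector_at_infinity i (pi / 10)" "T k \<le> sector_at_infinity i' (pi / 10)" using T1 i by auto
    have PA: "((\<lambda>l. P.phase i l * branch_power i (1/4) l * P.W i l) \<longlongrightarrow> 1) (T k)"
      "((\<lambda>l. P.phase i l * branch_power i (1/4) l * (P.f l / branch_sqrt i l ^ 3) * P.U i l) \<longlongrightarrow> -2) (T k)"
      using P.asymptotic_mono[OF le(1) P.frame_asymptotic] unfolding P.asymptotic_def P.nu_eq by auto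
    \<comment> \<open>\<open>phase\<close> depends on the parameter \<open>a\<close> alone. Taking
      both systems at the same \<open>a\<close> gives them the same phase, so the exponentials
      cancel in the mixed products.\<close>
    have OA: "((\<lambda>l. P.phase i' l * branch_power i' (3/4) l * O.W i' l) \<longlongrightarrow> 1) (T k)"
      using O.asymptotic_mono[OF le(2) O.frame_asymptotic] unfolding O.asymptotic_def O.nu_eq by auto
    have phi: "\<forall>\<^sub>F l in T k. norm (P.phase i l) * norm (P.phase i' l) = 1"
      using Targ[of k] i by (auto simp: mult.commute)
    \<comment> \<open>Apart from the phases, \<open>P.W\<close> is of order |l|^(-1/4),
      \<open>P.U\<close> of order |l|^(1/4) and \<open>O.W\<close> of order |l|^(-3/4). The products
      are at most of order |l|^(-1/2), the factor that is split off here.\<close>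
    have z: "((\<lambda>l. norm (P.phase i l * branch_power i (1/4) l * P.W i l) * norm (P.phase i' l * branch_power i' (3/4) l * O.W i' l) * norm l powr (-1/2)) \<longlongrightarrow> norm (1::complex) * norm (1::complex) * 0) (T k)"
      by (intro tendsto_intros PA OA inv0)
    have z': "((\<lambda>l. norm (P.phase i l * branch_power i (1/4) l * (P.f l / branch_sqrt i l ^ 3) * P.U i l) * norm (P.phase i' l * branch_power i' (3/4) l * O.W i' l) * norm l powr (-1/2)) \<longlongrightarrow> norm (-2::complex) * norm (1::complex) * 0) (T k)"
      by (intro tendsto_intros PA OA inv0)
    have pw: "norm l powr (1/4) * norm l powr (3/4) = norm l" "sqrt (norm l) = norm l powr (1/2)"
      if "1 \<le> norm l" for l :: complex
      using that by (auto simp: powr_add[symmetric] powr_half_sqrt)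
    show "((\<lambda>l. P.W i l * O.W i' l) \<longlongrightarrow> 0) (T k)"
    proof (rule Lim_null_comparison[OF _ z[unfolded mult_zero_right]], use phi big[of k] in eventually_elim)
      case (elim l)
      have "norm l powr (-1/2) * norm l \<ge> 1"
      proof -
        have "norm l powr (-1/2) * norm l = norm l powr (1/2)"
          using elim by (simp add: powr_add[symmetric] powr_mult_base mult.commute)
        then show ?thesis using elim by (simp add: ge_one_powr_ge_zero)
      qed
      then have "norm (P.W i l * O.W i' l) * 1 \<le> norm (P.W i l * O.W i' l) * (norm l powr (-1/2) * norm l)"
        by (intro mult_left_mono) auto
      also have "\<dots> = (norm (P.phase i l) * norm (P.phase i' l)) * (norm l powr (1/4) * norm l powr (3/4)) * norm (P.W i l) * norm (O.W i' l) * norm l powr (-1/2)"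
        using elim pw(1)[of l] by (simp add: norm_mult mult_ac)
      also have "\<dots> = norm (P.phase i l * branch_power i (1/4) l * P.W i l) * norm (P.phase i' l * branch_power i' (3/4) l * O.W i' l) * norm l powr (-1/2)"
        unfolding norm_mult norm_branch_power by (simp only: mult_ac)
      finally show ?case by simp
    qed
    show "((\<lambda>l. P.U i l * O.W i' l) \<longlongrightarrow> 0) (T k)"
    proof (rule Lim_null_comparison[OF _ z'[unfolded mult_zero_right]], use phi big[of k] in eventually_elim)
      case (elim l)
      have "norm l \<le> norm (P.f l)"
      proof -
        have "norm (P.f l) = 2 * norm (l - y a)" unfolding P.f_eq norm_mult by simp
        then show ?thesis using conjunct2[OF elim(2)] norm_triangle_ineq2[of l "y a"] by linarith
      qed
      define s where "s = norm l powr (1/2)"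
      have s: "s > 0" "s * s = norm l" "norm l powr (-1/2) = 1 / s"
        using elim by (auto simp: s_def powr_add[symmetric] powr_minus_divide)
      have "1 \<le> norm l * (norm (P.f l) / s ^ 3) * (1 / s)"
        using s \<open>norm l \<le> norm (P.f l)\<close> by (simp add: field_simps eval_nat_numeral flip: s(2))
      then have "norm (P.U i l * O.W i' l) * 1 \<le> norm (P.U i l * O.W i' l) * (norm l * (norm (P.f l) / s ^ 3) * (1 / s))"
        by (intro mult_left_mono) auto
      also have "\<dots> = (norm (P.phase i l) * norm (P.phase i' l)) * (norm l powr (1/4) * norm l powr (3/4)) * (norm (P.f l) / s ^ 3) * norm (P.U i l) * norm (O.W i' l) * norm l powr (-1/2)"
        unfolding s(3) using elim pw(1)[of l] by (simp add: norm_mult mult_ac)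
      also have "\<dots> = norm (P.phase i l * branch_power i (1/4) l * (P.f l / branch_sqrt i l ^ 3) * P.U i l) * norm (P.phase i' l * branch_power i' (3/4) l * O.W i' l) * norm l powr (-1/2)"
        unfolding norm_mult norm_branch_power norm_divide norm_power norm_branch_sqrt s_def pw(2)[OF conjunct1[OF elim(2)]]
        by (simp only: mult_ac)
      finally show ?case by simp
    qed
  qed
  have vanish: "X k l * Q (k + 1) l - X (k + 1) l * Q k l = 0"
    if X: "\<And>k l. X (k - 1) l = X (k + 1) l + P.stokes k * X k l" and hol: "\<And>k. X k holomorphic_on UNIV"
      and lim: "\<And>i i' k. i = k \<and> i' = k + 1 \<or> i = k + 1 \<and> i' = k \<Longrightarrow> ((\<lambda>l. X i l * O.W i' l) \<longlongrightarrow> 0) (T k)"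
    for X :: "int \<Rightarrow> complex \<Rightarrow> complex" and k l
  proof -
    define V where "V k l = X k l * Q (k + 1) l - X (k + 1) l * Q k l" for k l
    \<comment> \<open>\<open>V\<close> is the discrete Wronskian of two solutions of the same
      three-term recursion in \<open>k\<close>. Its modulus is independent of \<open>k\<close>, so
      the single entire function \<open>V 0\<close> is small in every sector.\<close>
    have V1: "V (k + 1) l = - V k l" for k l
      using X[of "k + 1" l] Qrel[of "k + 1" l] unfolding V_def by (simp add: algebra_simps)
    have normV: "norm (V k l) = norm (V 0 l)" for k l
    proof (induction k rule: int_induct[where k = 0])
      case (step2 i) then show ?case using V1[of "i - 1" l] by simp
    qed (simp_all add: V1)
    have VT: "(V k \<longlongrightarrow> 0) (T k)" for k
    proof -
      have "((\<lambda>l. (-1) powi (k + 1) * (X k l * O.W (k + 1) l) - (-1) powi k * (X (k + 1) l * O.W k l)) \<longlongrightarrow> (-1) powi (k + 1) * 0 - (-1) powi k * 0) (T k)"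
        by (intro tendsto_intros lim) auto
      then show ?thesis by (simp add: V_def[abs_def] Q_def mult_ac)
    qed
    have "(V 0 \<longlongrightarrow> 0) at_infinity"
    proof (rule tendstoI)
      fix e :: real assume e: "0 < e"
      have "\<forall>\<^sub>F l in T k. norm (V 0 l) < e" for k
        using tendstoD[OF VT[of k] e] normV[of k] by simp
      then have near: "\<forall>\<^sub>F l in at_infinity. l \<in> {l. l \<noteq> 0 \<and> (\<exists>\<theta>. is_Arg l \<theta> \<and> \<bar>\<theta> - (central k + pi / 5)\<bar> \<le> pi / 5)} \<longrightarrow> norm (V 0 l) < e" for k
        unfolding T_def eventually_inf_principal .
      have "\<forall>\<^sub>F l in at_infinity. \<forall>k\<in>{-3..3::int}. l \<in> {l. l \<noteq> 0 \<and> (\<exists>\<theta>. is_Arg l \<theta> \<and> \<bar>\<theta> - (central k + pi / 5)\<bar> \<le> pi / 5)} \<longrightarrow> norm (V 0 l) < e"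
        by (intro eventually_ball_finite finite_atLeastAtMost_int ballI near)
      moreover have "\<forall>\<^sub>F l in at_infinity. norm (l::complex) \<ge> 1" unfolding eventually_at_infinity by (rule exI[of _ 1]) simp
      ultimately show "\<forall>\<^sub>F l in at_infinity. dist (V 0 l) 0 < e"
      proof eventually_elim
        case (elim l)
        then have "l \<noteq> 0" by auto
        then obtain k \<theta> where "k \<in> {-3..3}" "is_Arg l \<theta>" "\<bar>\<theta> - (central k + pi / 5)\<bar> \<le> pi / 5"
          by (rule sector_halves)
        then have "norm (V 0 l) < e" using elim(1) \<open>l \<noteq> 0\<close> by blast
        then show ?case by simp
      qed
    qed
    moreover have "V 0 holomorphic_on UNIV"
    proof -
      have "O.W k holomorphic_on UNIV" for k
        using O.frame_solution[of k] unfolding O.solution_def holomorphic_on_open[OF open_UNIV] by blast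
      then have "Q k holomorphic_on UNIV" for k unfolding Q_def[abs_def] by (intro holomorphic_intros)
      then show ?thesis unfolding V_def[abs_def] by (intro holomorphic_intros hol)
    qed
    ultimately have "V 0 l = 0" by (intro Liouville_weak_0)
    then have "V k l = 0" using normV[of k l] by simp
    then show ?thesis by (simp add: V_def)
  qed
  have hU: "P.U k holomorphic_on UNIV" and hW: "P.W k holomorphic_on UNIV" for k
    using P.frame_solution[of k] unfolding P.solution_def holomorphic_on_open[OF open_UNIV] by blast+
  \<comment> \<open>The vanishing for both components says that \<open>Q 1\<close> times the frame
    vector of index 0 equals \<open>Q 0\<close> times that of index 1: the Lax frame would be
    linearly dependent wherever \<open>Q 0\<close> is nonzero.\<close>
  have 1: "P.U 0 l * Q 1 l = P.U 1 l * Q 0 l" for l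
    using vanish[of P.U 0 l, OF P.stokes_relation(1) hU lim(1)] by simp
  have 2: "P.W 0 l * Q 1 l = P.W 1 l * Q 0 l" for l
    using vanish[of P.W 0 l, OF P.stokes_relation(2) hW lim(2)] by simp
  obtain l where l: "O.W 0 l \<noteq> 0" using O.W_not_zero by blast
  then have Q0: "Q 0 l \<noteq> 0" by (simp add: Q_def)
  have "(P.U 0 l * P.W 1 l - P.U 1 l * P.W 0 l) * Q 0 l = 0"
    using 1[of l] 2[of l] by algebra
  then show False using Q0 P.frame_det_nonzero[of 0 l] by simp
qed

theorem theorem3:
  fixes y :: "complex \<Rightarrow> complex" and a :: complex
  assumes "PI_transcendent y"
  shows "is_pole y a \<longleftrightarrow> (\<exists>b. PI_monodromy y = cubic_monodromy a b)"
proof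
  assume "is_pole y a"
  then obtain b z where "\<not> is_pole y z" "\<And>k. PI_stokes y z k = cubic_stokes a b k"
    using PI_pole_stokes[OF assms] by blast
  then show "\<exists>b. PI_monodromy y = cubic_monodromy a b"
    using monodromy_eq_iff[OF assms] by blast
next
  assume "\<exists>b. PI_monodromy y = cubic_monodromy a b"
  then obtain b where b: "PI_monodromy y = cubic_monodromy a b" ..
  show "is_pole y a"
  proof (rule ccontr)
    assume "\<not> is_pole y a"
    then show False
      using monodromy_eq_iff[OF assms, of a a b] b no_common_stokes[of y a b] by blast
  qed
qed

end
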